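(* Let $\mathcal F$ be the fusion system of a proper locality $(\mathcal L,\Delta,S)$. Then $\mathcal F$ is saturated.
   Context: Fix a prime $p$. All groups and partial groups are finite; maps are written on the right; $x^g=g^{-1}xg$. **Partial groups.** For a set $\mathcal L$ let $\mathbf W(\mathcal L)$ be the free monoid of words in $\mathcal L$, with concatenation $\circ$ and empty word $\emptyset$; elements of $\mathcal L$ are identified with words of length 1. A partial group is a non-empty set $\mathcal L$ with a subset $\mathbf D=\mathbf D(\mathcal L)\subseteq\mathbf W(\mathcal L)$, a map $\Pi:\mathbf D\to\mathcal L$ and an involutory bijection $g\mapsto g^{-1}$ of $\mathcal L$, extended to words by $(g_1,\dots,g_n)^{-1}=(g_n^{-1},\dots,g_1^{-1})$, such that: (1) $\mathcal L\subseteq\mathbf D$, and $u\circ v\in\mathbf D$ implies $u,v\in\mathbf D$; (2) $\Pi$ is the identity on $\mathcal L$; (3) $u\circ v\circ w\in\mathbf D$ implies $u\circ(\Pi(v))\circ w\in\mathbf D$ and $\Pi(u\circ v\circ w)=\Pi(u\circ(\Pi(v))\circ w)$; (4) $w\in\mathbf D$ implies $w^{-1}\circ w\in\mathbf D$ and $\Pi(w^{-1}\circ w)=\mathbf 1:=\Pi(\emptyset)$. A partial subgroup is a non-empty subset $\mathcal H$ closed under inversion with $\Pi(w)\in\mathcal H$ for all $w\in\mathbf W(\mathcal H)\cap\mathbf D$; it is a subgroup if $\mathbf W(\mathcal H)\subseteq\mathbf D$. Write $\mathbf D(g)=\{x:(g^{-1},x,g)\in\mathbf D\}$ and $x^g=\Pi(g^{-1},x,g)$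 for $x\in\mathbf D(g)$; $X^g$ is defined if $X\subseteq\mathbf D(g)$. $N_{\mathcal L}(X)=\{g: X\subseteq\mathbf D(g),X^g=X\}$. **Localities.** $(\mathcal L,\Delta,S)$ is a locality if $\mathcal L$ is a finite partial group, $S$ is a $p$-subgroup of $\mathcal L$ maximal among the $p$-subgroups of $\mathcal L$, $\Delta$ is a set of subgroups of $S$ with $S\in\Delta$, and: (O1) $w=(g_1,\dots,g_n)\in\mathbf D$ iff there are $X_0,\dots,X_n\in\Delta$ with $X_{i-1}^{g_i}$ defined and equal to $X_i$ for all $i$; (O2) if $X,Z\in\Delta$, $g\in\mathcal L$, $X^g$ is defined and $X^g\le Y\le Z$, then $Y\in\Delta$. For $g\in\mathcal L$, $S_g=\{x\in S: x^g\text{ is defined and }x^g\in S\}$ (a subgroup of $S$). For $P\in\Delta$, $N_{\mathcal L}(P)$ is a subgroup. **Fusion systems.** A fusion system $\mathcal F$ on $S$ is a category whose objects are the subgroups of $S$, whose morphisms are injective group homomorphisms, containing all maps $c_g:P\to Q$ ($g\in S$, $P^g\le Q$), and such that for each morphism $\phi:P\to Q$ the bijection $P\to P\phi$ is an $\mathcal F$-isomorphism. $P^{\mathcal F}$ is the set of $\mathcal F$-conjugates $P\phi$ of $P$. $P$ is fully normalized if $|N_S(P)|\ge|N_S(P')|$ for all $P'\in P^{\mathcal F}$. $N_{\mathcal F}(U)$ is the fusion system on $N_S(U)$ whose morphisms $P\to Q$ are restrictions of $\mathcal F$-homomorphisms $\phi:PU\to QU$ with $U\phi=U$; $U$ is normal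 in $\mathcal F$ if $\mathcal F=N_{\mathcal F}(U)$; $O_p(\mathcal F)$ is the largest such $U$. $P$ is centric if $C_S(Q)\le Q$ for all $Q\in P^{\mathcal F}$; radical if some fully normalized $Q\in P^{\mathcal F}$ has $Q=O_p(N_{\mathcal F}(Q))$. $\mathcal F^{cr}$ is the set of centric radical subgroups. **Proper localities.** The fusion system $\mathcal F_S(\mathcal L)$ of a locality is the fusion system on $S$ generated by the conjugation maps $c_g:S_g\to S$, $g\in\mathcal L$ (its isomorphisms are composites of restrictions of the maps $c_g:S_g\to S_{g^{-1}}$). With $\mathcal F=\mathcal F_S(\mathcal L)$, the locality is proper if $\mathcal F^{cr}\subseteq\Delta$ and $G=N_{\mathcal L}(P)$ satisfies $C_G(O_p(G))\le O_p(G)$ for each $P\in\Delta$. **Saturation.** $Q\le S$ is fully automized in $\mathcal F$ if $\mathrm{Aut}_S(Q)$ is a Sylow $p$-subgroup of $\mathrm{Aut}_{\mathcal F}(Q)$. $Q$ is receptive if every $\mathcal F$-isomorphism $\phi:P\to Q$ extends to an $\mathcal F$-homomorphism $N_\phi\to S$, where $N_\phi=\{x\in N_S(P):\phi^{-1}\circ c_x\circ\phi\in\mathrm{Aut}_S(Q)\}$. $\mathcal F$ is saturated if every $P\le S$ has an $\mathcal F$-conjugate that is fully automized and receptive. *)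

theory Defs
  imports "HOL-Algebra.Group_Action" "HOL-Algebra.Sylow"
begin

section \<open>Finite groups\<close>

text \<open>
  Maps act on the right in the source: the conjugation \<open>c\<^sub>g\<close> is \<open>x \<mapsto> g\<inverse> x g\<close>, and a right-hand
  composite \<open>\<phi> \<circ> \<psi>\<close> is written \<^term>\<open>compose P \<psi> \<phi>\<close>. The library's \<^const>\<open>normalizer\<close> uses
  \<open>g H g\<inverse>\<close>, which gives the same set of elements \<open>g\<close>.
\<close>

definition gconj :: "('a, 'b) monoid_scheme \<Rightarrow> 'a \<Rightarrow> 'a \<Rightarrow> 'a"
  where "gconj G g x = inv\<^bsub>G\<^esub> g \<otimes>\<^bsub>G\<^esub> x \<otimes>\<^bsub>G\<^esub> g"

definition centralizer :: "('a, 'b) monoid_scheme \<Rightarrow> 'a set \<Rightarrow> 'a set"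
  where "centralizer G X = {g \<in> carrier G. \<forall>x\<in>X. g \<otimes>\<^bsub>G\<^esub> x = x \<otimes>\<^bsub>G\<^esub> g}"

definition p_core :: "nat \<Rightarrow> ('a, 'b) monoid_scheme \<Rightarrow> 'a set"
  where "p_core p G = (GREATEST U. U \<lhd> G \<and> (\<exists>n. card U = p ^ n))"

definition sylow_subgroup :: "nat \<Rightarrow> ('a, 'b) monoid_scheme \<Rightarrow> 'a set \<Rightarrow> bool"
  where "sylow_subgroup p G H \<longleftrightarrow> subgroup H G \<and> card H = p ^ multiplicity p (order G)"


section \<open>Fusion systems\<close>

text \<open>
  A fusion system on a group \<open>G\<close> is represented by its hom-sets \<open>F P Q\<close>. A morphism \<open>P \<rightarrow> Q\<close> is a
  function equal to \<^const>\<open>undefined\<close> outside \<open>P\<close>, so that equality of morphisms with given source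
  and target is equality of functions. Hom-sets are empty unless both arguments are subgroups of
  \<open>G\<close>, so that equality of fusion systems is equality of the functions \<open>F\<close>.
\<close>

type_synonym 'a homs = "'a set \<Rightarrow> 'a set \<Rightarrow> ('a \<Rightarrow> 'a) set"

definition fus_iso :: "'a homs \<Rightarrow> 'a homs"
  where "fus_iso F P Q =
    {\<phi> \<in> F P Q. \<exists>\<psi> \<in> F Q P. compose P \<psi> \<phi> = (\<lambda>x\<in>P. x) \<and> compose Q \<phi> \<psi> = (\<lambda>x\<in>Q. x)}"

locale fusion_system = group G for G (structure) +
  fixes F :: "'a homs"
  assumes finite_carrier: "finite (carrier G)"
    and objects: "\<phi> \<in> F P Q \<Longrightarrow> subgroup P G \<and> subgroup Q G"
    and injective_hom: "\<phi> \<in> F P Q \<Longrightarrow> \<phi> \<in> extensional P \<inter> mon (G\<lparr>carrier := P\<rparr>) (G\<lparr>carrier := Q\<rparr>)"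
    and identity: "subgroup P G \<Longrightarrow> (\<lambda>x\<in>P. x) \<in> F P P"
    and composition: "\<lbrakk>\<phi> \<in> F P Q; \<psi> \<in> F Q R\<rbrakk> \<Longrightarrow> compose P \<psi> \<phi> \<in> F P R"
    and conjugation: "\<lbrakk>subgroup P G; subgroup Q G; g \<in> carrier G; gconj G g ` P \<subseteq> Q\<rbrakk>
      \<Longrightarrow> restrict (gconj G g) P \<in> F P Q"
    and iso_image: "\<phi> \<in> F P Q \<Longrightarrow> \<phi> \<in> fus_iso F P (\<phi> ` P)"

definition fus_conjugates :: "'a homs \<Rightarrow> 'a set \<Rightarrow> 'a set set"
  where "fus_conjugates F P = {\<phi> ` P | \<phi> Q. \<phi> \<in> F P Q}"

definition fully_normalized :: "('a, 'b) monoid_scheme \<Rightarrow> 'a homs \<Rightarrow> 'a set \<Rightarrow> bool"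
  where "fully_normalized G F P \<longleftrightarrow>
    (\<forall>P' \<in> fus_conjugates F P. card (normalizer G P') \<le> card (normalizer G P))"

abbreviation normalizer_group :: "('a, 'b) monoid_scheme \<Rightarrow> 'a set \<Rightarrow> ('a, 'b) monoid_scheme"
  where "normalizer_group G U \<equiv> G\<lparr>carrier := normalizer G U\<rparr>"

definition normalizer_fusion :: "('a, 'b) monoid_scheme \<Rightarrow> 'a homs \<Rightarrow> 'a set \<Rightarrow> 'a homs"
  where "normalizer_fusion G F U P Q =
    (if subgroup P (normalizer_group G U) \<and> subgroup Q (normalizer_group G U)
     then {restrict \<phi> P | \<phi>. \<phi> \<in> F (P <#>\<^bsub>G\<^esub> U) (Q <#>\<^bsub>G\<^esub> U) \<and> \<phi> ` U = U \<and> \<phi> ` P \<subseteq> Q}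
     else {})"

definition fus_normal :: "('a, 'b) monoid_scheme \<Rightarrow> 'a homs \<Rightarrow> 'a set \<Rightarrow> bool"
  where "fus_normal G F U \<longleftrightarrow>
    subgroup U G \<and> normalizer G U = carrier G \<and> F = normalizer_fusion G F U"

definition fus_core :: "('a, 'b) monoid_scheme \<Rightarrow> 'a homs \<Rightarrow> 'a set"
  where "fus_core G F = (GREATEST U. fus_normal G F U)"

definition fus_centric :: "('a, 'b) monoid_scheme \<Rightarrow> 'a homs \<Rightarrow> 'a set \<Rightarrow> bool"
  where "fus_centric G F P \<longleftrightarrow> (\<forall>Q \<in> fus_conjugates F P. centralizer G Q \<subseteq> Q)"

definition fus_radical :: "('a, 'b) monoid_scheme \<Rightarrow> 'a homs \<Rightarrow> 'a set \<Rightarrow> bool"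
  where "fus_radical G F P \<longleftrightarrow>
    (\<exists>Q \<in> fus_conjugates F P. fully_normalized G F Q \<and>
      Q = fus_core (normalizer_group G Q) (normalizer_fusion G F Q))"

definition centric_radicals :: "('a, 'b) monoid_scheme \<Rightarrow> 'a homs \<Rightarrow> 'a set set"
  where "centric_radicals G F = {P. subgroup P G \<and> fus_centric G F P \<and> fus_radical G F P}"

definition inner_auts :: "('a, 'b) monoid_scheme \<Rightarrow> 'a set \<Rightarrow> ('a \<Rightarrow> 'a) set"
  where "inner_auts G Q = (\<lambda>g. restrict (gconj G g) Q) ` normalizer G Q"

text \<open>
  The library composes automorphisms from right to left; the opposite group has the same subgroups.
\<close>

definition fus_aut_group :: "'a homs \<Rightarrow> 'a set \<Rightarrow> ('a \<Rightarrow> 'a) monoid"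
  where "fus_aut_group F Q = (BijGroup Q)\<lparr>carrier := fus_iso F Q Q\<rparr>"

definition fully_automized :: "nat \<Rightarrow> ('a, 'b) monoid_scheme \<Rightarrow> 'a homs \<Rightarrow> 'a set \<Rightarrow> bool"
  where "fully_automized p G F Q \<longleftrightarrow> sylow_subgroup p (fus_aut_group F Q) (inner_auts G Q)"

definition extension_domain ::
    "('a, 'b) monoid_scheme \<Rightarrow> 'a set \<Rightarrow> 'a set \<Rightarrow> ('a \<Rightarrow> 'a) \<Rightarrow> 'a set"
  where "extension_domain G P Q \<phi> =
    {x \<in> normalizer G P. (\<lambda>y\<in>Q. \<phi> (gconj G x (inv_into P \<phi> y))) \<in> inner_auts G Q}"

definition receptive :: "('a, 'b) monoid_scheme \<Rightarrow> 'a homs \<Rightarrow> 'a set \<Rightarrow> bool"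
  where "receptive G F Q \<longleftrightarrow>
    (\<forall>P. \<forall>\<phi> \<in> fus_iso F P Q.
      \<exists>\<psi> \<in> F (extension_domain G P Q \<phi>) (carrier G). \<forall>x\<in>P. \<psi> x = \<phi> x)"

locale saturated_fusion_system = fusion_system G F for p :: nat and G (structure) and F +
  assumes saturated: "subgroup P G \<Longrightarrow>
    \<exists>Q \<in> fus_conjugates F P. fully_automized p G F Q \<and> receptive G F Q"


section \<open>Partial groups\<close>

record 'a partial_grp = "'a partial_object" +
  words :: "'a list set"
  wprod :: "'a list \<Rightarrow> 'a"
  pinv :: "'a \<Rightarrow> 'a"

locale partial_group =
  fixes L :: "('a, 'b) partial_grp_scheme"
  assumes carrier_nonempty: "carrier L \<noteq> {}"
    and words_subset: "words L \<subseteq> lists (carrier L)"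
    and wprod_closed: "w \<in> words L \<Longrightarrow> wprod L w \<in> carrier L"
    and pinv_closed: "g \<in> carrier L \<Longrightarrow> pinv L g \<in> carrier L"
    and pinv_pinv: "g \<in> carrier L \<Longrightarrow> pinv L (pinv L g) = g"
    and singleton_word: "g \<in> carrier L \<Longrightarrow> [g] \<in> words L"
    and words_split: "u @ v \<in> words L \<Longrightarrow> u \<in> words L \<and> v \<in> words L"
    and wprod_singleton: "g \<in> carrier L \<Longrightarrow> wprod L [g] = g"
    and words_contract: "u @ v @ w \<in> words L \<Longrightarrow> u @ [wprod L v] @ w \<in> words L"
    and wprod_contract: "u @ v @ w \<in> words L \<Longrightarrow> wprod L (u @ v @ w) = wprod L (u @ [wprod L v] @ w)"
    and words_inverse: "w \<in> words L \<Longrightarrow> rev (map (pinv L) w) @ w \<in> words L"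
    and wprod_inverse: "w \<in> words L \<Longrightarrow> wprod L (rev (map (pinv L) w) @ w) = wprod L []"

definition partial_subgroup :: "'a set \<Rightarrow> ('a, 'b) partial_grp_scheme \<Rightarrow> bool"
  where "partial_subgroup H L \<longleftrightarrow> H \<subseteq> carrier L \<and> H \<noteq> {} \<and> (\<forall>h\<in>H. pinv L h \<in> H) \<and>
    (\<forall>w \<in> lists H \<inter> words L. wprod L w \<in> H)"

definition pg_subgroup :: "'a set \<Rightarrow> ('a, 'b) partial_grp_scheme \<Rightarrow> bool"
  where "pg_subgroup H L \<longleftrightarrow> partial_subgroup H L \<and> lists H \<subseteq> words L"

definition pg_p_subgroup :: "nat \<Rightarrow> 'a set \<Rightarrow> ('a, 'b) partial_grp_scheme \<Rightarrow> bool"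
  where "pg_p_subgroup p H L \<longleftrightarrow> pg_subgroup H L \<and> (\<exists>n. card H = p ^ n)"

definition grp_of :: "('a, 'b) partial_grp_scheme \<Rightarrow> 'a set \<Rightarrow> 'a monoid"
  where "grp_of L H = \<lparr>carrier = H, monoid.mult = (\<lambda>x y. wprod L [x, y]), one = wprod L []\<rparr>"

definition conj_dom :: "('a, 'b) partial_grp_scheme \<Rightarrow> 'a \<Rightarrow> 'a set"
  where "conj_dom L g = {x \<in> carrier L. [pinv L g, x, g] \<in> words L}"

definition pconj :: "('a, 'b) partial_grp_scheme \<Rightarrow> 'a \<Rightarrow> 'a \<Rightarrow> 'a"
  where "pconj L g x = wprod L [pinv L g, x, g]"

definition pg_normalizer :: "('a, 'b) partial_grp_scheme \<Rightarrow> 'a set \<Rightarrow> 'a set"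
  where "pg_normalizer L X = {g \<in> carrier L. X \<subseteq> conj_dom L g \<and> pconj L g ` X = X}"


section \<open>Localities\<close>

locale locality = partial_group L for p :: nat and L :: "('a, 'b) partial_grp_scheme" +
  fixes \<Delta> :: "'a set set" and S :: "'a set"
  assumes finite_carrier: "finite (carrier L)"
    and S_p_subgroup: "pg_p_subgroup p S L"
    and S_maximal: "\<lbrakk>pg_p_subgroup p T L; S \<subseteq> T\<rbrakk> \<Longrightarrow> T = S"
    and objects_subgroups: "P \<in> \<Delta> \<Longrightarrow> subgroup P (grp_of L S)"
    and S_object: "S \<in> \<Delta>"
    and words_iff: "w \<in> lists (carrier L) \<Longrightarrow>
      w \<in> words L \<longleftrightarrow>
        (\<exists>X :: nat \<Rightarrow> 'a set. (\<forall>i \<le> length w. X i \<in> \<Delta>) \<and>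
          (\<forall>i < length w. X i \<subseteq> conj_dom L (w ! i) \<and> pconj L (w ! i) ` X i = X (Suc i)))"
    and objects_closed: "\<lbrakk>X \<in> \<Delta>; Z \<in> \<Delta>; g \<in> carrier L; X \<subseteq> conj_dom L g;
      subgroup (pconj L g ` X) (grp_of L Y); subgroup Y (grp_of L Z)\<rbrakk> \<Longrightarrow> Y \<in> \<Delta>"

definition S_elt :: "('a, 'b) partial_grp_scheme \<Rightarrow> 'a set \<Rightarrow> 'a \<Rightarrow> 'a set"
  where "S_elt L S g = {x \<in> S. x \<in> conj_dom L g \<and> pconj L g x \<in> S}"

text \<open>The smallest fusion system on \<open>S\<close> that contains the conjugation maps \<open>c\<^sub>g : S\<^sub>g \<rightarrow> S\<close>.\<close>

definition locality_fusion :: "('a, 'b) partial_grp_scheme \<Rightarrow> 'a set \<Rightarrow> 'a homs"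
  where "locality_fusion L S P Q =
    {\<phi>. \<forall>E. fusion_system (grp_of L S) E \<and>
          (\<forall>g \<in> carrier L. restrict (pconj L g) (S_elt L S g) \<in> E (S_elt L S g) S)
        \<longrightarrow> \<phi> \<in> E P Q}"

locale proper_locality = locality +
  assumes centric_radicals_subset: "centric_radicals (grp_of L S) (locality_fusion L S) \<subseteq> \<Delta>"
    and characteristic_p: "\<lbrakk>P \<in> \<Delta>; G = grp_of L (pg_normalizer L P)\<rbrakk>
      \<Longrightarrow> centralizer G (p_core p G) \<subseteq> p_core p G"

end

theory Submission
  imports Defs
begin

text \<open>
  Let F be the fusion system of the locality and \<open>\<Delta>\<close> its set of objects. A
  word that has a product is multiplied along a chain of objects, so on an object P the composite
  of the conjugation maps of a word is conjugation by the product of the word. Hence F-morphisms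
  on P are conjugations by single elements, Aut(P) is the image of the finite group N(P), the
  normalizer in the locality, and the domains of the generating maps of F are themselves objects.
  If the normalizer of P in S is a Sylow subgroup of N(P), then Sylow's conjugacy theorem, applied
  in N(P) and in the subgroup of the elements that act on P like an element of S, shows that P is
  fully automized (\<open>fully_automized_object\<close>) and receptive
  (\<open>receptive_object\<close>). Every object has a conjugate of this kind
  (\<open>sylow_conjugate_object\<close>): choose a conjugate with largest normalizer in S; if
  this normalizer, which is a larger object, were not a Sylow subgroup, then a larger p-group
  would normalize it and the conjugate, and by induction this p-group could be conjugated into S,
  giving a conjugate with a still larger normalizer.

  So F is generated by morphisms between members of a conjugation-closed family
  \<open>\<Delta>\<close> whose members satisfy the saturation condition, and
  \<open>\<Delta>\<close> contains the centric radical subgroups. For any fusion system on a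
  finite p-group this implies saturation (\<open>saturated_from_generating_family\<close>). The
  proof is a downward induction on the order of a subgroup P outside the family, where P is chosen
  with largest normalizer in its class. First, every conjugate of P is carried to P by a morphism
  defined on its whole normalizer (\<open>fully_normalized_is_top\<close>). Secondly, there is R
  with \<open>P < R \<le> N(P)\<close>, normalized by N(P), such that every automorphism of P
  extends to an automorphism of R: if P is not centric, then R is P C(P)
  (\<open>noncentric_overgroup\<close>); if P is centric, then it is not radical, and R is P U for
  a subgroup U that is normal in the normalizer fusion system of P but not contained in P
  (\<open>nonradical_overgroup\<close>). Finally, R satisfies the saturation condition by
  induction, and Sylow's theorem in Aut(R) brings it down to P
  (\<open>fully_automized_from_overgroup\<close>, \<open>receptive_from_overgroup\<close>).

  All extensions of morphisms come from \<open>extension_modulo_automorphisms\<close>. It takes a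
  subgroup Q that satisfies the saturation condition and a subgroup K of Aut(Q), and says that a
  morphism onto Q extends over every group that acts on Q through K, provided that it may be
  changed by an element of K. Different choices of K, such as the stabilizer or the pointwise
  fixer of a subgroup, give the different steps.
\<close>

section \<open>Conjugation and normalizers\<close>

context group
begin

lemma gconj_closed [simp]: "g \<in> carrier G \<Longrightarrow> x \<in> carrier G \<Longrightarrow> gconj G g x \<in> carrier G"
  by (simp add: gconj_def)

lemma gconj_one: "x \<in> carrier G \<Longrightarrow> gconj G \<one> x = x"
  by (simp add: gconj_def)

lemma gconj_mult:
  "\<lbrakk>a \<in> carrier G; b \<in> carrier G; x \<in> carrier G\<rbrakk> \<Longrightarrow> gconj G (a \<otimes> b) x = gconj G b (gconj G a x)"
  by (simp add: gconj_def inv_mult_group m_assoc)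

lemma gconj_inv:
  assumes "a \<in> carrier G" "x \<in> carrier G"
  shows "gconj G (inv a) (gconj G a x) = x" "gconj G a (gconj G (inv a) x) = x"
  using assms gconj_mult[of a "inv a" x] gconj_mult[of "inv a" a x] gconj_one by auto

lemma gconj_hom:
  assumes "a \<in> carrier G" "x \<in> carrier G" "y \<in> carrier G"
  shows "gconj G a (x \<otimes> y) = gconj G a x \<otimes> gconj G a y"
proof -
  have "a \<otimes> (inv a \<otimes> z) = z" if "z \<in> carrier G" for z using assms that by (simp flip: m_assoc)
  then show ?thesis using assms by (simp add: gconj_def m_assoc)
qed

lemma gconj_inj: "a \<in> carrier G \<Longrightarrow> inj_on (gconj G a) (carrier G)"
  by (metis gconj_inv(1) inj_onI)

lemma mem_normalizer_iff:
  assumes H: "H \<subseteq> carrier G"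
  shows "g \<in> normalizer G H \<longleftrightarrow> g \<in> carrier G \<and> gconj G g ` H = H"
proof -
  have "g <# H #> inv g = gconj G (inv g) ` H" if "g \<in> carrier G"
    using that by (auto simp: l_coset_def r_coset_def gconj_def)
  moreover have "gconj G (inv g) ` H = H \<longleftrightarrow> gconj G g ` H = H" if g: "g \<in> carrier G"
  proof -
    have "gconj G (inv g) ` gconj G g ` H = H" "gconj G g ` gconj G (inv g) ` H = H"
      using g H gconj_inv by (force simp: image_image subset_iff)+
    then show ?thesis by metis
  qed
  ultimately show ?thesis using H by (simp add: normalizer_def stabilizer_def cong: conj_cong)
qed

lemma subgroup_normalizer: "H \<subseteq> carrier G \<Longrightarrow> subgroup (normalizer G H) G"
  using normalizer_imp_subgroup by simp

lemma gconj_image_subgroup: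
  assumes "subgroup H G" "h \<in> H"
  shows "gconj G h ` H = H"
proof
  have c: "H \<subseteq> carrier G" using assms subgroup.subset by auto
  interpret H: subgroup H G by fact
  have *: "gconj G k ` H \<subseteq> H" if "k \<in> H" for k
    using that by (auto simp: gconj_def)
  show "gconj G h ` H \<subseteq> H" using * assms by blast
  have "gconj G (inv h) y \<in> H" if "y \<in> H" for y using * H.m_inv_closed assms(2) that by blast
  moreover have "gconj G h (gconj G (inv h) y) = y" if "y \<in> H" for y
    using gconj_inv(2) H.mem_carrier assms(2) that by simp
  ultimately have "y \<in> gconj G h ` H" if "y \<in> H" for y
    using that image_eqI[of y "gconj G h" "gconj G (inv h) y" H] by simp
  then show "H \<subseteq> gconj G h ` H" by (rule subsetI)
qed

lemma subset_normalizer: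
  assumes "subgroup H G"
  shows "H \<subseteq> normalizer G H"
proof
  fix x assume x: "x \<in> H"
  then have "x \<in> carrier G" using subgroup.mem_carrier[OF assms] by simp
  then show "x \<in> normalizer G H"
    using gconj_image_subgroup[OF assms x] mem_normalizer_iff[OF subgroup.subset[OF assms]] by simp
qed

lemma normalizer_memD:
  assumes "subgroup H G" "g \<in> normalizer G H" "x \<in> H"
  shows "gconj G g x \<in> H"
  using assms mem_normalizer_iff[OF subgroup.subset[OF assms(1)]] by blast

lemma normalizer_memI:
  assumes "subgroup H G" "finite H" "g \<in> carrier G" "\<And>x. x \<in> H \<Longrightarrow> gconj G g x \<in> H"
  shows "g \<in> normalizer G H"
proof -
  have H: "H \<subseteq> carrier G" using assms subgroup.subset by auto
  have "gconj G g ` H \<subseteq> H" using assms by auto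
  moreover have "inj_on (gconj G g) H" using gconj_inj[OF assms(3)] H inj_on_subset by blast
  ultimately show ?thesis using endo_inj_surj[OF assms(2)] assms(3) mem_normalizer_iff[OF H] by auto
qed

lemma subgroup_gconj_image:
  assumes "subgroup H G" "g \<in> carrier G"
  shows "subgroup (gconj G g ` H) G"
proof -
  interpret h: group_hom G G "gconj G g"
    using assms gconj_hom by unfold_locales (auto simp: hom_def)
  show ?thesis using h.subgroup_img_is_subgroup assms by auto
qed

lemma centralizer_iff:
  assumes "X \<subseteq> carrier G"
  shows "g \<in> centralizer G X \<longleftrightarrow> g \<in> carrier G \<and> (\<forall>x\<in>X. gconj G g x = x)"
  unfolding centralizer_def gconj_def using assms
  by (auto simp: subset_iff m_assoc) (metis inv_solve_left m_closed)+

lemma subgroup_centralizer: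
  assumes X: "X \<subseteq> carrier G"
  shows "subgroup (centralizer G X) G"
proof (rule subgroupI)
  have "\<one> \<in> centralizer G X" using X gconj_one by (auto simp: centralizer_iff[OF X])
  then show "centralizer G X \<noteq> {}" by blast
  fix a assume a: "a \<in> centralizer G X"
  then show "inv a \<in> centralizer G X"
    using X gconj_inv(1) by (auto simp: centralizer_iff[OF X]) (metis subsetD)
  fix b assume "b \<in> centralizer G X"
  then show "a \<otimes> b \<in> centralizer G X" using a X gconj_mult by (auto simp: centralizer_iff[OF X] subset_iff)
qed (auto simp: centralizer_def)

end

section \<open>Sylow subgroups\<close>

text \<open>
  An orbit of points that are not fixed has length a power of p greater than 1. Modulo p, the
  number of points is therefore the number of fixed points; this is the source of Sylow conjugacy
  and of the growth of normalizers.
\<close>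

lemma (in group_action) prime_dvd_card_nonfixed:
  assumes p: "prime p" and ord: "order G = p ^ n" and fin: "finite E"
  shows "p dvd card {x \<in> E. \<exists>g\<in>carrier G. \<phi> g x \<noteq> x}"
proof -
  let ?f = "\<lambda>x. if \<exists>g\<in>carrier G. \<phi> g x \<noteq> x then 1 else (0::nat)"
  interpret G: group G
    using group_hom group_hom.axioms(1) by auto
  have fin_G: "finite (carrier G)"
    using ord p by (metis card.infinite order_def power_not_zero prime_gt_0_nat less_numeral_extra(3))
  have "p dvd (\<Sum>x\<in>X. ?f x)" if X: "X \<in> orbits G E \<phi>" for X
  proof -
    from X obtain x where x: "x \<in> E" "X = orbit G \<phi> x" by (auto simp: orbits_def)
    have XE: "X \<subseteq> E"
      using X orbits_coverture by blast
    show ?thesis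
    proof (cases "\<exists>g\<in>carrier G. \<phi> g x \<noteq> x")
      case False
      then have "\<phi> g x = x" if "g \<in> carrier G" for g using that by blast
      then have "X = {x}" unfolding x(2) orbit_def using G.one_closed by (auto; metis G.one_closed)
      then show ?thesis using False by simp
    next
      case True
      then obtain g where g: "g \<in> carrier G" "\<phi> g x \<noteq> x" by auto
      have all: "\<exists>g\<in>carrier G. \<phi> g y \<noteq> y" if y: "y \<in> X" for y
      proof (rule ccontr)
        assume fixy: "\<not> ?thesis"
        have yE: "y \<in> E" using y XE by auto
        have "x \<in> orbit G \<phi> y" using orbit_sym x y yE by auto
        then have xy: "x = y" using fixy by (auto simp: orbit_def)
        show False using fixy g by (simp add: xy)
      qed
      have "card X * card (stabilizer G \<phi> x) = p ^ n"
        using orbit_stabilizer_theorem[OF x(1)] x ord by simp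
      then have "card X dvd p ^ n" by (metis dvd_triv_left)
      then obtain k where k: "card X = p ^ k" using p divides_primepow_nat by blast
      have "finite X" using XE fin finite_subset by auto
      moreover have "x \<in> X" using orbit_refl x by auto
      moreover have "\<phi> g x \<in> X" using x g by (auto simp: orbit_def)
      ultimately have "card X \<noteq> 1" using g(2) by (metis card_1_singletonE singletonD)
      then have "p dvd card X" using k by (cases k) auto
      moreover have "(\<Sum>x\<in>X. ?f x) = card X" using all by simp
      ultimately show ?thesis by simp
    qed
  qed
  then have "p dvd (\<Sum>X\<in>orbits G E \<phi>. \<Sum>x\<in>X. ?f x)" by (rule dvd_sum)
  also have "\<dots> = (\<Sum>x\<in>E. ?f x)" using disjoint_sum[OF fin] .
  also have "\<dots> = card {x \<in> E. \<exists>g\<in>carrier G. \<phi> g x \<noteq> x}"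
    using fin by (simp add: sum.If_cases Int_def)
  finally show ?thesis .
qed

text \<open>
  The inverse turns right multiplication into a left action.
\<close>

lemma (in group) r_coset_action:
  assumes "subgroup H G" "subgroup X G"
  shows "group_action (G\<lparr>carrier := X\<rparr>) (rcosets H) (\<lambda>x. \<lambda>C\<in>rcosets H. C #> inv x)"
proof -
  interpret X: subgroup X G by fact
  have HG: "H \<subseteq> carrier G" using assms subgroup.subset by auto
  have sub: "C \<subseteq> carrier G" if "C \<in> rcosets H" for C
    using that assms(1) subgroup.rcosets_carrier group_axioms by blast
  have closed: "C #> x \<in> rcosets H" if C: "C \<in> rcosets H" and x: "x \<in> carrier G" for C x
  proof -
    from C obtain g where "g \<in> carrier G" "C = H #> g" by (auto simp: RCOSETS_def)
    then show ?thesis using x HG coset_mult_assoc[OF HG] by (auto simp: RCOSETS_def)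
  qed
  have undo: "(C #> inv x) #> x = C" "(C #> x) #> inv x = C" if "C \<in> rcosets H" "x \<in> carrier G" for C x
    using that sub by (simp_all add: coset_mult_assoc)
  have bij: "(\<lambda>C\<in>rcosets H. C #> inv x) \<in> Bij (rcosets H)" if x: "x \<in> X" for x
    unfolding Bij_def
  proof (intro IntI CollectI, simp, rule bij_betwI[where g = "\<lambda>C. C #> x"])
    show "(\<lambda>C\<in>rcosets H. C #> inv x) \<in> rcosets H \<rightarrow> rcosets H"
      using x closed by auto
    show "(\<lambda>C. C #> x) \<in> rcosets H \<rightarrow> rcosets H" using x closed by auto
  qed (use x undo closed in auto)
  have hom: "(\<lambda>x. \<lambda>C\<in>rcosets H. C #> inv x) \<in> hom (G\<lparr>carrier := X\<rparr>) (BijGroup (rcosets H))"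
  proof (rule homI)
    fix x y assume xy: "x \<in> carrier (G\<lparr>carrier := X\<rparr>)" "y \<in> carrier (G\<lparr>carrier := X\<rparr>)"
    then have xy': "x \<in> X" "y \<in> X" by auto
    have "(\<lambda>C\<in>rcosets H. C #> inv (x \<otimes> y)) = compose (rcosets H) (\<lambda>C\<in>rcosets H. C #> inv x) (\<lambda>C\<in>rcosets H. C #> inv y)"
    proof (rule ext)
      fix C
      show "(\<lambda>C\<in>rcosets H. C #> inv (x \<otimes> y)) C = compose (rcosets H) (\<lambda>C\<in>rcosets H. C #> inv x) (\<lambda>C\<in>rcosets H. C #> inv y) C"
        using xy' sub closed by (auto simp: compose_def inv_mult_group coset_mult_assoc)
    qed
    then show "(\<lambda>C\<in>rcosets H. C #> inv (x \<otimes>\<^bsub>G\<lparr>carrier := X\<rparr>\<^esub> y)) =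
      (\<lambda>C\<in>rcosets H. C #> inv x) \<otimes>\<^bsub>BijGroup (rcosets H)\<^esub> (\<lambda>C\<in>rcosets H. C #> inv y)"
      using bij xy' by (simp add: BijGroup_def)
  qed (use bij in \<open>auto simp: BijGroup_def\<close>)
  show ?thesis
    by (intro group_action.intro group_hom.intro group_hom_axioms.intro hom group_BijGroup
      subgroup_imp_group assms)
qed

lemma (in group) r_coset_fixed:
  assumes H: "subgroup H G" and g: "g \<in> carrier G" and x: "x \<in> carrier G"
    and fixed: "(H #> g) #> inv x = H #> g"
  shows "g \<otimes> x \<otimes> inv g \<in> H"
proof -
  have HG: "H \<subseteq> carrier G" using H subgroup.subset by auto
  have "(H #> g) #> x = H #> g"
    using fixed g x HG by (metis coset_mult_assoc coset_mult_one inv_closed l_inv m_closed r_coset_subset_G)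
  then have "H #> (g \<otimes> x \<otimes> inv g) = H"
    using g x HG by (metis coset_mult_assoc coset_mult_one inv_closed r_inv m_closed)
  then show ?thesis
    using H g x coset_join1[of H] HG by auto
qed

text \<open>
  The index of P is prime to p, so X fixes one of the cosets of P, and X fixes the coset of g if
  and only if g conjugates X into P.
\<close>

lemma (in group) p_subgroup_conjugate_into:
  assumes fin: "finite (carrier G)" and p: "prime p"
    and syl: "sylow_subgroup p G P" and X: "subgroup X G" "card X = p ^ n"
  shows "\<exists>g\<in>carrier G. \<forall>x\<in>X. g \<otimes> x \<otimes> inv g \<in> P"
proof -
  have P: "subgroup P G" and cP: "card P = p ^ multiplicity p (order G)"
    using syl by (auto simp: sylow_subgroup_def)
  let ?\<phi> = "\<lambda>x. \<lambda>C\<in>rcosets P. C #> inv x"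
  interpret act: group_action "G\<lparr>carrier := X\<rparr>" "rcosets P" ?\<phi>
    using r_coset_action P X by auto
  have ord: "order G \<noteq> 0" using fin order_gt_0_iff_finite by auto
  have ix: "card (rcosets P) * p ^ multiplicity p (order G) = order G"
    using lagrange[OF P] cP by simp
  have nd: "\<not> p dvd card (rcosets P)"
  proof
    assume "p dvd card (rcosets P)"
    then have "p ^ Suc (multiplicity p (order G)) dvd order G"
      using ix by (metis dvd_mult_right mult_dvd_mono power_Suc dvd_refl)
    then show False using ord p
      by (metis multiplicity_geI not_less_eq_eq order_refl not_prime_unit)
  qed
  have finr: "finite (rcosets P)"
    using ix ord by (metis card.infinite mult_is_0)
  have "p dvd card {C \<in> rcosets P. \<exists>x\<in>carrier (G\<lparr>carrier := X\<rparr>). ?\<phi> x C \<noteq> C}"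
    using act.prime_dvd_card_nonfixed[OF p _ finr] X by (simp add: order_def)
  then have "{C \<in> rcosets P. \<exists>x\<in>carrier (G\<lparr>carrier := X\<rparr>). ?\<phi> x C \<noteq> C} \<noteq> rcosets P"
    using nd by metis
  then obtain C where C: "C \<in> rcosets P"
      "C \<notin> {C \<in> rcosets P. \<exists>x\<in>carrier (G\<lparr>carrier := X\<rparr>). ?\<phi> x C \<noteq> C}" by blast
  then have C': "C #> inv x = C" if "x \<in> X" for x using that C by auto
  obtain g where g: "g \<in> carrier G" "C = P #> g" using C(1) by (auto simp: RCOSETS_def)
  have "g \<otimes> x \<otimes> inv g \<in> P" if x: "x \<in> X" for x
    using r_coset_fixed[OF P g(1)] C'[OF x] subgroup.mem_carrier[OF X(1) x] g(2) by simp
  then show ?thesis using g(1) by blast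
qed

text \<open>
  Let H act on its own cosets in T. Their number is divisible by p and the coset H is fixed, so
  there is a second fixed coset; its representatives normalize H.
\<close>

lemma (in group) normalizer_grows:
  assumes T: "subgroup T G" "card T = p ^ n" and p: "prime p" and H: "subgroup H G" "H \<subset> T"
  shows "\<exists>t \<in> T - H. gconj G t ` H = H"
proof -
  interpret T: group "G\<lparr>carrier := T\<rparr>" using T subgroup_imp_group by auto
  have HT: "subgroup H (G\<lparr>carrier := T\<rparr>)" using H subgroup_incl T by auto
  let ?T = "G\<lparr>carrier := T\<rparr>"
  let ?\<phi> = "\<lambda>x. \<lambda>C\<in>rcosets\<^bsub>?T\<^esub> H. C #>\<^bsub>?T\<^esub> inv\<^bsub>?T\<^esub> x"
  interpret act: group_action "?T\<lparr>carrier := H\<rparr>" "rcosets\<^bsub>?T\<^esub> H" ?\<phi>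
    using T.r_coset_action[OF HT HT] by simp
  have finT: "finite T" using T p by (metis card.infinite power_not_zero not_prime_0)
  have finH: "finite H" using finT H finite_subset by blast
  have ix: "card (rcosets\<^bsub>?T\<^esub> H) * card H = p ^ n"
    using T.lagrange[OF HT] T by (simp add: order_def)
  obtain k where k: "card H = p ^ k" using ix p by (metis dvd_triv_right divides_primepow_nat)
  obtain l where l: "card (rcosets\<^bsub>?T\<^esub> H) = p ^ l" using ix p by (metis dvd_triv_left divides_primepow_nat)
  have "card H < card T" using H finT psubset_card_mono by blast
  then have "card (rcosets\<^bsub>?T\<^esub> H) \<noteq> 1" using ix T by auto
  then have pd: "p dvd card (rcosets\<^bsub>?T\<^esub> H)" using l by (cases l) auto
  have finr: "finite (rcosets\<^bsub>?T\<^esub> H)" using ix T p by (metis card.infinite mult_0 power_not_zero not_prime_0)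
  let ?N = "{C \<in> rcosets\<^bsub>?T\<^esub> H. \<exists>x\<in>carrier (?T\<lparr>carrier := H\<rparr>). ?\<phi> x C \<noteq> C}"
  let ?F = "rcosets\<^bsub>?T\<^esub> H - ?N"
  have "p dvd card ?N"
    using act.prime_dvd_card_nonfixed[OF p _ finr] k by (simp add: order_def)
  then have pF: "p dvd card ?F"
    using pd finr by (simp add: card_Diff_subset)
  have oneT: "\<one> \<in> T" "\<one> \<in> H" using T H subgroup.one_closed by auto
  have "H #>\<^bsub>?T\<^esub> \<one> = H" using HT T.coset_mult_one subgroup.subset[OF HT] by auto
  then have Hr: "H \<in> rcosets\<^bsub>?T\<^esub> H" using oneT by (auto simp: RCOSETS_def)
  have "H \<in> ?F"
  proof -
    have "H #>\<^bsub>?T\<^esub> inv\<^bsub>?T\<^esub> x = H" if "x \<in> H" for x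
      using that HT T.coset_join2[OF _ HT] subgroup.m_inv_closed[OF HT] subgroup.subset[OF HT] by auto
    then show ?thesis using Hr by auto
  qed
  have "card ?F \<noteq> 1" using pF p by (metis not_prime_unit)
  then have "?F \<noteq> {H}" using is_singletonI is_singleton_altdef by metis
  then obtain C where C: "C \<in> ?F" "C \<noteq> H" using \<open>H \<in> ?F\<close> by blast
  then obtain g where g: "g \<in> T" "C = H #>\<^bsub>?T\<^esub> g" by (auto simp: RCOSETS_def)
  have gc: "g \<in> carrier G" using g T subgroup.subset by auto
  have "g \<notin> H" using g C(2) T.coset_join2[OF _ HT] by auto
  have conj: "g \<otimes> x \<otimes> inv g \<in> H" if x: "x \<in> H" for x
  proof -
    have "x \<in> T" using x H by auto
    moreover have "(H #>\<^bsub>?T\<^esub> g) #>\<^bsub>?T\<^esub> inv\<^bsub>?T\<^esub> x = H #>\<^bsub>?T\<^esub> g" using C x g by auto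
    ultimately have "g \<otimes>\<^bsub>?T\<^esub> x \<otimes>\<^bsub>?T\<^esub> inv\<^bsub>?T\<^esub> g \<in> H" using T.r_coset_fixed[OF HT, of g x] g by auto
    then show ?thesis using m_inv_consistent[OF T(1)] g by simp
  qed
  have ig: "inv g \<in> T" using g T subgroup.m_inv_closed by auto
  have Hc: "H \<subseteq> carrier G" using H subgroup.subset by auto
  have sub: "gconj G (inv g) ` H \<subseteq> H" using conj gc by (auto simp: gconj_def)
  have "inj_on (gconj G (inv g)) H"
    using gc Hc by (auto simp: inj_on_def gconj_def subset_iff)
  then have "gconj G (inv g) ` H = H" using sub finH endo_inj_surj by blast
  moreover have "inv g \<notin> H" using \<open>g \<notin> H\<close> H gc by (metis inv_inv subgroup.m_inv_closed)
  ultimately show ?thesis using ig by blast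
qed

lemma (in group) sylow_exists:
  assumes fin: "finite (carrier G)" and p: "prime p"
  shows "\<exists>P. sylow_subgroup p G P"
proof -
  have "order G \<noteq> 0" using fin order_gt_0_iff_finite by auto
  obtain m where "order G = p ^ multiplicity p (order G) * m" using multiplicity_dvd[of p "order G"] by (auto simp: dvd_def)
  then show ?thesis using sylow_thm[OF p is_group _ fin] by (auto simp: sylow_subgroup_def)
qed

lemma (in group) p_subgroup_card_le:
  assumes fin: "finite (carrier G)" and p: "prime p" and X: "subgroup X G" "card X = p ^ n"
  shows "n \<le> multiplicity p (order G)"
proof -
  have "order G \<noteq> 0" using fin order_gt_0_iff_finite by auto
  moreover have "card X dvd order G" using lagrange[OF X(1)] by (metis dvd_triv_right)
  ultimately show ?thesis using X p by (metis multiplicity_geI not_prime_unit)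
qed

lemma (in group) sylowI:
  assumes fin: "finite (carrier G)" and p: "prime p" and X: "subgroup X G" "card X = p ^ n"
    and le: "p ^ multiplicity p (order G) \<le> card X"
  shows "sylow_subgroup p G X"
  using p_subgroup_card_le[OF fin p X] X le p unfolding sylow_subgroup_def
  by (metis le_antisym power_le_imp_le_exp prime_gt_1_nat)

lemma (in group_hom) card_image_kernel:
  assumes X: "subgroup X G"
  shows "card (h ` X) * card {x \<in> X. h x = \<one>\<^bsub>H\<^esub>} = card X"
proof -
  let ?X = "G\<lparr>carrier := X\<rparr>"
  interpret X: group ?X using X G.subgroup_imp_group by auto
  interpret h: group_hom ?X H h
    using subgroup.subset[OF X] by unfold_locales (auto simp: hom_def subset_iff)
  have "?X Mod kernel ?X H h \<cong> H\<lparr>carrier := h ` carrier ?X\<rparr>"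
  proof -
    interpret I: group "H\<lparr>carrier := h ` X\<rparr>"
      using h.img_is_subgroup H.subgroup_imp_group by simp
    interpret hi: group_hom ?X "H\<lparr>carrier := h ` X\<rparr>" h
      using h.hom_mult by unfold_locales (auto simp: hom_def)
    have "?X Mod kernel ?X (H\<lparr>carrier := h ` X\<rparr>) h \<cong> H\<lparr>carrier := h ` X\<rparr>"
      using hi.FactGroup_iso by simp
    then show ?thesis by (simp add: kernel_def)
  qed
  then have "order (?X Mod kernel ?X H h) = card (h ` X)"
    using iso_same_card by (fastforce simp: order_def)
  moreover have "card (rcosets\<^bsub>?X\<^esub> kernel ?X H h) * card (kernel ?X H h) = card X"
    using X.lagrange[OF h.subgroup_kernel] by (simp add: order_def)
  ultimately show ?thesis by (simp add: order_def FactGroup_def kernel_def)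
qed

text \<open>
  The kernel of the restriction of h to P is a p-subgroup of the kernel of h, so its order is at
  most the p-part of the order of the kernel. The image of P therefore has at least the order of a
  Sylow subgroup.
\<close>

lemma (in group_hom) sylow_image:
  assumes fin: "finite (carrier G)" and p: "prime p"
    and surj: "h ` carrier G = carrier H" and P: "sylow_subgroup p G P"
  shows "sylow_subgroup p H (h ` P)"
proof -
  have sP: "subgroup P G" and cP: "card P = p ^ multiplicity p (order G)"
    using P by (auto simp: sylow_subgroup_def)
  let ?K = "kernel G H h"
  have o0: "order G \<noteq> 0" using fin G.order_gt_0_iff_finite by auto
  have e1: "order G = order H * card ?K"
    using card_image_kernel[OF G.subgroup_self] surj by (simp add: order_def kernel_def)
  have e2: "card (h ` P) * card {x \<in> P. h x = \<one>\<^bsub>H\<^esub>} = p ^ multiplicity p (order G)"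
    using card_image_kernel[OF sP] cP by simp
  have nz: "order H \<noteq> 0" "card ?K \<noteq> 0" using e1 o0 by auto
  have mult: "multiplicity p (order G) = multiplicity p (order H) + multiplicity p (card ?K)"
    using e1 nz p by (simp add: prime_elem_multiplicity_mult_distrib)
  obtain a where a: "card (h ` P) = p ^ a" using e2 p by (metis dvd_triv_left divides_primepow_nat)
  obtain b where b: "card {x \<in> P. h x = \<one>\<^bsub>H\<^esub>} = p ^ b" using e2 p by (metis dvd_triv_right divides_primepow_nat)
  have "{x \<in> P. h x = \<one>\<^bsub>H\<^esub>} = P \<inter> ?K" using sP subgroup.subset by (auto simp: kernel_def)
  then have "subgroup {x \<in> P. h x = \<one>\<^bsub>H\<^esub>} G"
    using G.subgroups_Inter_pair[OF sP subgroup_kernel] by simp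
  then have "subgroup {x \<in> P. h x = \<one>\<^bsub>H\<^esub>} (G\<lparr>carrier := ?K\<rparr>)"
    using G.subgroup_incl[OF _ subgroup_kernel] sP subgroup.subset by (fastforce simp: kernel_def)
  moreover have "group (G\<lparr>carrier := ?K\<rparr>)" using subgroup_kernel G.subgroup_imp_group by auto
  ultimately have "b \<le> multiplicity p (card ?K)"
    using group.p_subgroup_card_le[OF _ _ p _ b, of "G\<lparr>carrier := ?K\<rparr>"] fin by (auto simp: order_def kernel_def)
  moreover have "a + b = multiplicity p (order G)"
    using e2 a b p by (metis power_add power_inject_exp prime_gt_1_nat)
  ultimately have "multiplicity p (order H) \<le> a" using mult by linarith
  moreover have sI: "subgroup (h ` P) H" using subgroup_img_is_subgroup[OF sP] .
  moreover have "finite (carrier H)" using surj fin by (metis finite_imageI)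
  ultimately show ?thesis
    using H.sylowI[OF _ p sI a] a p by (metis power_increasing prime_ge_1_nat)
qed

lemma (in group) sylow_in_subgroup:
  assumes fin: "finite (carrier G)" and p: "prime p"
    and P: "sylow_subgroup p G P" and M: "subgroup M G" "P \<subseteq> M"
  shows "sylow_subgroup p (G\<lparr>carrier := M\<rparr>) P"
proof -
  have sP: "subgroup P G" and cP: "card P = p ^ multiplicity p (order G)"
    using P by (auto simp: sylow_subgroup_def)
  interpret M: group "G\<lparr>carrier := M\<rparr>" using M subgroup_imp_group by auto
  have o0: "order G \<noteq> 0" using fin order_gt_0_iff_finite by auto
  have "card M dvd order G" using lagrange[OF M(1)] by (metis dvd_triv_right)
  then have "multiplicity p (card M) \<le> multiplicity p (order G)"
    using o0 by (simp add: dvd_imp_multiplicity_le)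
  then have "p ^ multiplicity p (order (G\<lparr>carrier := M\<rparr>)) \<le> card P"
    unfolding cP order_def using p prime_ge_1_nat[OF p] by (intro power_increasing) (auto simp: order_def)
  moreover have "finite M" using fin subgroup.subset[OF M(1)] finite_subset by blast
  ultimately show ?thesis
    using M.sylowI[OF _ p subgroup_incl[OF sP M] cP] by simp
qed

text \<open>
  A conjugate of a Sylow subgroup contains N properly, so the normalizer of N in it is larger than
  N.
\<close>

lemma (in group) nonsylow_enlarge:
  assumes fin: "finite (carrier G)" and p: "prime p"
    and N: "subgroup N G" "card N = p ^ n" and ns: "\<not> sylow_subgroup p G N"
  obtains M m where "subgroup M G" "card M = p ^ m" "N \<subset> M" "\<And>t. t \<in> M \<Longrightarrow> gconj G t ` N = N"
proof -
  obtain P where P: "sylow_subgroup p G P" using sylow_exists[OF fin p] by blast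
  then have sP: "subgroup P G" and cP: "card P = p ^ multiplicity p (order G)"
    by (auto simp: sylow_subgroup_def)
  obtain g where g: "g \<in> carrier G" "\<And>x. x \<in> N \<Longrightarrow> g \<otimes> x \<otimes> inv g \<in> P"
    using p_subgroup_conjugate_into[OF fin p P N] by blast
  have Nc: "N \<subseteq> carrier G" using subgroup.subset[OF N(1)] .
  interpret c: group_hom G G "gconj G g"
    using g(1) gconj_hom by unfold_locales (auto simp: hom_def)
  let ?T = "gconj G g ` P"
  have T: "subgroup ?T G" using c.subgroup_img_is_subgroup[OF sP] .
  have cT: "card ?T = p ^ multiplicity p (order G)"
    using cP card_image[OF inj_on_subset[OF gconj_inj[OF g(1)] subgroup.subset[OF sP]]] by simp
  have NT: "N \<subseteq> ?T"
  proof
    fix x assume x: "x \<in> N"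
    then have xc: "x \<in> carrier G" using Nc by blast
    have "gconj G (inv g) x \<in> P" using g(2)[OF x] g(1) by (simp add: gconj_def)
    then show "x \<in> ?T" using gconj_inv(2)[OF g(1) xc] by (metis image_eqI)
  qed
  have "N \<noteq> ?T" using ns N(1) cT by (auto simp: sylow_subgroup_def)
  then have NT2: "N \<subset> ?T" using NT by blast
  let ?M = "?T \<inter> normalizer G N"
  have sM: "subgroup ?M G" using subgroups_Inter_pair[OF T subgroup_normalizer[OF Nc]] .
  obtain t where t: "t \<in> ?T - N" "gconj G t ` N = N"
    using normalizer_grows[OF T cT p N(1) NT2] by blast
  then have "t \<in> ?M" using mem_normalizer_iff[OF Nc] subgroup.mem_carrier[OF T] by blast
  then have "N \<subset> ?M" using t(1) NT subset_normalizer[OF N(1)] by blast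
  moreover have "card ?M dvd card ?T"
  proof -
    interpret gT: group "G\<lparr>carrier := ?T\<rparr>" using subgroup_imp_group[OF T] .
    have "subgroup ?M (G\<lparr>carrier := ?T\<rparr>)" using subgroup_incl[OF sM T] by simp
    then have "card ?M * card (rcosets\<^bsub>G\<lparr>carrier := ?T\<rparr>\<^esub> ?M) = card ?T"
      using gT.lagrange by (simp add: order_def mult.commute)
    then show ?thesis by (rule dvdI[OF sym])
  qed
  then obtain m where "card ?M = p ^ m" using cT divides_primepow_nat[OF p] by auto
  ultimately show thesis using that[OF sM] mem_normalizer_iff[OF Nc] by blast
qed

section \<open>Morphisms of a fusion system\<close>

context fusion_system
begin

text \<open>
  A morphism as an arbitrary function of which only the values on P count. Composites and inverses
  need no restrictions in this form; \<open>mem_iff\<close> translates between the two.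
\<close>

definition mor :: "('a \<Rightarrow> 'a) \<Rightarrow> 'a set \<Rightarrow> bool"
  where "mor f P \<longleftrightarrow> restrict f P \<in> F P (f ` P)"

lemma mor_cong: "(\<And>x. x \<in> P \<Longrightarrow> f x = g x) \<Longrightarrow> mor f P \<longleftrightarrow> mor g P"
  unfolding mor_def by (metis (mono_tags, lifting) image_cong restrict_ext)

lemma morI:
  assumes "\<phi> \<in> F P Q"
  shows "mor \<phi> P" "subgroup P G" "subgroup Q G" "\<phi> ` P \<subseteq> Q" "\<phi> \<in> extensional P"
proof -
  show "subgroup P G" "subgroup Q G" using objects[OF assms] by auto
  show e: "\<phi> \<in> extensional P" using injective_hom[OF assms] by auto
  show "\<phi> ` P \<subseteq> Q" using injective_hom[OF assms] by (auto simp: mon_def hom_def)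
  show "mor \<phi> P" using iso_image[OF assms] e extensional_restrict by (fastforce simp: mor_def fus_iso_def)
qed

lemma mor_subgroup: "mor f P \<Longrightarrow> subgroup P G" "mor f P \<Longrightarrow> subgroup (f ` P) G"
  unfolding mor_def using objects by blast+

lemma mor_finite: "mor f P \<Longrightarrow> finite P"
  using mor_subgroup(1) finite_carrier finite_subset subgroup.subset by metis

lemma mor_mult: "mor f P \<Longrightarrow> x \<in> P \<Longrightarrow> y \<in> P \<Longrightarrow> f (x \<otimes> y) = f x \<otimes> f y"
  using injective_hom[of "restrict f P" P "f ` P"] mor_subgroup(1)[of f P] subgroup.m_closed
  by (fastforce simp: mor_def mon_def hom_def)

lemma mor_inj: "mor f P \<Longrightarrow> inj_on f P"
  using injective_hom[of "restrict f P" P "f ` P"] by (auto simp: mor_def mon_def inj_on_def)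

lemma mor_card: "mor f P \<Longrightarrow> card (f ` P) = card P"
  using mor_inj card_image by blast

lemma inclusion_mem:
  assumes "subgroup P G" "subgroup Q G" "P \<subseteq> Q"
  shows "(\<lambda>x\<in>P. x) \<in> F P Q"
proof -
  have c: "P \<subseteq> carrier G" using assms subgroup.subset by auto
  have e: "restrict (gconj G \<one>) P = (\<lambda>x\<in>P. x)" using c by (auto simp: gconj_one restrict_def subset_iff)
  have "gconj G \<one> ` P \<subseteq> Q" using c assms by (auto simp: gconj_one subset_iff)
  then show ?thesis using conjugation[OF assms(1,2) one_closed] e by simp
qed

lemma mor_mem:
  assumes "mor f P" "subgroup Q G" "f ` P \<subseteq> Q"
  shows "restrict f P \<in> F P Q"
proof -
  have "compose P (\<lambda>x\<in>f ` P. x) (restrict f P) \<in> F P Q"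
    using composition inclusion_mem[OF mor_subgroup(2)[OF assms(1)] assms(2,3)] assms(1) mor_def by blast
  also have "compose P (\<lambda>x\<in>f ` P. x) (restrict f P) = restrict f P"
    by (auto simp: compose_def restrict_def)
  finally show ?thesis .
qed

lemma mem_iff:
  "\<phi> \<in> F P Q \<longleftrightarrow> \<phi> \<in> extensional P \<and> mor \<phi> P \<and> subgroup Q G \<and> \<phi> ` P \<subseteq> Q"
  using morI mor_mem extensional_restrict by metis

lemma mor_restrict:
  assumes "mor f P" "subgroup Q G" "Q \<subseteq> P"
  shows "mor f Q"
proof -
  have "compose Q (restrict f P) (\<lambda>x\<in>Q. x) \<in> F Q (f ` P)"
    using composition inclusion_mem[OF assms(2) mor_subgroup(1)[OF assms(1)] assms(3)] assms(1) mor_def by blast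
  then have "mor (compose Q (restrict f P) (\<lambda>x\<in>Q. x)) Q" using morI by blast
  moreover have "compose Q (restrict f P) (\<lambda>x\<in>Q. x) x = f x" if "x \<in> Q" for x
    using that assms by (auto simp: compose_def)
  ultimately show ?thesis using mor_cong by blast
qed

lemma mor_image_subgroup: "mor f P \<Longrightarrow> subgroup Q G \<Longrightarrow> Q \<subseteq> P \<Longrightarrow> subgroup (f ` Q) G"
  using mor_subgroup(2)[OF mor_restrict] .

lemma mor_comp:
  assumes "mor f P" "mor g Q" "f ` P \<subseteq> Q"
  shows "mor (g \<circ> f) P"
proof -
  have "mor g (f ` P)" using mor_restrict[OF assms(2) mor_subgroup(2)[OF assms(1)] assms(3)] .
  then have "compose P (restrict g (f ` P)) (restrict f P) \<in> F P (g ` f ` P)"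
    using composition assms unfolding mor_def by blast
  then have "mor (compose P (restrict g (f ` P)) (restrict f P)) P" using morI by blast
  then show ?thesis by (rule mor_cong[THEN iffD1, rotated]) (auto simp: compose_def)
qed

lemma mor_inv:
  assumes "mor f P"
  shows "mor (inv_into P f) (f ` P)"
proof -
  have "restrict f P \<in> fus_iso F P (f ` P)" using iso_image assms by (fastforce simp: mor_def)
  then obtain \<psi> where \<psi>: "\<psi> \<in> F (f ` P) P" "compose P \<psi> (restrict f P) = (\<lambda>x\<in>P. x)"
    by (auto simp: fus_iso_def)
  have "\<psi> (f x) = x" if "x \<in> P" for x
    using fun_cong[OF \<psi>(2), of x] that by (simp add: compose_def)
  then have "\<psi> y = inv_into P f y" if "y \<in> f ` P" for y
    using that mor_inj[OF assms] by auto
  then show ?thesis using morI(1)[OF \<psi>(1)] mor_cong by blast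
qed

lemma mor_inv_apply: "mor f P \<Longrightarrow> x \<in> P \<Longrightarrow> inv_into P f (f x) = x"
  using mor_inj by simp

lemma mor_inv_image: "mor f P \<Longrightarrow> Q \<subseteq> P \<Longrightarrow> inv_into P f ` f ` Q = Q"
  using mor_inj inv_into_image_cancel by metis

lemma mor_gconj:
  assumes "subgroup P G" "g \<in> carrier G"
  shows "mor (gconj G g) P"
  unfolding mor_def using conjugation[OF assms(1) subgroup_gconj_image[OF assms] assms(2)] by auto

lemma mor_id: "subgroup P G \<Longrightarrow> mor (\<lambda>x. x) P"
  using identity morI(1) mor_cong[of P "\<lambda>x\<in>P. x" "\<lambda>x. x"] by auto

lemma mor_one: "mor f P \<Longrightarrow> f \<one> = \<one>"
  using mor_mult[of f P \<one> \<one>] mor_subgroup[of f P] subgroup.one_closed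
  by (metis image_eqI l_cancel_one one_closed r_one subgroup.mem_carrier)

lemma mor_minv:
  assumes "mor f P" "x \<in> P"
  shows "f (inv x) = inv (f x)"
proof -
  have "inv x \<in> P" "x \<in> carrier G" "f (inv x) \<in> carrier G" "f x \<in> carrier G"
    using assms mor_subgroup[OF assms(1)] subgroup.m_inv_closed subgroup.mem_carrier by (metis image_eqI)+
  then show ?thesis
    using mor_mult[OF assms(1) \<open>inv x \<in> P\<close> assms(2)] mor_one[OF assms(1)] inv_equality by simp
qed

lemma mor_conj:
  assumes "mor f P" "t \<in> P" "x \<in> P"
  shows "f (gconj G t x) = gconj G (f t) (f x)"
proof -
  have "inv t \<in> P" "inv t \<otimes> x \<in> P"
    using assms mor_subgroup[OF assms(1)] subgroup.m_inv_closed subgroup.m_closed by metis+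
  then show ?thesis unfolding gconj_def using mor_mult[OF assms(1)] mor_minv[OF assms(1)] assms by simp
qed

lemma mor_normalizer:
  assumes "mor f T" "subgroup P G" "P \<subseteq> T" "T \<subseteq> normalizer G P"
  shows "f ` T \<subseteq> normalizer G (f ` P)"
proof (rule image_subsetI)
  fix t assume t: "t \<in> T"
  have sub: "subgroup (f ` P) G" using mor_image_subgroup assms by blast
  show "f t \<in> normalizer G (f ` P)"
  proof (rule normalizer_memI[OF sub])
    show "finite (f ` P)" using mor_finite[OF mor_restrict[OF assms(1,2,3)]] by auto
    show "f t \<in> carrier G" using mor_subgroup(2)[OF assms(1)] t subgroup.mem_carrier by (metis image_eqI)
    fix y assume "y \<in> f ` P"
    then obtain x where x: "x \<in> P" "y = f x" by auto
    then have "gconj G t x \<in> P" using normalizer_memD[OF assms(2)] assms(4) t by blast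
    moreover have "gconj G (f t) y = f (gconj G t x)" using mor_conj[OF assms(1) t, of x] x assms(3) by auto
    ultimately show "gconj G (f t) y \<in> f ` P" by simp
  qed
qed

lemma conjugates_iff: "X \<in> fus_conjugates F P \<longleftrightarrow> (\<exists>f. mor f P \<and> X = f ` P)"
proof
  assume "X \<in> fus_conjugates F P"
  then show "\<exists>f. mor f P \<and> X = f ` P" unfolding fus_conjugates_def using morI(1) by blast
next
  assume "\<exists>f. mor f P \<and> X = f ` P"
  then obtain f where f: "mor f P" "X = f ` P" by auto
  then have "X = restrict f P ` P" by auto
  then show "X \<in> fus_conjugates F P" using f unfolding fus_conjugates_def mor_def by blast
qed

lemma iso_iff: "\<phi> \<in> fus_iso F P Q \<longleftrightarrow> \<phi> \<in> extensional P \<and> mor \<phi> P \<and> \<phi> ` P = Q"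
proof
  assume "\<phi> \<in> fus_iso F P Q"
  then obtain \<psi> where \<psi>: "\<phi> \<in> F P Q" "\<psi> \<in> F Q P" "compose Q \<phi> \<psi> = (\<lambda>x\<in>Q. x)"
    by (auto simp: fus_iso_def)
  have "Q \<subseteq> \<phi> ` P"
  proof
    fix y assume y: "y \<in> Q"
    have "\<phi> (\<psi> y) = y" using fun_cong[OF \<psi>(3), of y] y by (simp add: compose_def)
    moreover have "\<psi> y \<in> P" using morI(4)[OF \<psi>(2)] y by auto
    ultimately show "y \<in> \<phi> ` P" by force
  qed
  then show "\<phi> \<in> extensional P \<and> mor \<phi> P \<and> \<phi> ` P = Q" using morI[OF \<psi>(1)] by blast
next
  assume "\<phi> \<in> extensional P \<and> mor \<phi> P \<and> \<phi> ` P = Q"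
  then show "\<phi> \<in> fus_iso F P Q" using iso_image mem_iff mor_subgroup(2) by blast
qed

subsection \<open>Automorphism groups\<close>

abbreviation Aut :: "'a set \<Rightarrow> ('a \<Rightarrow> 'a) monoid"
  where "Aut Q \<equiv> fus_aut_group F Q"

lemma Aut_iff: "\<phi> \<in> carrier (Aut Q) \<longleftrightarrow> \<phi> \<in> extensional Q \<and> mor \<phi> Q \<and> \<phi> ` Q = Q"
  by (simp add: fus_aut_group_def iso_iff)

lemma Aut_closed: "f \<in> carrier (Aut Q) \<Longrightarrow> x \<in> Q \<Longrightarrow> f x \<in> Q"
  by (metis Aut_iff image_eqI)

lemma Aut_restrictI: "mor f Q \<Longrightarrow> f ` Q = Q \<Longrightarrow> restrict f Q \<in> carrier (Aut Q)"
  using mor_cong[of Q f "restrict f Q"] by (auto simp: Aut_iff)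

lemma Aut_Bij: "carrier (Aut Q) \<subseteq> Bij Q"
  by (rule subsetI) (simp add: Aut_iff Bij_def bij_betw_def mor_inj)

lemma Aut_mult: "f \<in> carrier (Aut Q) \<Longrightarrow> g \<in> carrier (Aut Q) \<Longrightarrow> f \<otimes>\<^bsub>Aut Q\<^esub> g = compose Q f g"
  using Aut_Bij[of Q] by (auto simp: fus_aut_group_def BijGroup_def)

lemma Aut_mult_apply:
  "f \<in> carrier (Aut Q) \<Longrightarrow> g \<in> carrier (Aut Q) \<Longrightarrow> x \<in> Q \<Longrightarrow> (f \<otimes>\<^bsub>Aut Q\<^esub> g) x = f (g x)"
  by (simp add: Aut_mult compose_def)

lemma Aut_one: "\<one>\<^bsub>Aut Q\<^esub> = (\<lambda>x\<in>Q. x)"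
  by (simp add: fus_aut_group_def BijGroup_def)

lemma group_Aut:
  assumes Q: "subgroup Q G"
  shows "group (Aut Q)"
proof (rule groupI)
  fix f g assume fg: "f \<in> carrier (Aut Q)" "g \<in> carrier (Aut Q)"
  have "mor (f \<circ> g) Q" using fg mor_comp by (auto simp: Aut_iff)
  then have "restrict (f \<circ> g) Q \<in> carrier (Aut Q)" using fg by (intro Aut_restrictI) (simp_all only: Aut_iff image_comp[symmetric])
  then show "f \<otimes>\<^bsub>Aut Q\<^esub> g \<in> carrier (Aut Q)"
    using fg by (simp add: Aut_mult compose_def restrict_def o_def)
next
  show "\<one>\<^bsub>Aut Q\<^esub> \<in> carrier (Aut Q)"
    using Aut_restrictI[OF mor_id[OF Q]] by (simp add: Aut_one)
next
  fix f g h assume fgh: "f \<in> carrier (Aut Q)" "g \<in> carrier (Aut Q)" "h \<in> carrier (Aut Q)"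
  have "h \<in> Q \<rightarrow> Q" using fgh Aut_closed by auto
  then show "f \<otimes>\<^bsub>Aut Q\<^esub> g \<otimes>\<^bsub>Aut Q\<^esub> h = f \<otimes>\<^bsub>Aut Q\<^esub> (g \<otimes>\<^bsub>Aut Q\<^esub> h)"
    using fgh Aut_Bij[of Q] compose_Bij[of _ Q] compose_assoc[of h Q Q f g]
    by (auto simp: fus_aut_group_def BijGroup_def subset_iff)
next
  fix f assume f: "f \<in> carrier (Aut Q)"
  then show "\<one>\<^bsub>Aut Q\<^esub> \<otimes>\<^bsub>Aut Q\<^esub> f = f"
    using Aut_Bij[of Q] id_Bij[of Q] by (auto simp: fus_aut_group_def BijGroup_def subset_iff Id_compose Bij_def bij_betw_imp_funcset)
  have "restrict (inv_into Q f) Q \<in> carrier (Aut Q)"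
    using f mor_inv[of f Q] mor_inv_image[of f Q Q] by (intro Aut_restrictI) (auto simp: Aut_iff)
  moreover have "restrict (inv_into Q f) Q \<otimes>\<^bsub>Aut Q\<^esub> f = \<one>\<^bsub>Aut Q\<^esub>"
    using f calculation Bij_compose_restrict_eq[of f Q] Aut_Bij[of Q] by (auto simp: Aut_mult Aut_one)
  ultimately show "\<exists>g\<in>carrier (Aut Q). g \<otimes>\<^bsub>Aut Q\<^esub> f = \<one>\<^bsub>Aut Q\<^esub>" by blast
qed

lemma Aut_inv_apply:
  assumes Q: "subgroup Q G" and "f \<in> carrier (Aut Q)" "x \<in> Q"
  shows "(inv\<^bsub>Aut Q\<^esub> f) (f x) = x" "f ((inv\<^bsub>Aut Q\<^esub> f) x) = x"
proof -
  interpret A: group "Aut Q" using group_Aut[OF Q] .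
  have i: "inv\<^bsub>Aut Q\<^esub> f \<in> carrier (Aut Q)" using assms by simp
  have "(inv\<^bsub>Aut Q\<^esub> f \<otimes>\<^bsub>Aut Q\<^esub> f) x = x" "(f \<otimes>\<^bsub>Aut Q\<^esub> inv\<^bsub>Aut Q\<^esub> f) x = x"
    using assms by (simp_all add: Aut_one)
  then show "(inv\<^bsub>Aut Q\<^esub> f) (f x) = x" "f ((inv\<^bsub>Aut Q\<^esub> f) x) = x"
    using Aut_mult_apply assms i by metis+
qed

lemma finite_Aut:
  assumes Q: "subgroup Q G"
  shows "finite (carrier (Aut Q))"
proof -
  have fQ: "finite Q" using Q finite_carrier finite_subset subgroup.subset by metis
  have "f \<in> Q \<rightarrow>\<^sub>E Q" if "f \<in> carrier (Aut Q)" for f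
    using Aut_closed[OF that] that unfolding Aut_iff by (intro PiE_I) (auto simp: extensional_def)
  then have "carrier (Aut Q) \<subseteq> Q \<rightarrow>\<^sub>E Q" by blast
  then show ?thesis using finite_PiE[OF fQ] fQ finite_subset by fastforce
qed

lemma Aut_eqI: "f \<in> carrier (Aut Q) \<Longrightarrow> g \<in> carrier (Aut Q) \<Longrightarrow> (\<And>x. x \<in> Q \<Longrightarrow> f x = g x) \<Longrightarrow> f = g"
  by (auto simp: Aut_iff intro: extensionalityI)

text \<open>
  The action of T on P by conjugation, carried over to Q. Conjugation is contravariant in the
  conjugating element, whence the inverse of t.
\<close>

lemma conjugation_action_hom:
  assumes \<phi>: "mor \<phi> P" "\<phi> ` P = Q" and T: "subgroup T G" "T \<subseteq> normalizer G P"
  shows "(\<lambda>t. \<lambda>y\<in>Q. \<phi> (gconj G (inv t) (inv_into P \<phi> y))) \<in> hom (G\<lparr>carrier := T\<rparr>) (Aut Q)"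
    (is "?h \<in> _")
proof (rule homI)
  have P: "subgroup P G" using \<phi> mor_subgroup by auto
  have Pc: "P \<subseteq> carrier G" using P subgroup.subset by auto
  have Tc: "T \<subseteq> carrier G" using T subgroup.subset by auto
  have cl: "?h t \<in> carrier (Aut Q)" if t: "t \<in> T" for t
  proof -
    have it: "inv t \<in> T" using subgroup.m_inv_closed[OF T(1) t] .
    have im: "gconj G (inv t) ` P = P" using it T mem_normalizer_iff[OF Pc] by auto
    have m1: "mor (gconj G (inv t)) P" using mor_gconj P it Tc by auto
    have m2: "mor (inv_into P \<phi>) Q" "inv_into P \<phi> ` Q = P" using mor_inv[OF \<phi>(1)] mor_inv_image[OF \<phi>(1), of P] \<phi> by auto
    have "mor (\<phi> \<circ> (gconj G (inv t) \<circ> inv_into P \<phi>)) Q"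
      by (intro mor_comp[OF _ \<phi>(1)] mor_comp[OF m2(1) m1])
        (simp_all only: image_comp[symmetric] m2 im order_refl)
    moreover have "(\<phi> \<circ> (gconj G (inv t) \<circ> inv_into P \<phi>)) ` Q = Q"
      by (simp only: image_comp[symmetric] m2 im \<phi>)
    ultimately show ?thesis using Aut_restrictI by (fastforce simp: o_def)
  qed
  show "?h t \<in> carrier (Aut Q)" if "t \<in> carrier (G\<lparr>carrier := T\<rparr>)" for t
    using cl that by simp
  fix t u assume "t \<in> carrier (G\<lparr>carrier := T\<rparr>)" "u \<in> carrier (G\<lparr>carrier := T\<rparr>)"
  then have tu: "t \<in> T" "u \<in> T" by auto
  then have tuT: "t \<otimes> u \<in> T" using subgroup.m_closed[OF T(1) tu] by simp
  interpret A: group "Aut Q" using group_Aut mor_subgroup \<phi> by auto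
  have "?h (t \<otimes> u) = ?h t \<otimes>\<^bsub>Aut Q\<^esub> ?h u"
  proof (rule Aut_eqI)
    show "?h (t \<otimes> u) \<in> carrier (Aut Q)" using cl tuT by blast
    show "?h t \<otimes>\<^bsub>Aut Q\<^esub> ?h u \<in> carrier (Aut Q)" using cl tu by blast
    fix y assume y: "y \<in> Q"
    then obtain x where x: "x \<in> P" "y = \<phi> x" using \<phi> by auto
    have ux: "gconj G (inv u) x \<in> P" using normalizer_memD[OF P subsetD[OF T(2) subgroup.m_inv_closed[OF T(1) tu(2)]] x(1)] .
    have "(?h t \<otimes>\<^bsub>Aut Q\<^esub> ?h u) y = ?h t (?h u y)" using Aut_mult_apply[OF cl cl y] tu by auto
    also have "\<dots> = \<phi> (gconj G (inv t) (gconj G (inv u) x))"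
      using x y ux mor_inv_apply[OF \<phi>(1)] \<phi>(2) by auto
    also have "\<dots> = \<phi> (gconj G (inv (t \<otimes> u)) x)"
      using tu Tc Pc x by (subst gconj_mult[symmetric]) (auto simp: inv_mult_group subset_iff)
    finally show "?h (t \<otimes> u) y = (?h t \<otimes>\<^bsub>Aut Q\<^esub> ?h u) y"
      using x y mor_inv_apply[OF \<phi>(1)] by simp
  qed
  then show "?h (t \<otimes>\<^bsub>G\<lparr>carrier := T\<rparr>\<^esub> u) = ?h t \<otimes>\<^bsub>Aut Q\<^esub> ?h u" by simp
qed

end

section \<open>Extending morphisms in a fusion system on a \<open>p\<close>-group\<close>

locale p_fusion_system = fusion_system +
  fixes p :: nat
  assumes prime_p: "prime p" and p_group: "\<exists>n. order G = p ^ n"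
begin

lemma subgroup_p_power:
  assumes "subgroup T G"
  shows "\<exists>n. card T = p ^ n"
proof -
  obtain n where "order G = p ^ n" using p_group by auto
  then have "card T dvd p ^ n" using lagrange[OF assms] by (metis dvd_triv_right)
  then show ?thesis using prime_p divides_primepow_nat by blast
qed

lemma finite_subgroup: "subgroup T G \<Longrightarrow> finite T"
  using finite_carrier finite_subset subgroup.subset by metis

lemma proper_subgroup_normalizer:
  assumes "subgroup T G" "subgroup H G" "H \<subset> T"
  shows "\<exists>t \<in> T - H. t \<in> normalizer G H"
proof -
  obtain n where "card T = p ^ n" using subgroup_p_power assms(1) by auto
  then obtain t where t: "t \<in> T - H" "gconj G t ` H = H"
    using normalizer_grows[OF assms(1) _ prime_p assms(2,3)] by blast
  then have "t \<in> carrier G" using subgroup.mem_carrier[OF assms(1)] by auto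
  then show ?thesis using t mem_normalizer_iff[OF subgroup.subset[OF assms(2)]] by auto
qed

lemma subgroup_normalizer': "subgroup H G \<Longrightarrow> subgroup (normalizer G H) G"
  using subgroup_normalizer[OF subgroup.subset] .

text \<open>
  The set does not change if t is replaced by its inverse, so it is the image of the homomorphism
  in \<open>conjugation_action_hom\<close>.
\<close>

lemma transported_action_p_subgroup:
  assumes \<phi>: "mor \<phi> P" "\<phi> ` P = Q" and T: "subgroup T G" "T \<subseteq> normalizer G P"
  defines "X \<equiv> (\<lambda>t. \<lambda>y\<in>Q. \<phi> (gconj G t (inv_into P \<phi> y))) ` T"
  shows "subgroup X (Aut Q)" "\<exists>n. card X = p ^ n"
proof -
  let ?h = "\<lambda>t. \<lambda>y\<in>Q. \<phi> (gconj G (inv t) (inv_into P \<phi> y))"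
  have Q: "subgroup Q G" using mor_subgroup(2)[OF \<phi>(1)] \<phi>(2) by simp
  interpret h: group_hom "G\<lparr>carrier := T\<rparr>" "Aut Q" ?h
    using conjugation_action_hom[OF \<phi> T] group_Aut[OF Q] subgroup_imp_group[OF T(1)]
    by (simp add: group_hom_def group_hom_axioms_def)
  have iT: "T = m_inv G ` T"
  proof
    show "m_inv G ` T \<subseteq> T" using subgroup.m_inv_closed[OF T(1)] by auto
    have "t \<in> m_inv G ` T" if t: "t \<in> T" for t
      using image_eqI[of t "m_inv G" "inv t" T] subgroup.mem_carrier[OF T(1) t] subgroup.m_inv_closed[OF T(1) t] by simp
    then show "T \<subseteq> m_inv G ` T" by blast
  qed
  have X: "X = ?h ` T"
  proof -
    have "X = (\<lambda>t. \<lambda>y\<in>Q. \<phi> (gconj G t (inv_into P \<phi> y))) ` (m_inv G ` T)" using iT X_def by simp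
    then show ?thesis by (simp add: image_image)
  qed
  show "subgroup X (Aut Q)" using h.img_is_subgroup X by simp
  obtain n where n: "card T = p ^ n" using subgroup_p_power[OF T(1)] by auto
  have "card (?h ` T) dvd card T"
    using dvdI[OF h.card_image_kernel[OF h.G.subgroup_self, symmetric]] by simp
  then show "\<exists>n. card X = p ^ n" using X n divides_primepow_nat[OF prime_p] by auto
qed

lemma inner_auts_p_subgroup:
  assumes Q: "subgroup Q G"
  shows "subgroup (inner_auts G Q) (Aut Q)" "\<exists>n. card (inner_auts G Q) = p ^ n"
proof -
  have "inner_auts G Q = (\<lambda>t. \<lambda>y\<in>Q. gconj G t (inv_into Q (\<lambda>x. x) y)) ` normalizer G Q"
    unfolding inner_auts_def using inv_into_f_f[of "\<lambda>x. x" Q] by (intro image_cong refl restrict_ext) simp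
  then show "subgroup (inner_auts G Q) (Aut Q)" "\<exists>n. card (inner_auts G Q) = p ^ n"
    using transported_action_p_subgroup[OF mor_id[OF Q] _ subgroup_normalizer'[OF Q] order_refl, of Q] by simp_all
qed

definition saturated_at :: "'a set \<Rightarrow> bool"
  where "saturated_at Q \<longleftrightarrow>
    (\<exists>f. mor f Q \<and> fully_automized p G F (f ` Q) \<and> receptive G F (f ` Q))"

text \<open>
  Let Z be a Sylow subgroup of K. A morphism from Q to a fully automized conjugate carries Z to a
  p-subgroup of the automorphism group there, which can be conjugated into the Sylow subgroup of
  inner automorphisms; the composite is \<open>\<chi>\<close>. Every p-subgroup X of K is
  conjugate in K to a subgroup of Z. The conclusion says that \<open>\<chi> k\<close> conjugates X
  to inner automorphisms, written without inverses.
\<close>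

lemma automorphism_p_subgroups_into_inner:
  assumes sat: "saturated_at Q" and Q: "subgroup Q G" and K: "subgroup K (Aut Q)"
  obtains \<chi> where "mor \<chi> Q" "receptive G F (\<chi> ` Q)"
    "\<And>X n. \<lbrakk>subgroup X (Aut Q); X \<subseteq> K; card X = p ^ n\<rbrakk> \<Longrightarrow>
       \<exists>k\<in>K. \<forall>x\<in>X. \<exists>s\<in>normalizer G (\<chi> ` Q). \<forall>y\<in>Q. \<chi> (k (x y)) = gconj G s (\<chi> (k y))"
proof -
  obtain \<chi>0 where \<chi>0: "mor \<chi>0 Q" "fully_automized p G F (\<chi>0 ` Q)" "receptive G F (\<chi>0 ` Q)"
    using sat by (auto simp: saturated_at_def)
  let ?Q = "\<chi>0 ` Q"
  have Q': "subgroup ?Q G" using mor_subgroup(2)[OF \<chi>0(1)] .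
  interpret A: group "Aut Q" using group_Aut[OF Q] .
  interpret A': group "Aut ?Q" using group_Aut[OF Q'] .
  interpret AK: group "(Aut Q)\<lparr>carrier := K\<rparr>" using A.subgroup_imp_group[OF K] .
  have finK: "finite K" using finite_Aut[OF Q] subgroup.subset[OF K] finite_subset by blast
  obtain Z where Z: "sylow_subgroup p ((Aut Q)\<lparr>carrier := K\<rparr>) Z"
    using AK.sylow_exists[OF _ prime_p] finK by auto
  \<comment> \<open>Conjugation by \<open>\<chi>0\<close>, from the automorphism group of Q to that of its
     image.\<close>
  let ?h = "\<lambda>k. \<lambda>y\<in>?Q. \<chi>0 (k (inv_into Q \<chi>0 y))"
  have h_apply: "?h k (\<chi>0 y) = \<chi>0 (k y)" if "y \<in> Q" for k y
    using that mor_inv_apply[OF \<chi>0(1)] by simp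
  have h_cl: "?h k \<in> carrier (Aut ?Q)" if k: "k \<in> carrier (Aut Q)" for k
  proof -
    have m2: "mor (inv_into Q \<chi>0) ?Q" "inv_into Q \<chi>0 ` ?Q = Q"
      using mor_inv[OF \<chi>0(1)] mor_inv_image[OF \<chi>0(1) order_refl] by auto
    have k': "mor k Q" "k ` Q = Q" using k by (auto simp: Aut_iff)
    have "mor (\<chi>0 \<circ> (k \<circ> inv_into Q \<chi>0)) ?Q"
      by (intro mor_comp[OF _ \<chi>0(1)] mor_comp[OF m2(1) k'(1)])
        (simp_all only: image_comp[symmetric] m2 k' order_refl)
    moreover have "(\<chi>0 \<circ> (k \<circ> inv_into Q \<chi>0)) ` ?Q = ?Q"
      by (simp only: image_comp[symmetric] m2 k')
    ultimately show ?thesis using Aut_restrictI[of "\<chi>0 \<circ> (k \<circ> inv_into Q \<chi>0)" ?Q] by (simp add: o_def)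
  qed
  have h: "?h \<in> hom ((Aut Q)) (Aut ?Q)"
  proof (rule homI)
    fix k l assume kl: "k \<in> carrier (Aut Q)" "l \<in> carrier (Aut Q)"
    show "?h (k \<otimes>\<^bsub>Aut Q\<^esub> l) = ?h k \<otimes>\<^bsub>Aut ?Q\<^esub> ?h l"
    proof (rule Aut_eqI[OF h_cl A'.m_closed[OF h_cl h_cl]])
      fix y assume "y \<in> ?Q"
      then obtain x where x: "x \<in> Q" "y = \<chi>0 x" by auto
      have "(?h k \<otimes>\<^bsub>Aut ?Q\<^esub> ?h l) y = ?h k (?h l (\<chi>0 x))"
        using Aut_mult_apply[OF h_cl[OF kl(1)] h_cl[OF kl(2)]] x by simp
      also have "\<dots> = \<chi>0 (k (l x))" using h_apply x Aut_closed[OF kl(2)] by metis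
      also have "\<dots> = ?h (k \<otimes>\<^bsub>Aut Q\<^esub> l) y" using h_apply[OF x(1)] x Aut_mult_apply[OF kl x(1)] by simp
      finally show "?h (k \<otimes>\<^bsub>Aut Q\<^esub> l) y = (?h k \<otimes>\<^bsub>Aut ?Q\<^esub> ?h l) y" by simp
    qed (use kl in auto)
  qed (rule h_cl)
  interpret h: group_hom "Aut Q" "Aut ?Q" ?h
    using h by unfold_locales
  have cZ: "\<exists>a. card Z = p ^ a" using Z unfolding sylow_subgroup_def by (intro exI) (erule conjunct2)
  have Z': "subgroup Z ((Aut Q)\<lparr>carrier := K\<rparr>)" using Z by (simp add: sylow_subgroup_def)
  have ZK: "Z \<subseteq> K" "subgroup Z (Aut Q)"
    using subgroup.subset[OF Z'] A.incl_subgroup[OF K Z'] by simp_all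
  have hZ: "subgroup (?h ` Z) (Aut ?Q)" using h.subgroup_img_is_subgroup[OF ZK(2)] .
  obtain m where "card (?h ` Z) = p ^ m"
  proof -
    have "card (?h ` Z) dvd card Z" by (rule dvdI[OF h.card_image_kernel[OF ZK(2), symmetric]])
    moreover obtain a where "card Z = p ^ a" using cZ by (elim exE)
    ultimately have "\<exists>m. card (?h ` Z) = p ^ m" using divides_primepow_nat[OF prime_p] by auto
    then show thesis using that by (elim exE)
  qed
  then have "\<exists>\<gamma>\<in>carrier (Aut ?Q). \<forall>z\<in>?h ` Z. \<gamma> \<otimes>\<^bsub>Aut ?Q\<^esub> z \<otimes>\<^bsub>Aut ?Q\<^esub> inv\<^bsub>Aut ?Q\<^esub> \<gamma> \<in> inner_auts G ?Q"
    using A'.p_subgroup_conjugate_into[OF finite_Aut[OF Q'] prime_p _ hZ] \<chi>0(2)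
    by (simp add: fully_automized_def)
  then obtain \<gamma> where \<gamma>: "\<gamma> \<in> carrier (Aut ?Q)"
    "\<And>z. z \<in> ?h ` Z \<Longrightarrow> \<gamma> \<otimes>\<^bsub>Aut ?Q\<^esub> z \<otimes>\<^bsub>Aut ?Q\<^esub> inv\<^bsub>Aut ?Q\<^esub> \<gamma> \<in> inner_auts G ?Q"
    by blast
  let ?\<chi> = "\<gamma> \<circ> \<chi>0"
  have \<gamma>m: "mor \<gamma> ?Q" "\<gamma> ` ?Q = ?Q" using \<gamma>(1) by (auto simp: Aut_iff)
  have im: "?\<chi> ` Q = ?Q" by (simp only: image_comp[symmetric] \<gamma>m)
  have z_inner: "\<exists>s\<in>normalizer G ?Q. \<forall>y\<in>Q. ?\<chi> (z y) = gconj G s (?\<chi> y)" if z: "z \<in> Z" for z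
  proof -
    have zA: "z \<in> carrier (Aut Q)" using z ZK subgroup.mem_carrier by metis
    let ?c = "\<gamma> \<otimes>\<^bsub>Aut ?Q\<^esub> ?h z \<otimes>\<^bsub>Aut ?Q\<^esub> inv\<^bsub>Aut ?Q\<^esub> \<gamma>"
    obtain s where s: "s \<in> normalizer G ?Q" "?c = restrict (gconj G s) ?Q"
      using \<gamma>(2)[of "?h z"] z by (auto simp: inner_auts_def)
    have cA: "?c \<in> carrier (Aut ?Q)" using \<gamma> h_cl[OF zA] by simp
    have "?c \<otimes>\<^bsub>Aut ?Q\<^esub> \<gamma> = \<gamma> \<otimes>\<^bsub>Aut ?Q\<^esub> ?h z" using \<gamma>(1) h_cl[OF zA] by (simp add: A'.m_assoc)
    then have eq: "(?c \<otimes>\<^bsub>Aut ?Q\<^esub> \<gamma>) (\<chi>0 y) = (\<gamma> \<otimes>\<^bsub>Aut ?Q\<^esub> ?h z) (\<chi>0 y)" for y by simp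
    have "?\<chi> (z y) = gconj G s (?\<chi> y)" if y: "y \<in> Q" for y
    proof -
      have "?\<chi> (z y) = \<gamma> (?h z (\<chi>0 y))" using h_apply[OF y] by simp
      also have "\<dots> = ?c (\<gamma> (\<chi>0 y))"
        using eq[of y] Aut_mult_apply[OF cA \<gamma>(1), of "\<chi>0 y"] Aut_mult_apply[OF \<gamma>(1) h_cl[OF zA], of "\<chi>0 y"] y by simp
      also have "\<dots> = gconj G s (?\<chi> y)" using s(2) Aut_closed[OF \<gamma>(1), of "\<chi>0 y"] y by simp
      finally show ?thesis .
    qed
    then show ?thesis using s by blast
  qed
  show thesis
  proof (rule that[of ?\<chi>])
    show "mor ?\<chi> Q" using mor_comp[OF \<chi>0(1) \<gamma>m(1)] by simp
    show "receptive G F (?\<chi> ` Q)" using \<chi>0 im by simp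
    fix X n assume X: "subgroup X (Aut Q)" "X \<subseteq> K" "card X = p ^ n"
    then obtain k where k: "k \<in> K"
      "\<And>x. x \<in> X \<Longrightarrow> k \<otimes>\<^bsub>Aut Q\<^esub> x \<otimes>\<^bsub>Aut Q\<^esub> inv\<^bsub>(Aut Q)\<lparr>carrier := K\<rparr>\<^esub> k \<in> Z"
      using AK.p_subgroup_conjugate_into[OF _ prime_p Z A.subgroup_incl[OF X(1) K X(2)] X(3)] finK by auto
    have kA: "k \<in> carrier (Aut Q)" using subgroup.mem_carrier[OF K k(1)] .
    show "\<exists>k\<in>K. \<forall>x\<in>X. \<exists>s\<in>normalizer G (?\<chi> ` Q). \<forall>y\<in>Q. ?\<chi> (k (x y)) = gconj G s (?\<chi> (k y))"
    proof (intro bexI[OF _ k(1)] ballI)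
      fix x assume x: "x \<in> X"
      have xA: "x \<in> carrier (Aut Q)" using subgroup.mem_carrier[OF X(1) x] .
      let ?z = "k \<otimes>\<^bsub>Aut Q\<^esub> x \<otimes>\<^bsub>Aut Q\<^esub> inv\<^bsub>Aut Q\<^esub> k"
      have zZ: "?z \<in> Z" using k(2)[OF x] A.m_inv_consistent[OF K k(1)] by simp
      have "?z \<otimes>\<^bsub>Aut Q\<^esub> k = k \<otimes>\<^bsub>Aut Q\<^esub> x" using kA xA by (simp add: A.m_assoc)
      moreover have zA: "?z \<in> carrier (Aut Q)" using kA xA by simp
      ultimately have zk: "?z (k y) = k (x y)" if "y \<in> Q" for y
        using Aut_mult_apply[OF zA kA that] Aut_mult_apply[OF kA xA that] by simp
      obtain s where s: "s \<in> normalizer G ?Q" "\<And>y. y \<in> Q \<Longrightarrow> ?\<chi> (?z y) = gconj G s (?\<chi> y)"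
        using z_inner[OF zZ] by blast
      have "?\<chi> (k (x y)) = gconj G s (?\<chi> (k y))" if "y \<in> Q" for y
        using s(2)[OF Aut_closed[OF kA that]] zk[OF that] by simp
      then show "\<exists>s\<in>normalizer G (?\<chi> ` Q). \<forall>y\<in>Q. ?\<chi> (k (x y)) = gconj G s (?\<chi> (k y))"
        using s(1) im by auto
    qed
  qed
qed

text \<open>
  The condition that \<open>\<phi>\<close> conjugates the action of x to the conjugation by s,
  without inverses.
\<close>

lemma mem_extension_domain:
  assumes \<phi>: "mor \<phi> P" "\<phi> ` P = Q"
  shows "x \<in> extension_domain G P Q \<phi> \<longleftrightarrow>
    x \<in> normalizer G P \<and> (\<exists>s\<in>normalizer G Q. \<forall>y\<in>P. \<phi> (gconj G x y) = gconj G s (\<phi> y))"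
proof -
  have "(\<lambda>y\<in>Q. \<phi> (gconj G x (inv_into P \<phi> y))) = restrict (gconj G s) Q \<longleftrightarrow>
      (\<forall>y\<in>P. \<phi> (gconj G x y) = gconj G s (\<phi> y))" for s
  proof
    assume *: "(\<lambda>y\<in>Q. \<phi> (gconj G x (inv_into P \<phi> y))) = restrict (gconj G s) Q"
    show "\<forall>y\<in>P. \<phi> (gconj G x y) = gconj G s (\<phi> y)"
    proof
      fix y assume "y \<in> P"
      then show "\<phi> (gconj G x y) = gconj G s (\<phi> y)"
        using fun_cong[OF *, of "\<phi> y"] \<phi>(2) mor_inv_apply[OF \<phi>(1)] by auto
    qed
  next
    assume "\<forall>y\<in>P. \<phi> (gconj G x y) = gconj G s (\<phi> y)"
    then show "(\<lambda>y\<in>Q. \<phi> (gconj G x (inv_into P \<phi> y))) = restrict (gconj G s) Q"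
      using \<phi>(2) mor_inv_apply[OF \<phi>(1)] by (intro restrict_ext) auto
  qed
  then show ?thesis by (auto simp: extension_domain_def inner_auts_def)
qed

lemma subgroup_extension_domain:
  assumes \<phi>: "mor \<phi> P" "\<phi> ` P = Q"
  shows "subgroup (extension_domain G P Q \<phi>) G"
proof (rule subgroupI)
  let ?N = "extension_domain G P Q \<phi>"
  note iff = mem_extension_domain[OF \<phi>]
  have P: "subgroup P G" and Q: "subgroup Q G" using mor_subgroup[OF \<phi>(1)] \<phi>(2) by auto
  note NP = subgroup_normalizer'[OF P] and NQ = subgroup_normalizer'[OF Q]
  have Pc: "x \<in> carrier G" if "x \<in> P" for x using subgroup.mem_carrier[OF P that] .
  have Qc: "\<phi> x \<in> carrier G" if "x \<in> P" for x using subgroup.mem_carrier[OF Q] that \<phi>(2) by auto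
  show "?N \<subseteq> carrier G" using iff subgroup.subset[OF NP] by blast
  have "\<one> \<in> ?N" unfolding iff
    using subgroup.one_closed[OF NP] subgroup.one_closed[OF NQ] gconj_one Pc Qc by (intro conjI bexI[of _ \<one>]) auto
  then show "?N \<noteq> {}" by blast
  fix a assume a: "a \<in> ?N"
  then obtain s where s: "a \<in> normalizer G P" "s \<in> normalizer G Q" "\<And>y. y \<in> P \<Longrightarrow> \<phi> (gconj G a y) = gconj G s (\<phi> y)"
    unfolding iff by blast
  have ac: "a \<in> carrier G" "s \<in> carrier G" using s subgroup.mem_carrier[OF NP] subgroup.mem_carrier[OF NQ] by auto
  have ia: "inv a \<in> normalizer G P" "inv s \<in> normalizer G Q"
    using s subgroup.m_inv_closed[OF NP] subgroup.m_inv_closed[OF NQ] by auto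
  have "\<phi> (gconj G (inv a) y) = gconj G (inv s) (\<phi> y)" if y: "y \<in> P" for y
  proof -
    have z: "gconj G (inv a) y \<in> P" using normalizer_memD[OF P ia(1) y] .
    have "\<phi> y = gconj G s (\<phi> (gconj G (inv a) y))" using s(3)[OF z] gconj_inv(2)[OF ac(1) Pc[OF y]] by simp
    then show ?thesis using gconj_inv(1)[OF ac(2) Qc[OF z]] by simp
  qed
  then show "inv a \<in> ?N" unfolding iff using ia by blast
  fix b assume b: "b \<in> ?N"
  then obtain t where t: "b \<in> normalizer G P" "t \<in> normalizer G Q" "\<And>y. y \<in> P \<Longrightarrow> \<phi> (gconj G b y) = gconj G t (\<phi> y)"
    unfolding iff by blast
  have bc: "b \<in> carrier G" "t \<in> carrier G" using t subgroup.mem_carrier[OF NP] subgroup.mem_carrier[OF NQ] by auto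
  have "\<phi> (gconj G (a \<otimes> b) y) = gconj G (s \<otimes> t) (\<phi> y)" if y: "y \<in> P" for y
    using y s t ac bc Pc Qc normalizer_memD[OF P s(1) y] gconj_mult by simp
  then show "a \<otimes> b \<in> ?N" unfolding iff
    using subgroup.m_closed[OF NP s(1) t(1)] subgroup.m_closed[OF NQ s(2) t(2)] by blast
qed

lemma subset_extension_domain:
  assumes \<phi>: "mor \<phi> P" "\<phi> ` P = Q"
  shows "P \<subseteq> extension_domain G P Q \<phi>"
proof
  fix x assume x: "x \<in> P"
  have "subgroup P G" "subgroup Q G" using mor_subgroup[OF \<phi>(1)] \<phi>(2) by auto
  then have "x \<in> normalizer G P" "\<phi> x \<in> normalizer G Q" using subset_normalizer x \<phi>(2) by blast+
  then show "x \<in> extension_domain G P Q \<phi>"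
    unfolding mem_extension_domain[OF \<phi>] using mor_conj[OF \<phi>(1) x] by blast
qed

lemma extension_domain_restrict:
  assumes "mor \<phi> P" "\<phi> ` P = Q"
  shows "extension_domain G P Q (restrict \<phi> P) = extension_domain G P Q \<phi>"
proof -
  have "mor (restrict \<phi> P) P" "restrict \<phi> P ` P = Q" using assms mor_cong[of P "restrict \<phi> P" \<phi>] by auto
  note iff = mem_extension_domain[OF this]
  have P: "subgroup P G" using mor_subgroup assms by blast
  show ?thesis
    unfolding set_eq_iff iff mem_extension_domain[OF assms] using normalizer_memD[OF P] by auto
qed

lemma receptive_extension:
  assumes rec: "receptive G F Q" and \<phi>: "mor \<phi> P" "\<phi> ` P = Q"
  obtains \<psi> where "mor \<psi> (extension_domain G P Q \<phi>)" "\<And>x. x \<in> P \<Longrightarrow> \<psi> x = \<phi> x"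
proof -
  have "restrict \<phi> P \<in> fus_iso F P Q" using \<phi> mor_cong[of P "restrict \<phi> P" \<phi>] by (simp add: iso_iff)
  then obtain \<psi> where "\<psi> \<in> F (extension_domain G P Q (restrict \<phi> P)) (carrier G)" "\<forall>x\<in>P. \<psi> x = restrict \<phi> P x"
    using rec unfolding receptive_def by blast
  then show thesis using that[of \<psi>] morI(1) extension_domain_restrict[OF \<phi>] by auto
qed

definition p_subgroups_become_inner :: "('a \<Rightarrow> 'a) set \<Rightarrow> ('a \<Rightarrow> 'a) \<Rightarrow> 'a set \<Rightarrow> bool"
  where "p_subgroups_become_inner K \<chi> Q \<longleftrightarrow>
    (\<forall>X n. subgroup X (Aut Q) \<and> X \<subseteq> K \<and> card X = p ^ n \<longrightarrow>
      (\<exists>k\<in>K. \<forall>x\<in>X. \<exists>s\<in>normalizer G (\<chi> ` Q). \<forall>y\<in>Q. \<chi> (k (x y)) = gconj G s (\<chi> (k y))))"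

text \<open>
  Receptivity up to K: if T acts, along \<open>\<phi>\<close>, on Q through K, then \<open>\<chi>
  k \<phi>\<close> extends over T for some k in K. The map \<open>\<chi>\<close> does not depend
  on \<open>\<phi>\<close> and T, so two extensions obtained from it can be compared.
\<close>

definition extends_modulo :: "('a \<Rightarrow> 'a) set \<Rightarrow> ('a \<Rightarrow> 'a) \<Rightarrow> 'a set \<Rightarrow> bool"
  where "extends_modulo K \<chi> Q \<longleftrightarrow>
    (\<forall>\<phi> P T. mor \<phi> P \<and> \<phi> ` P = Q \<and> subgroup T G \<and> T \<subseteq> normalizer G P \<and>
        (\<forall>t\<in>T. \<exists>\<kappa>\<in>K. \<forall>y\<in>P. \<phi> (gconj G t y) = \<kappa> (\<phi> y)) \<longrightarrow>
      (\<exists>k\<in>K. \<exists>\<psi> U. mor \<psi> U \<and> P \<subseteq> U \<and> T \<subseteq> U \<and> U \<subseteq> normalizer G P \<and> (\<forall>x\<in>P. \<psi> x = \<chi> (k (\<phi> x)))))"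

lemma extends_moduloE:
  assumes "extends_modulo K \<chi> Q" "mor \<phi> P" "\<phi> ` P = Q" "subgroup T G" "T \<subseteq> normalizer G P"
    "\<And>t. t \<in> T \<Longrightarrow> \<exists>\<kappa>\<in>K. \<forall>y\<in>P. \<phi> (gconj G t y) = \<kappa> (\<phi> y)"
  obtains k \<psi> U where "k \<in> K" "mor \<psi> U" "P \<subseteq> U" "T \<subseteq> U" "U \<subseteq> normalizer G P"
    "\<forall>x\<in>P. \<psi> x = \<chi> (k (\<phi> x))"
proof -
  have "\<exists>k\<in>K. \<exists>\<psi> U. mor \<psi> U \<and> P \<subseteq> U \<and> T \<subseteq> U \<and> U \<subseteq> normalizer G P \<and> (\<forall>x\<in>P. \<psi> x = \<chi> (k (\<phi> x)))"
    using assms(1)[unfolded extends_modulo_def, rule_format, of \<phi> P T] assms(2-6) by simp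
  then show thesis using that by (elim bexE exE conjE) simp
qed

text \<open>
  Along \<open>\<phi>\<close>, the group T acts on Q by a p-subgroup of K. Some k in K moves this
  subgroup to one that becomes inner under \<open>\<chi>\<close>; then T lies in the extension
  domain of \<open>\<chi> k \<phi>\<close>, and the image of \<open>\<chi>\<close> is receptive.
\<close>

lemma extension_modulo_automorphisms:
  assumes sat: "saturated_at Q" and Q: "subgroup Q G" and K: "subgroup K (Aut Q)"
  obtains \<chi> where "mor \<chi> Q" "p_subgroups_become_inner K \<chi> Q" "extends_modulo K \<chi> Q"
proof -
  obtain \<chi> where \<chi>: "mor \<chi> Q" "receptive G F (\<chi> ` Q)"
    "\<And>X n. \<lbrakk>subgroup X (Aut Q); X \<subseteq> K; card X = p ^ n\<rbrakk> \<Longrightarrow>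
       \<exists>k\<in>K. \<forall>x\<in>X. \<exists>s\<in>normalizer G (\<chi> ` Q). \<forall>y\<in>Q. \<chi> (k (x y)) = gconj G s (\<chi> (k y))"
    using automorphism_p_subgroups_into_inner[OF sat Q K] by blast
  show thesis
  proof (rule that[OF \<chi>(1)])
    show "p_subgroups_become_inner K \<chi> Q"
      unfolding p_subgroups_become_inner_def using \<chi>(3) by (intro allI impI) (elim conjE)
    show "extends_modulo K \<chi> Q"
      unfolding extends_modulo_def
    proof (intro allI impI, elim conjE)
    fix \<phi> P T
    assume \<phi>: "mor \<phi> P" "\<phi> ` P = Q" and T: "subgroup T G" "T \<subseteq> normalizer G P"
      and comp': "\<forall>t\<in>T. \<exists>\<kappa>\<in>K. \<forall>y\<in>P. \<phi> (gconj G t y) = \<kappa> (\<phi> y)"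
    note comp = bspec[OF comp']
    have P: "subgroup P G" using mor_subgroup(1)[OF \<phi>(1)] .
    let ?X = "(\<lambda>t. \<lambda>y\<in>Q. \<phi> (gconj G t (inv_into P \<phi> y))) ` T"
    have X: "subgroup ?X (Aut Q)" "\<exists>n. card ?X = p ^ n"
      using transported_action_p_subgroup[OF \<phi> T] by auto
    have "?X \<subseteq> K"
    proof
      fix x assume "x \<in> ?X"
      then obtain t where t: "t \<in> T" "x = (\<lambda>y\<in>Q. \<phi> (gconj G t (inv_into P \<phi> y)))" by auto
      obtain \<kappa> where \<kappa>: "\<kappa> \<in> K" "\<And>y. y \<in> P \<Longrightarrow> \<phi> (gconj G t y) = \<kappa> (\<phi> y)" using comp[OF t(1)] by auto
      have "x = \<kappa>"
      proof (rule Aut_eqI)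
        show "x \<in> carrier (Aut Q)" using \<open>x \<in> ?X\<close> by (rule subgroup.mem_carrier[OF X(1)])
        show "\<kappa> \<in> carrier (Aut Q)" using \<kappa>(1) by (rule subgroup.mem_carrier[OF K])
        fix y assume "y \<in> Q"
        then show "x y = \<kappa> y" using \<kappa>(2) \<phi>(2) t(2) mor_inv_apply[OF \<phi>(1)] by auto
      qed
      then show "x \<in> K" using \<kappa> by simp
    qed
    obtain n where n: "card ?X = p ^ n" using X(2) by (elim exE)
    have "\<exists>k\<in>K. \<forall>x\<in>?X. \<exists>s\<in>normalizer G (\<chi> ` Q). \<forall>y\<in>Q. \<chi> (k (x y)) = gconj G s (\<chi> (k y))"
      by (rule \<chi>(3)[OF X(1) \<open>?X \<subseteq> K\<close> n])
    then obtain k where k: "k \<in> K" "\<And>x. x \<in> ?X \<Longrightarrow> \<exists>s\<in>normalizer G (\<chi> ` Q). \<forall>y\<in>Q. \<chi> (k (x y)) = gconj G s (\<chi> (k y))"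
      by (elim bexE) blast
    have kA: "k \<in> carrier (Aut Q)" using k(1) by (rule subgroup.mem_carrier[OF K])
    then have km: "mor k Q" "k ` Q = Q" by (auto simp: Aut_iff)
    let ?\<theta> = "\<chi> \<circ> (k \<circ> \<phi>)"
    have \<theta>: "mor ?\<theta> P" "?\<theta> ` P = \<chi> ` Q"
      by (intro mor_comp[OF _ \<chi>(1)] mor_comp[OF \<phi>(1) km(1)]) (simp_all only: image_comp[symmetric] km \<phi> order_refl)
    have TU: "T \<subseteq> extension_domain G P (\<chi> ` Q) ?\<theta>"
    proof
      fix t assume t: "t \<in> T"
      let ?x = "\<lambda>y\<in>Q. \<phi> (gconj G t (inv_into P \<phi> y))"
      obtain s where s: "s\<in>normalizer G (\<chi> ` Q)" "\<And>y. y \<in> Q \<Longrightarrow> \<chi> (k (?x y)) = gconj G s (\<chi> (k y))"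
        using k(2)[of ?x] t by blast
      have "?\<theta> (gconj G t y) = gconj G s (?\<theta> y)" if y: "y \<in> P" for y
        using s(2)[of "\<phi> y"] y \<phi>(2) mor_inv_apply[OF \<phi>(1) y] by auto
      then show "t \<in> extension_domain G P (\<chi> ` Q) ?\<theta>"
        unfolding mem_extension_domain[OF \<theta>] using s(1) t T(2) by blast
    qed
    obtain \<psi> where "mor \<psi> (extension_domain G P (\<chi> ` Q) ?\<theta>)" "\<And>x. x \<in> P \<Longrightarrow> \<psi> x = ?\<theta> x"
      using receptive_extension[OF \<chi>(2) \<theta>] by blast
    moreover have "extension_domain G P (\<chi> ` Q) ?\<theta> \<subseteq> normalizer G P"
      using mem_extension_domain[OF \<theta>] by blast
    ultimately have "mor \<psi> (extension_domain G P (\<chi> ` Q) ?\<theta>) \<and> P \<subseteq> extension_domain G P (\<chi> ` Q) ?\<theta> \<and>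
        T \<subseteq> extension_domain G P (\<chi> ` Q) ?\<theta> \<and> extension_domain G P (\<chi> ` Q) ?\<theta> \<subseteq> normalizer G P \<and>
        (\<forall>x\<in>P. \<psi> x = \<chi> (k (\<phi> x)))"
      using TU subset_extension_domain[OF \<theta>] by simp
    then show "\<exists>k\<in>K. \<exists>\<psi> U. mor \<psi> U \<and> P \<subseteq> U \<and> T \<subseteq> U \<and> U \<subseteq> normalizer G P \<and> (\<forall>x\<in>P. \<psi> x = \<chi> (k (\<phi> x)))"
      using k(1) by blast
    qed
  qed
qed

subsection \<open>Subgroups of automorphism groups\<close>

lemma Aut_transport:
  assumes \<phi>: "mor \<phi> P" "\<phi> ` P = Q" and t: "t \<in> normalizer G P"
  obtains \<kappa> where "\<kappa> \<in> carrier (Aut Q)" "\<And>y. y \<in> P \<Longrightarrow> \<phi> (gconj G t y) = \<kappa> (\<phi> y)"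
proof -
  have P: "subgroup P G" using mor_subgroup(1)[OF \<phi>(1)] .
  let ?\<kappa> = "\<lambda>y\<in>Q. \<phi> (gconj G t (inv_into P \<phi> y))"
  have "?\<kappa> \<in> carrier (Aut Q)"
    using subgroup.subset[OF transported_action_p_subgroup(1)[OF \<phi> subgroup_normalizer'[OF P] order_refl]] t by blast
  moreover have "\<phi> (gconj G t y) = ?\<kappa> (\<phi> y)" if "y \<in> P" for y
    using \<phi>(2) that mor_inv_apply[OF \<phi>(1) that] by auto
  ultimately show thesis by (rule that)
qed

lemma subgroup_stabilizer_Aut:
  assumes Q: "subgroup Q G" and X: "X \<subseteq> Q"
  shows "subgroup {\<kappa> \<in> carrier (Aut Q). \<kappa> ` X = X} (Aut Q)"
proof -
  interpret A: group "Aut Q" using group_Aut[OF Q] .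
  show ?thesis
  proof (rule A.subgroupI)
    have "\<one>\<^bsub>Aut Q\<^esub> ` X = X" using X by (auto simp: Aut_one image_def subset_iff)
    then show "{\<kappa> \<in> carrier (Aut Q). \<kappa> ` X = X} \<noteq> {}" using A.one_closed by blast
    fix a assume "a \<in> {\<kappa> \<in> carrier (Aut Q). \<kappa> ` X = X}"
    then have a: "a \<in> carrier (Aut Q)" "a ` X = X" by auto
    have "(inv\<^bsub>Aut Q\<^esub> a) ` a ` X = X" unfolding image_image
      using Aut_inv_apply(1)[OF Q a(1)] X by (auto simp: subset_iff image_def)
    then show "inv\<^bsub>Aut Q\<^esub> a \<in> {\<kappa> \<in> carrier (Aut Q). \<kappa> ` X = X}" using a by simp
    fix b assume "b \<in> {\<kappa> \<in> carrier (Aut Q). \<kappa> ` X = X}"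
    then have b: "b \<in> carrier (Aut Q)" "b ` X = X" by auto
    have "(a \<otimes>\<^bsub>Aut Q\<^esub> b) ` X = a ` b ` X" unfolding image_image
      using Aut_mult_apply[OF a(1) b(1)] X by (intro image_cong) auto
    then show "a \<otimes>\<^bsub>Aut Q\<^esub> b \<in> {\<kappa> \<in> carrier (Aut Q). \<kappa> ` X = X}" using a b by simp
  qed auto
qed

lemma subgroup_fixer_Aut:
  assumes Q: "subgroup Q G" and X: "X \<subseteq> Q"
  shows "subgroup {\<kappa> \<in> carrier (Aut Q). \<forall>x\<in>X. \<kappa> x = x} (Aut Q)"
proof -
  interpret A: group "Aut Q" using group_Aut[OF Q] .
  show ?thesis
  proof (rule A.subgroupI)
    have "\<forall>x\<in>X. \<one>\<^bsub>Aut Q\<^esub> x = x" using X by (auto simp: Aut_one)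
    then show "{\<kappa> \<in> carrier (Aut Q). \<forall>x\<in>X. \<kappa> x = x} \<noteq> {}" using A.one_closed by blast
    fix a assume "a \<in> {\<kappa> \<in> carrier (Aut Q). \<forall>x\<in>X. \<kappa> x = x}"
    then have a: "a \<in> carrier (Aut Q)" "\<And>x. x \<in> X \<Longrightarrow> a x = x" by auto
    have "(inv\<^bsub>Aut Q\<^esub> a) x = x" if "x \<in> X" for x
      using Aut_inv_apply(1)[OF Q a(1), of x] a(2)[OF that] that X by auto
    then show "inv\<^bsub>Aut Q\<^esub> a \<in> {\<kappa> \<in> carrier (Aut Q). \<forall>x\<in>X. \<kappa> x = x}" using a by simp
    fix b assume "b \<in> {\<kappa> \<in> carrier (Aut Q). \<forall>x\<in>X. \<kappa> x = x}"
    then have b: "b \<in> carrier (Aut Q)" "\<And>x. x \<in> X \<Longrightarrow> b x = x" by auto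
    have "(a \<otimes>\<^bsub>Aut Q\<^esub> b) x = x" if "x \<in> X" for x
      using Aut_mult_apply[OF a(1) b(1), of x] a(2)[OF that] b(2)[OF that] that X by auto
    then show "a \<otimes>\<^bsub>Aut Q\<^esub> b \<in> {\<kappa> \<in> carrier (Aut Q). \<forall>x\<in>X. \<kappa> x = x}" using a(1) b(1) by simp
  qed auto
qed

text \<open>
  The extension domain of an automorphism of P acts on an overgroup Q of P through this group.
\<close>

lemma subgroup_inner_on_Aut:
  assumes Q: "subgroup Q G" and P: "subgroup P G" "P \<subseteq> Q"
  shows "subgroup {\<kappa> \<in> carrier (Aut Q). \<exists>s\<in>normalizer G P. \<forall>y\<in>P. \<kappa> y = gconj G s y} (Aut Q)"
    (is "subgroup ?K _")
proof -
  interpret A: group "Aut Q" using group_Aut[OF Q] .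
  note NP = subgroup_normalizer'[OF P(1)]
  have Pc: "x \<in> carrier G" if "x \<in> P" for x using subgroup.mem_carrier[OF P(1) that] .
  have Nc: "x \<in> carrier G" if "x \<in> normalizer G P" for x using subgroup.mem_carrier[OF NP that] .
  show ?thesis
  proof (rule A.subgroupI)
    have "\<forall>y\<in>P. \<one>\<^bsub>Aut Q\<^esub> y = gconj G \<one> y" using P(2) gconj_one Pc by (auto simp: Aut_one)
    then have "\<one>\<^bsub>Aut Q\<^esub> \<in> ?K" using subgroup.one_closed[OF NP] A.one_closed by blast
    then show "?K \<noteq> {}" by blast
    fix a assume "a \<in> ?K"
    then obtain s where a: "a \<in> carrier (Aut Q)" "s \<in> normalizer G P" "\<And>y. y \<in> P \<Longrightarrow> a y = gconj G s y" by auto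
    have is': "inv s \<in> normalizer G P" using subgroup.m_inv_closed[OF NP a(2)] .
    have "(inv\<^bsub>Aut Q\<^esub> a) y = gconj G (inv s) y" if y: "y \<in> P" for y
    proof -
      have z: "gconj G (inv s) y \<in> P" using normalizer_memD[OF P(1) is' y] .
      have "a (gconj G (inv s) y) = y" using a(3)[OF z] gconj_inv(2)[OF Nc[OF a(2)] Pc[OF y]] by simp
      then show ?thesis using Aut_inv_apply(1)[OF Q a(1), of "gconj G (inv s) y"] z P(2) by auto
    qed
    then show "inv\<^bsub>Aut Q\<^esub> a \<in> ?K" using a(1) is' by blast
    fix b assume "b \<in> ?K"
    then obtain r where b: "b \<in> carrier (Aut Q)" "r \<in> normalizer G P" "\<And>y. y \<in> P \<Longrightarrow> b y = gconj G r y" by auto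
    have "(a \<otimes>\<^bsub>Aut Q\<^esub> b) y = gconj G (r \<otimes> s) y" if y: "y \<in> P" for y
    proof -
      have "(a \<otimes>\<^bsub>Aut Q\<^esub> b) y = a (b y)" using Aut_mult_apply[OF a(1) b(1)] P(2) y by blast
      also have "\<dots> = gconj G s (gconj G r y)" using b(3)[OF y] a(3) normalizer_memD[OF P(1) b(2) y] by simp
      finally show ?thesis using gconj_mult[OF Nc[OF b(2)] Nc[OF a(2)] Pc[OF y]] by simp
    qed
    then show "a \<otimes>\<^bsub>Aut Q\<^esub> b \<in> ?K" using A.m_closed[OF a(1) b(1)] subgroup.m_closed[OF NP b(2) a(2)] by blast
  qed auto
qed

section \<open>Subgroups with largest normalizer in their conjugacy class\<close>

text \<open>
  On a conjugacy class of subgroups this is a preorder, along which the normalizers embed into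
  each other. A subgroup with largest normalizer is maximal in it; the aim is that it is the
  greatest element.
\<close>

definition normalizer_le :: "'a set \<Rightarrow> 'a set \<Rightarrow> bool"
  where "normalizer_le X Y \<longleftrightarrow> subgroup X G \<and> (\<exists>\<psi>. mor \<psi> (normalizer G X) \<and> \<psi> ` X = Y)"

lemma mor_normalizer_image:
  assumes "subgroup X G" "mor \<psi> (normalizer G X)"
  shows "\<psi> ` normalizer G X \<subseteq> normalizer G (\<psi> ` X)"
  using mor_normalizer[OF assms(2,1) subset_normalizer[OF assms(1)] order_refl] .

lemma normalizer_le_refl: "subgroup X G \<Longrightarrow> normalizer_le X X"
  unfolding normalizer_le_def using mor_id[OF subgroup_normalizer'] by auto

lemma normalizer_le_subgroup:
  assumes "normalizer_le X Y"
  shows "subgroup X G" "subgroup Y G" "card Y = card X"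
proof -
  obtain \<psi> where \<psi>: "subgroup X G" "mor \<psi> (normalizer G X)" "\<psi> ` X = Y"
    using assms by (auto simp: normalizer_le_def)
  then have "mor \<psi> X" using mor_restrict[OF \<psi>(2,1) subset_normalizer[OF \<psi>(1)]] by simp
  then show "subgroup X G" "subgroup Y G" "card Y = card X" using \<psi> mor_subgroup(2) mor_card by auto
qed

lemma normalizer_le_trans:
  assumes "normalizer_le X Y" "normalizer_le Y Z"
  shows "normalizer_le X Z"
proof -
  obtain \<psi> where \<psi>: "subgroup X G" "mor \<psi> (normalizer G X)" "\<psi> ` X = Y"
    using assms by (auto simp: normalizer_le_def)
  obtain \<rho> where \<rho>: "mor \<rho> (normalizer G Y)" "\<rho> ` Y = Z"
    using assms by (auto simp: normalizer_le_def)
  have "mor (\<rho> \<circ> \<psi>) (normalizer G X)"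
    using mor_comp[OF \<psi>(2) \<rho>(1)] mor_normalizer_image[OF \<psi>(1,2)] \<psi>(3) by simp
  moreover have "(\<rho> \<circ> \<psi>) ` X = Z" using \<psi>(3) \<rho>(2) by (simp only: image_comp[symmetric])
  ultimately show ?thesis using \<psi>(1) by (auto simp: normalizer_le_def)
qed

lemma normalizer_image_eq:
  assumes X: "subgroup X G" "mor \<psi> (normalizer G X)"
    and card: "card (normalizer G (\<psi> ` X)) \<le> card (normalizer G X)"
  shows "\<psi> ` normalizer G X = normalizer G (\<psi> ` X)"
proof (rule card_seteq)
  have "subgroup (\<psi> ` X) G" using mor_image_subgroup[OF X(2,1) subset_normalizer[OF X(1)]] .
  then show "finite (normalizer G (\<psi> ` X))" using finite_subgroup[OF subgroup_normalizer'] by simp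
qed (use mor_normalizer_image[OF X] mor_card[OF X(2)] card in auto)

lemma normalizer_le_sym:
  assumes le: "normalizer_le X Y" and card: "card (normalizer G Y) \<le> card (normalizer G X)"
  shows "normalizer_le Y X"
proof -
  obtain \<psi> where \<psi>: "subgroup X G" "mor \<psi> (normalizer G X)" "\<psi> ` X = Y"
    using le by (auto simp: normalizer_le_def)
  have im: "\<psi> ` normalizer G X = normalizer G Y" using normalizer_image_eq[OF \<psi>(1,2)] \<psi>(3) card by simp
  have "mor (inv_into (normalizer G X) \<psi>) (normalizer G Y)" using mor_inv[OF \<psi>(2)] im by simp
  moreover have "inv_into (normalizer G X) \<psi> ` Y = X"
    using mor_inv_image[OF \<psi>(2) subset_normalizer[OF \<psi>(1)]] \<psi>(3) by simp
  ultimately show ?thesis using normalizer_le_subgroup(2)[OF le] by (auto simp: normalizer_le_def)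
qed

text \<open>
  The inverse of one morphism on N(X), followed by the other one, carries Y to Z and is defined on
  the image of N(X).
\<close>

lemma normalizer_le_valley:
  assumes "normalizer_le X Y" "normalizer_le X Z"
  obtains \<phi> V where "mor \<phi> V" "Y \<subseteq> V" "V \<subseteq> normalizer G Y" "card V = card (normalizer G X)" "\<phi> ` Y = Z"
proof -
  obtain \<alpha> where \<alpha>: "subgroup X G" "mor \<alpha> (normalizer G X)" "\<alpha> ` X = Y"
    using assms by (auto simp: normalizer_le_def)
  obtain \<beta> where \<beta>: "mor \<beta> (normalizer G X)" "\<beta> ` X = Z"
    using assms by (auto simp: normalizer_le_def)
  let ?V = "\<alpha> ` normalizer G X" and ?i = "inv_into (normalizer G X) \<alpha>"
  have i: "mor ?i ?V" "?i ` ?V = normalizer G X" "?i ` Y = X"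
    using mor_inv[OF \<alpha>(2)] mor_inv_image[OF \<alpha>(2) order_refl] mor_inv_image[OF \<alpha>(2) subset_normalizer[OF \<alpha>(1)]] \<alpha>(3)
    by simp_all
  show thesis
  proof (rule that[of "\<beta> \<circ> ?i" ?V])
    show "mor (\<beta> \<circ> ?i) ?V" using mor_comp[OF i(1) \<beta>(1)] i(2) by simp
    show "Y \<subseteq> ?V" using \<alpha>(3) subset_normalizer[OF \<alpha>(1)] by blast
    show "?V \<subseteq> normalizer G Y" using mor_normalizer_image[OF \<alpha>(1,2)] \<alpha>(3) by simp
    show "card ?V = card (normalizer G X)" using mor_card[OF \<alpha>(2)] .
    show "(\<beta> \<circ> ?i) ` Y = Z" using i(3) \<beta>(2) by (simp only: image_comp[symmetric])
  qed
qed

text \<open>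
  \<open>extension_modulo_automorphisms\<close> for the stabilizer of X in Aut(Q). An element of
  the stabilizer does not change the image of X, so all the extensions carry Y to the same
  subgroup.
\<close>

lemma stabilizer_transfer:
  assumes sat: "saturated_at Q" and Q: "subgroup Q G" and X: "X \<subseteq> Q"
  obtains \<chi> where "mor \<chi> Q"
    "\<And>\<phi> P Y. \<lbrakk>mor \<phi> P; \<phi> ` P = Q; subgroup Y G; Y \<subseteq> P; \<phi> ` Y = X\<rbrakk> \<Longrightarrow>
      \<exists>\<psi>. mor \<psi> (normalizer G P \<inter> normalizer G Y) \<and> \<psi> ` Y = \<chi> ` X"
proof -
  define K where "K = {\<kappa> \<in> carrier (Aut Q). \<kappa> ` X = X}"
  have K: "subgroup K (Aut Q)" using subgroup_stabilizer_Aut[OF Q X] by (simp add: K_def)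
  obtain \<chi> where \<chi>: "mor \<chi> Q" "extends_modulo K \<chi> Q"
    by (rule extension_modulo_automorphisms[OF sat Q K])
  show thesis
  proof (rule that[OF \<chi>(1)])
    fix \<phi> P Y assume \<phi>: "mor \<phi> P" "\<phi> ` P = Q" and Y: "subgroup Y G" "Y \<subseteq> P" "\<phi> ` Y = X"
    have P: "subgroup P G" using mor_subgroup(1)[OF \<phi>(1)] .
    let ?T = "normalizer G P \<inter> normalizer G Y"
    have T: "subgroup ?T G"
      using subgroups_Inter_pair[OF subgroup_normalizer'[OF P] subgroup_normalizer'[OF Y(1)]] .
    have comp: "\<exists>\<kappa>\<in>K. \<forall>y\<in>P. \<phi> (gconj G t y) = \<kappa> (\<phi> y)" if t: "t \<in> ?T" for t
    proof -
      obtain \<kappa> where \<kappa>: "\<kappa> \<in> carrier (Aut Q)" "\<And>y. y \<in> P \<Longrightarrow> \<phi> (gconj G t y) = \<kappa> (\<phi> y)"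
        using Aut_transport[OF \<phi>] t by blast
      have "\<kappa> ` X = \<phi> ` gconj G t ` Y" unfolding Y(3)[symmetric] image_image
        using \<kappa>(2) Y(2) by (intro image_cong) auto
      also have "\<dots> = X" using t mem_normalizer_iff[OF subgroup.subset[OF Y(1)]] Y(3) by auto
      finally show ?thesis unfolding K_def using \<kappa> by blast
    qed
    obtain k \<psi> U where k: "k \<in> K" "mor \<psi> U" "P \<subseteq> U" "?T \<subseteq> U" "U \<subseteq> normalizer G P" "\<forall>x\<in>P. \<psi> x = \<chi> (k (\<phi> x))"
      by (rule extends_moduloE[OF \<chi>(2) \<phi> T Int_lower1 comp])
    have "\<psi> ` Y = \<chi> ` k ` \<phi> ` Y" unfolding image_image using k(6) Y(2) by (intro image_cong) auto
    then have "\<psi> ` Y = \<chi> ` X" using k(1) Y(3) by (simp add: K_def)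
    then show "\<exists>\<psi>. mor \<psi> ?T \<and> \<psi> ` Y = \<chi> ` X" using mor_restrict[OF k(2) T k(4)] by blast
  qed
qed

text \<open>
  By downward induction on the order of Q. If Q or its image is the whole normalizer, one of the
  two subgroups lies below the other. Otherwise \<open>stabilizer_transfer\<close> provides a
  conjugate X' of X to which both X and its image are carried by morphisms on larger subgroups. By
  induction X and X' have an upper bound Z1, and X' and the image of X have an upper bound Z2. The
  subgroups Z1 and Z2 both lie above X', so a morphism on a copy of N(X') carries one to the
  other. As N(X') is larger than Q, they have an upper bound, too.
\<close>

lemma normalizer_le_upper_bound:
  assumes big: "\<And>Q. subgroup Q G \<Longrightarrow> m < card Q \<Longrightarrow> saturated_at Q"
  shows "mor \<phi> Q \<Longrightarrow> subgroup X G \<Longrightarrow> card X = m \<Longrightarrow> X \<subseteq> Q \<Longrightarrow> m < card Q \<Longrightarrow> Q \<subseteq> normalizer G X \<Longrightarrow>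
    \<exists>Z. normalizer_le X Z \<and> normalizer_le (\<phi> ` X) Z"
proof (induction "order G - card Q" arbitrary: X Q \<phi> rule: less_induct)
  case less
  note \<phi> = less.prems(1) and X = less.prems(2) and cX = less.prems(3) and XQ = less.prems(4) and cQ = less.prems(5) and QN = less.prems(6)
  have IH: "\<exists>Z. normalizer_le X' Z \<and> normalizer_le (\<phi>' ` X') Z"
    if "card Q < card Q'" "mor \<phi>' Q'" "subgroup X' G" "card X' = m" "X' \<subseteq> Q'" "Q' \<subseteq> normalizer G X'" for Q' \<phi>' X'
  proof -
    have "card Q' \<le> order G"
      unfolding order_def using card_mono[OF finite_carrier subgroup.subset[OF mor_subgroup(1)[OF that(2)]]] .
    then show ?thesis using less.hyps[OF _ that(2,3,4,5) _ that(6)] that(1) cQ by simp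
  qed
  have Q: "subgroup Q G" using mor_subgroup(1)[OF \<phi>] .
  let ?X = "\<phi> ` X" and ?Q = "\<phi> ` Q"
  have X': "subgroup ?X G" using mor_image_subgroup[OF \<phi> X XQ] .
  have Q': "subgroup ?Q G" using mor_subgroup(2)[OF \<phi>] .
  have cX': "card ?X = m" using mor_card[OF mor_restrict[OF \<phi> X XQ]] cX by simp
  have cQ': "card ?Q = card Q" using mor_card[OF \<phi>] .
  have XQ': "?X \<subseteq> ?Q" using XQ by blast
  have QN': "?Q \<subseteq> normalizer G ?X" using mor_normalizer[OF \<phi> X XQ QN] .
  let ?i = "inv_into Q \<phi>"
  have i: "mor ?i ?Q" "?i ` ?Q = Q" "?i ` ?X = X"
    using mor_inv[OF \<phi>] mor_inv_image[OF \<phi> order_refl] mor_inv_image[OF \<phi> XQ] by simp_all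
  show ?case
  proof (cases "Q = normalizer G X \<or> ?Q = normalizer G ?X")
    case True
    then have "normalizer_le X ?X \<or> normalizer_le ?X X"
      using \<phi> i(1,3) X X' unfolding normalizer_le_def by metis
    then show ?thesis using normalizer_le_refl[OF X] normalizer_le_refl[OF X'] by blast
  next
    case False
    then have QN2: "Q \<subset> normalizer G X" "?Q \<subset> normalizer G ?X" using QN QN' by auto
    obtain \<chi> where \<chi>: "mor \<chi> Q"
      "\<And>\<phi> P Y. \<lbrakk>mor \<phi> P; \<phi> ` P = Q; subgroup Y G; Y \<subseteq> P; \<phi> ` Y = X\<rbrakk> \<Longrightarrow>
        \<exists>\<psi>. mor \<psi> (normalizer G P \<inter> normalizer G Y) \<and> \<psi> ` Y = \<chi> ` X"
      using stabilizer_transfer[OF big[OF Q cQ] Q XQ] by blast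
    let ?X' = "\<chi> ` X"
    \<comment> \<open>One side of the picture; it is used for X with the identity on Q and for the image of
       X with the inverse of \<open>\<phi>\<close>.\<close>
    have step: "\<exists>Z. normalizer_le Y Z \<and> normalizer_le ?X' Z \<and> card Q < card (normalizer G ?X')"
      if P: "mor \<rho> P" "\<rho> ` P = Q" "P \<subset> normalizer G Y" "subgroup Y G" "Y \<subseteq> P" "\<rho> ` Y = X" "card Y = m" for P Y \<rho>
    proof -
      obtain \<psi> where \<psi>: "mor \<psi> (normalizer G P \<inter> normalizer G Y)" "\<psi> ` Y = ?X'"
        using \<chi>(2)[OF P(1,2,4,5,6)] by blast
      let ?T = "normalizer G P \<inter> normalizer G Y"
      have sP: "subgroup P G" using mor_subgroup(1)[OF P(1)] .
      obtain t where "t \<in> normalizer G Y - P" "t \<in> normalizer G P"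
        using proper_subgroup_normalizer[OF subgroup_normalizer'[OF P(4)] sP P(3)] by blast
      then have PT: "P \<subset> ?T" using P(3) subset_normalizer[OF sP] by blast
      have "card Q = card P" using mor_card[OF P(1)] P(2) by simp
      then have cT: "card Q < card ?T" using psubset_card_mono[OF mor_finite[OF \<psi>(1)] PT] by simp
      have "\<psi> ` ?T \<subseteq> normalizer G ?X'"
        using mor_normalizer[OF \<psi>(1) P(4)] PT P(5) \<psi>(2) by auto
      have "finite (normalizer G ?X')"
        using finite_subgroup[OF subgroup_normalizer'[OF mor_image_subgroup[OF \<chi>(1) X XQ]]] .
      then have "card ?T \<le> card (normalizer G ?X')"
        using card_mono[OF _ \<open>\<psi> ` ?T \<subseteq> normalizer G ?X'\<close>] mor_card[OF \<psi>(1)] by simp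
      moreover have "\<exists>Z. normalizer_le Y Z \<and> normalizer_le (\<psi> ` Y) Z"
        by (rule IH[OF cT \<psi>(1) P(4,7)]) (use PT P(5) in auto)
      ultimately show ?thesis using cT \<psi>(2) by auto
    qed
    obtain Z1 where Z1: "normalizer_le X Z1" "normalizer_le ?X' Z1" "card Q < card (normalizer G ?X')"
      using step[OF mor_id[OF Q] _ QN2(1) X XQ _ cX] by auto
    obtain Z2 where Z2: "normalizer_le ?X Z2" "normalizer_le ?X' Z2"
      using step[OF i(1,2) QN2(2) X' XQ' i(3) cX'] by auto
    obtain \<rho> V where V: "mor \<rho> V" "Z1 \<subseteq> V" "V \<subseteq> normalizer G Z1" "card V = card (normalizer G ?X')" "\<rho> ` Z1 = Z2"
      using normalizer_le_valley[OF Z1(2) Z2(2)] by blast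
    have "card Z1 = m" using normalizer_le_subgroup(3)[OF Z1(1)] cX by simp
    then obtain Z where Z: "normalizer_le Z1 Z" "normalizer_le Z2 Z"
      using IH[OF _ V(1) normalizer_le_subgroup(2)[OF Z1(1)] _ V(2,3)] V(4,5) Z1(3) by auto
    then show ?thesis using normalizer_le_trans Z1(1) Z2(1) by blast
  qed
qed

lemma subgroup_card_le: "subgroup Q G \<Longrightarrow> card Q \<le> order G"
  unfolding order_def using card_mono[OF finite_carrier subgroup.subset] .

lemma largest_normalizer_in_class:
  assumes P: "subgroup P G"
  obtains f where "mor f P" "\<forall>g. mor g P \<longrightarrow> card (normalizer G (g ` P)) \<le> card (normalizer G (f ` P))"
proof -
  have "card (normalizer G (g ` P)) < Suc (order G)" if "mor g P" for g
    using subgroup_card_le[OF subgroup_normalizer'[OF mor_subgroup(2)[OF that]]] by simp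
  then have "\<exists>f. mor f P \<and> (\<forall>g. mor g P \<longrightarrow> card (normalizer G (g ` P)) \<le> card (normalizer G (f ` P)))"
    by (intro Lattices_Big.ex_has_greatest_nat[of "\<lambda>f. mor f P", OF mor_id[OF P]] allI impI)
  then show thesis using that by (elim exE conjE)
qed

text \<open>
  On P, the map is a composite of restrictions of morphisms that are defined on members of D.
\<close>

inductive composite :: "'a set set \<Rightarrow> 'a set \<Rightarrow> ('a \<Rightarrow> 'a) \<Rightarrow> bool" for D
  where
    composite_id: "composite D P (\<lambda>x. x)"
  | composite_step: "\<lbrakk>E \<in> D; mor g E; P \<subseteq> E; composite D (g ` P) h\<rbrakk> \<Longrightarrow> composite D P (h \<circ> g)"

definition fusion_generated :: "'a set set \<Rightarrow> bool"
  where "fusion_generated D \<longleftrightarrow>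
    carrier G \<in> D \<and> (\<forall>E\<in>D. subgroup E G) \<and> (\<forall>E\<in>D. \<forall>f. mor f E \<longrightarrow> f ` E \<in> D) \<and>
    (\<forall>f P. mor f P \<longrightarrow> (\<exists>h. composite D P h \<and> (\<forall>x\<in>P. h x = f x)))"

lemma outside_image:
  assumes D: "fusion_generated D" and X: "subgroup X G" "X \<notin> D" and g: "mor g X"
  shows "g ` X \<notin> D"
proof
  assume "g ` X \<in> D"
  moreover have "mor (inv_into X g) (g ` X)" using mor_inv[OF g] .
  ultimately have "inv_into X g ` g ` X \<in> D" using D by (auto simp: fusion_generated_def)
  then show False using mor_inv_image[OF g order_refl] X(2) by simp
qed

text \<open>
  Since X is not a member of D, it is properly contained in E, and normalizers grow.
\<close>

lemma outside_proper_normalizer: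
  assumes D: "fusion_generated D" and X: "subgroup X G" "X \<notin> D" and E: "E \<in> D" "X \<subseteq> E"
  shows "card X < card (E \<inter> normalizer G X)" "subgroup (E \<inter> normalizer G X) G" "X \<subseteq> E \<inter> normalizer G X"
proof -
  have sE: "subgroup E G" using D E by (auto simp: fusion_generated_def)
  show s: "subgroup (E \<inter> normalizer G X) G"
    using subgroups_Inter_pair[OF sE subgroup_normalizer'[OF X(1)]] .
  have "X \<subset> E" using E X(2) by auto
  then obtain t where "t \<in> E - X" "t \<in> normalizer G X"
    using proper_subgroup_normalizer[OF sE X(1)] by blast
  then have "X \<subset> E \<inter> normalizer G X" using E(2) subset_normalizer[OF X(1)] by blast
  then show "card X < card (E \<inter> normalizer G X)" "X \<subseteq> E \<inter> normalizer G X"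
    using psubset_card_mono[OF finite_subgroup[OF s]] by auto
qed

text \<open>
  A morphism on P is a composite, each factor of which is defined on a larger subgroup, so
  consecutive conjugates have a common upper bound. If the first of them lies below P, then P and
  this bound have an upper bound W. As the normalizer of P is largest, W lies below P as well, and
  so does the second one.
\<close>

lemma fully_normalized_is_top:
  assumes big: "\<And>Q. subgroup Q G \<Longrightarrow> card P < card Q \<Longrightarrow> saturated_at Q"
    and D: "fusion_generated D" and P: "subgroup P G" "P \<notin> D" and fn: "fully_normalized G F P"
    and f: "mor f P"
  shows "normalizer_le (f ` P) P"
proof -
  have max: "card (normalizer G (f ` P)) \<le> card (normalizer G P)" if "mor f P" for f
    using fn that conjugates_iff unfolding fully_normalized_def by blast
  have "composite D X h \<Longrightarrow> X \<notin> D \<Longrightarrow> normalizer_le X P \<Longrightarrow> normalizer_le (h ` X) P" for X h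
  proof (induction rule: composite.induct)
    case (composite_step E g X h)
    have X: "subgroup X G" "card X = card P" using normalizer_le_subgroup[OF composite_step.prems(2)] by auto
    note EX = outside_proper_normalizer[OF D X(1) composite_step.prems(1) composite_step.hyps(1,3)]
    have gX: "mor g X" using mor_restrict[OF composite_step.hyps(2) X(1) composite_step.hyps(3)] .
    have gE: "mor g (E \<inter> normalizer G X)" using mor_restrict[OF composite_step.hyps(2) EX(2)] by simp
    obtain Z where Z: "normalizer_le X Z" "normalizer_le (g ` X) Z"
      using normalizer_le_upper_bound[OF big gE X EX(3)] EX(1) X(2) by auto
    obtain \<rho> V where V: "mor \<rho> V" "P \<subseteq> V" "V \<subseteq> normalizer G P" "card V = card (normalizer G X)" "\<rho> ` P = Z"
      using normalizer_le_valley[OF composite_step.prems(2) Z(1)] by blast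
    have "card (E \<inter> normalizer G X) \<le> card (normalizer G X)"
      using card_mono[OF finite_subgroup[OF subgroup_normalizer'[OF X(1)]]] by simp
    then have "card P < card V" using EX(1) V(4) X(2) by simp
    then obtain W where W: "normalizer_le P W" "normalizer_le Z W"
      using normalizer_le_upper_bound[OF big V(1) P(1) refl V(2) _ V(3)] V(5) by auto
    obtain \<omega> where \<omega>: "mor \<omega> (normalizer G P)" "\<omega> ` P = W" using W(1) by (auto simp: normalizer_le_def)
    have "card (normalizer G W) \<le> card (normalizer G P)"
      using max[OF mor_restrict[OF \<omega>(1) P(1) subset_normalizer[OF P(1)]]] \<omega>(2) by simp
    then have "normalizer_le W P" using normalizer_le_sym[OF W(1)] by simp
    then have "normalizer_le (g ` X) P" using normalizer_le_trans[OF Z(2)] normalizer_le_trans[OF W(2)] by blast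
    then have "normalizer_le (h ` g ` X) P"
      using composite_step.IH outside_image[OF D X(1) composite_step.prems(1) gX] by blast
    then show ?case by (simp add: image_comp)
  qed simp
  moreover obtain h where h: "composite D P h" "\<And>x. x \<in> P \<Longrightarrow> h x = f x"
    using D f unfolding fusion_generated_def by blast
  ultimately have "normalizer_le (h ` P) P" using P normalizer_le_refl by blast
  moreover have "h ` P = f ` P" using h(2) by (intro image_cong) auto
  ultimately show ?thesis by simp
qed

end

section \<open>Non-centric subgroups\<close>

context group
begin

text \<open>
  The product Q C(P), described by its action on P. In this form it is visibly preserved by the
  morphisms that map P and Q to themselves.
\<close>

definition centralizer_product :: "'a set \<Rightarrow> 'a set \<Rightarrow> 'a set"
  where "centralizer_product P Q = {t \<in> carrier G. \<exists>q\<in>Q. \<forall>x\<in>P. gconj G t x = gconj G q x}"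

lemma subset_centralizer_product: "subgroup Q G \<Longrightarrow> Q \<subseteq> centralizer_product P Q"
  using subgroup.subset by (fastforce simp: centralizer_product_def)

lemma centralizer_product_factor:
  assumes P: "subgroup P G" and Q: "subgroup Q G" and t: "t \<in> centralizer_product P Q"
  obtains q c where "q \<in> Q" "c \<in> centralizer G P" "t = c \<otimes> q"
proof -
  obtain q where q: "t \<in> carrier G" "q \<in> Q" "\<And>x. x \<in> P \<Longrightarrow> gconj G t x = gconj G q x"
    using t by (auto simp: centralizer_product_def)
  have qc: "q \<in> carrier G" using subgroup.mem_carrier[OF Q q(2)] .
  have "gconj G (t \<otimes> inv q) x = x" if x: "x \<in> P" for x
    using q(1) qc gconj_mult[of t "inv q" x] q(3)[OF x] gconj_inv(1)[OF qc, of x] subgroup.mem_carrier[OF P x] by simp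
  then have "t \<otimes> inv q \<in> centralizer G P"
    using centralizer_iff[OF subgroup.subset[OF P]] q(1) qc by simp
  moreover have "t = t \<otimes> inv q \<otimes> q" using q(1) qc by (simp add: m_assoc)
  ultimately show thesis using that q(2) by blast
qed

lemma subgroup_centralizer_product:
  assumes P: "subgroup P G" and Q: "subgroup Q G" and QN: "Q \<subseteq> normalizer G P"
  shows "subgroup (centralizer_product P Q) G"
proof (rule subgroupI)
  have Pc: "x \<in> carrier G" if "x \<in> P" for x using subgroup.mem_carrier[OF P that] .
  have Qc: "x \<in> carrier G" if "x \<in> Q" for x using subgroup.mem_carrier[OF Q that] .
  show "centralizer_product P Q \<subseteq> carrier G" by (auto simp: centralizer_product_def)
  show "centralizer_product P Q \<noteq> {}" using subset_centralizer_product[OF Q] subgroup.one_closed[OF Q] by blast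
  fix a assume "a \<in> centralizer_product P Q"
  then obtain q where q: "a \<in> carrier G" "q \<in> Q" "\<And>x. x \<in> P \<Longrightarrow> gconj G a x = gconj G q x"
    by (auto simp: centralizer_product_def)
  have iq: "inv q \<in> Q" using subgroup.m_inv_closed[OF Q q(2)] .
  have "gconj G (inv a) x = gconj G (inv q) x" if x: "x \<in> P" for x
  proof -
    have y: "gconj G (inv q) x \<in> P" using normalizer_memD[OF P _ x] iq QN by blast
    have "gconj G a (gconj G (inv q) x) = x" using q(3)[OF y] gconj_inv(2)[OF Qc[OF q(2)] Pc[OF x]] by simp
    then show ?thesis using gconj_inv(1)[OF q(1) Pc[OF y]] by simp
  qed
  then show "inv a \<in> centralizer_product P Q" using q(1) iq by (auto simp: centralizer_product_def)
  fix b assume "b \<in> centralizer_product P Q"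
  then obtain r where r: "b \<in> carrier G" "r \<in> Q" "\<And>x. x \<in> P \<Longrightarrow> gconj G b x = gconj G r x"
    by (auto simp: centralizer_product_def)
  have "gconj G (a \<otimes> b) x = gconj G (q \<otimes> r) x" if x: "x \<in> P" for x
  proof -
    have y: "gconj G q x \<in> P" using normalizer_memD[OF P _ x] q(2) QN by blast
    show ?thesis
      using gconj_mult[OF q(1) r(1) Pc[OF x]] gconj_mult[OF Qc[OF q(2)] Qc[OF r(2)] Pc[OF x]] q(3)[OF x] r(3)[OF y] by simp
  qed
  then show "a \<otimes> b \<in> centralizer_product P Q"
    using q(1) r(1) subgroup.m_closed[OF Q q(2) r(2)] by (auto simp: centralizer_product_def)
qed

end

context p_fusion_system
begin

lemma centralizer_subset_product:
  assumes P: "subgroup P G" and Q: "subgroup Q G"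
  shows "centralizer G P \<subseteq> centralizer_product P Q"
proof
  fix c assume c: "c \<in> centralizer G P"
  then have "c \<in> carrier G" "\<forall>x\<in>P. gconj G c x = gconj G \<one> x"
    using centralizer_iff[OF subgroup.subset[OF P]] gconj_one subgroup.mem_carrier[OF P] by auto
  then show "c \<in> centralizer_product P Q"
    using subgroup.one_closed[OF Q] by (auto simp: centralizer_product_def)
qed

lemma centralizer_product_normalizes:
  assumes P: "subgroup P G" and Q: "subgroup Q G" "Q \<subseteq> normalizer G P"
  shows "centralizer_product P Q \<subseteq> normalizer G P"
proof
  fix t assume "t \<in> centralizer_product P Q"
  then obtain q where q: "t \<in> carrier G" "q \<in> Q" "\<And>x. x \<in> P \<Longrightarrow> gconj G t x = gconj G q x"
    by (auto simp: centralizer_product_def)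
  show "t \<in> normalizer G P"
  proof (rule normalizer_memI[OF P finite_subgroup[OF P] q(1)])
    fix x assume x: "x \<in> P"
    have "q \<in> normalizer G P" using q(2) Q(2) by blast
    then show "gconj G t x \<in> P" using q(3)[OF x] normalizer_memD[OF P _ x] by simp
  qed
qed

lemma mor_centralizer_product:
  assumes \<rho>: "mor \<rho> (centralizer_product P P)" and P: "subgroup P G" and im: "\<rho> ` P = P"
  shows "\<rho> ` centralizer_product P P = centralizer_product P P"
proof -
  let ?R = "centralizer_product P P"
  have PR: "P \<subseteq> ?R" using subset_centralizer_product[OF P] .
  have "\<rho> t \<in> ?R" if t: "t \<in> ?R" for t
  proof -
    obtain q where q: "t \<in> carrier G" "q \<in> P" "\<And>x. x \<in> P \<Longrightarrow> gconj G t x = gconj G q x"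
      using t by (auto simp: centralizer_product_def)
    have "gconj G (\<rho> t) x = gconj G (\<rho> q) x" if x: "x \<in> P" for x
    proof -
      obtain y where y: "y \<in> P" "x = \<rho> y" using x im by blast
      have "\<rho> (gconj G t y) = gconj G (\<rho> t) (\<rho> y)" using mor_conj[OF \<rho> t, of y] y PR by blast
      moreover have "\<rho> (gconj G q y) = gconj G (\<rho> q) (\<rho> y)" using mor_conj[OF \<rho>, of q y] q(2) y PR by blast
      ultimately show ?thesis using q(3)[OF y(1)] y(2) by simp
    qed
    moreover have "\<rho> q \<in> P" using q(2) im by blast
    moreover have "\<rho> t \<in> carrier G" using subgroup.mem_carrier[OF mor_subgroup(2)[OF \<rho>]] t by blast
    ultimately show ?thesis unfolding centralizer_product_def by blast
  qed
  then have "\<rho> ` ?R \<subseteq> ?R" by blast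
  then show ?thesis using endo_inj_surj[OF mor_finite[OF \<rho>] _ mor_inj[OF \<rho>]] by simp
qed

text \<open>
  \<open>extension_modulo_automorphisms\<close> for the pointwise fixer of P in Aut(Q), whose
  elements do not change the restriction of a morphism to P. The group that acts is the set of all
  elements of C(P) that normalize Q'; some of them lie outside Q', since normalizers grow in the
  p-group Q' C(P).
\<close>

lemma fixer_transfer:
  assumes sat: "saturated_at Q" and Q: "subgroup Q G" and P: "subgroup P G" "P \<subseteq> Q"
  obtains \<chi> where "mor \<chi> Q"
    "\<And>\<phi> Q'. \<lbrakk>mor \<phi> Q'; \<phi> ` Q' = Q; P \<subseteq> Q'; \<phi> ` P = P; Q' \<subseteq> normalizer G P; \<not> centralizer G P \<subseteq> Q'\<rbrakk> \<Longrightarrow>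
      \<exists>\<psi> V. mor \<psi> V \<and> P \<subseteq> V \<and> V \<subseteq> normalizer G P \<and> card Q < card V \<and> (\<forall>x\<in>P. \<psi> x = \<chi> (\<phi> x))"
proof -
  define K where "K = {\<kappa> \<in> carrier (Aut Q). \<forall>x\<in>P. \<kappa> x = x}"
  have K: "subgroup K (Aut Q)" using subgroup_fixer_Aut[OF Q P(2)] by (simp add: K_def)
  obtain \<chi> where \<chi>: "mor \<chi> Q" "extends_modulo K \<chi> Q"
    by (rule extension_modulo_automorphisms[OF sat Q K])
  show thesis
  proof (rule that[OF \<chi>(1)])
    fix \<phi> Q'
    assume \<phi>: "mor \<phi> Q'" "\<phi> ` Q' = Q" and P': "P \<subseteq> Q'" "\<phi> ` P = P" "Q' \<subseteq> normalizer G P"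
      and nc: "\<not> centralizer G P \<subseteq> Q'"
    have Q': "subgroup Q' G" using mor_subgroup(1)[OF \<phi>(1)] .
    let ?T = "normalizer G Q' \<inter> centralizer G P"
    have T: "subgroup ?T G"
      using subgroups_Inter_pair[OF subgroup_normalizer'[OF Q'] subgroup_centralizer[OF subgroup.subset[OF P(1)]]] .
    have comp: "\<exists>\<kappa>\<in>K. \<forall>y\<in>Q'. \<phi> (gconj G t y) = \<kappa> (\<phi> y)" if t: "t \<in> ?T" for t
    proof -
      have "t \<in> normalizer G Q'" using t by blast
      then obtain \<kappa> where \<kappa>: "\<kappa> \<in> carrier (Aut Q)" "\<And>y. y \<in> Q' \<Longrightarrow> \<phi> (gconj G t y) = \<kappa> (\<phi> y)"
        using Aut_transport[OF \<phi>] by blast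
      have "\<kappa> x = x" if x: "x \<in> P" for x
      proof -
        obtain y where y: "y \<in> P" "x = \<phi> y" using x P'(2) by blast
        have "gconj G t y = y" using t y(1) centralizer_iff[OF subgroup.subset[OF P(1)]] by blast
        then show ?thesis using \<kappa>(2)[of y] y P'(1) by auto
      qed
      then show ?thesis unfolding K_def using \<kappa> by blast
    qed
    obtain k \<psi> U where k: "k \<in> K" "mor \<psi> U" "Q' \<subseteq> U" "?T \<subseteq> U" "U \<subseteq> normalizer G Q'" "\<forall>x\<in>Q'. \<psi> x = \<chi> (k (\<phi> x))"
      by (rule extends_moduloE[OF \<chi>(2) \<phi> T Int_lower1 comp])
    let ?V = "U \<inter> normalizer G P"
    have V: "subgroup ?V G"
      using subgroups_Inter_pair[OF mor_subgroup(1)[OF k(2)] subgroup_normalizer'[OF P(1)]] .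
    have "Q' \<noteq> centralizer_product P Q'" using nc centralizer_subset_product[OF P(1) Q'] by blast
    then have "Q' \<subset> centralizer_product P Q'" using subset_centralizer_product[OF Q', of P] by blast
    then obtain t where t: "t \<in> centralizer_product P Q' - Q'" "t \<in> normalizer G Q'"
      using proper_subgroup_normalizer[OF subgroup_centralizer_product[OF P(1) Q' P'(3)] Q'] by blast
    then obtain q c where qc: "q \<in> Q'" "c \<in> centralizer G P" "t = c \<otimes> q"
      using centralizer_product_factor[OF P(1) Q', of t] by blast
    have cc: "c \<in> carrier G" "q \<in> carrier G"
      using qc(1) subgroup.mem_carrier[OF Q'] qc(2) by (auto simp: centralizer_def)
    have "c = t \<otimes> inv q" using qc(3) cc by (simp add: m_assoc)
    moreover have "inv q \<in> normalizer G Q'"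
      using subset_normalizer[OF Q'] subgroup.m_inv_closed[OF Q' qc(1)] by blast
    ultimately have "c \<in> normalizer G Q'" using subgroup.m_closed[OF subgroup_normalizer'[OF Q'] t(2)] by simp
    then have "c \<in> ?V" using qc(2) k(4) centralizer_subset_product[OF P(1) Q'] centralizer_product_normalizes[OF P(1) Q' P'(3)] by blast
    moreover have "c \<notin> Q'" using t(1) qc subgroup.m_closed[OF Q'] by blast
    ultimately have "Q' \<subset> ?V" using k(3) P'(3) by blast
    then have "card Q' < card ?V" using psubset_card_mono[OF finite_subgroup[OF V]] by simp
    then have "card Q < card ?V" using mor_card[OF \<phi>(1)] \<phi>(2) by simp
    moreover have "\<psi> x = \<chi> (\<phi> x)" if "x \<in> P" for x
    proof -
      have "x \<in> Q'" "\<phi> x \<in> P" using that P'(1,2) by blast+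
      then show ?thesis using k(1,6) by (simp add: K_def)
    qed
    moreover have "mor \<psi> ?V" using mor_restrict[OF k(2) V] by simp
    moreover have "P \<subseteq> ?V" using P'(1) k(3) subset_normalizer[OF P(1)] by blast
    ultimately show "\<exists>\<psi> V. mor \<psi> V \<and> P \<subseteq> V \<and> V \<subseteq> normalizer G P \<and> card Q < card V \<and> (\<forall>x\<in>P. \<psi> x = \<chi> (\<phi> x))"
      by (intro exI[of _ \<psi>] exI[of _ ?V]) simp
  qed
qed

text \<open>
  By downward induction on the order of Q. If C(P) is not contained in Q, then
  \<open>fixer_transfer\<close> writes the restriction of \<open>\<beta>\<close> to P as a
  quotient of two isomorphisms from P to a conjugate, both of which are defined on larger
  subgroups. A morphism \<open>\<mu>\<close> on the normalizer of the conjugate carries it back to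
  P, so the two become automorphisms of P that are covered by the induction hypothesis.
\<close>

lemma extends_to_centralizer_product:
  assumes big: "\<And>Q. subgroup Q G \<Longrightarrow> card P < card Q \<Longrightarrow> saturated_at Q"
    and P: "subgroup P G" and top: "\<And>f. mor f P \<Longrightarrow> normalizer_le (f ` P) P"
  shows "mor \<beta> Q \<Longrightarrow> P \<subseteq> Q \<Longrightarrow> card P < card Q \<Longrightarrow> Q \<subseteq> normalizer G P \<Longrightarrow> \<beta> ` P = P \<Longrightarrow>
    \<exists>\<rho>. mor \<rho> (centralizer_product P P) \<and> (\<forall>x\<in>P. \<rho> x = \<beta> x)"
proof (induction "order G - card Q" arbitrary: Q \<beta> rule: less_induct)
  case less
  note \<beta> = less.prems(1,5) and PQ = less.prems(2) and cQ = less.prems(3) and QN = less.prems(4)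
  let ?R = "centralizer_product P P"
  have R: "subgroup ?R G" using subgroup_centralizer_product[OF P P subset_normalizer[OF P]] .
  have PR: "P \<subseteq> ?R" using subset_centralizer_product[OF P] .
  have IH: "\<exists>\<rho>. mor \<rho> ?R \<and> (\<forall>x\<in>P. \<rho> x = \<beta>' x)"
    if "card Q < card Q'" "mor \<beta>' Q'" "P \<subseteq> Q'" "Q' \<subseteq> normalizer G P" "\<beta>' ` P = P" for Q' \<beta>'
  proof -
    have "card Q' \<le> order G"
      unfolding order_def using card_mono[OF finite_carrier subgroup.subset[OF mor_subgroup(1)[OF that(2)]]] .
    then show ?thesis using less.hyps[OF _ that(2,3) _ that(4,5)] that(1) cQ by simp
  qed
  have Q: "subgroup Q G" using mor_subgroup(1)[OF \<beta>(1)] .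
  let ?C = "centralizer G P"
  show ?case
  proof (cases "?C \<subseteq> Q")
    case True
    have "?R \<subseteq> Q"
    proof
      fix t assume "t \<in> ?R"
      then obtain q c where qc: "q \<in> P" "c \<in> ?C" "t = c \<otimes> q" by (rule centralizer_product_factor[OF P P])
      then have "q \<in> Q" "c \<in> Q" using True PQ by blast+
      then show "t \<in> Q" using subgroup.m_closed[OF Q] qc(3) by simp
    qed
    then show ?thesis using mor_restrict[OF \<beta>(1) R] by blast
  next
    case False
    let ?i = "inv_into Q \<beta>" and ?Q = "\<beta> ` Q"
    have i: "mor ?i ?Q" "?i ` ?Q = Q" "?i ` P = P"
      using mor_inv[OF \<beta>(1)] mor_inv_image[OF \<beta>(1) order_refl] mor_inv_image[OF \<beta>(1) PQ] \<beta>(2) by simp_all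
    have PQ': "P \<subseteq> ?Q" using PQ \<beta>(2) by blast
    have QN': "?Q \<subseteq> normalizer G P" using mor_normalizer[OF \<beta>(1) P PQ QN] \<beta>(2) by simp
    \<comment> \<open>If C(P) were contained in the image of Q, then the inverse of \<open>\<beta>\<close>
       would map C(P) into itself, hence onto itself, and C(P) would be contained in Q.\<close>
    have nC: "\<not> ?C \<subseteq> ?Q"
    proof
      assume CQ: "?C \<subseteq> ?Q"
      have C: "subgroup ?C G" using subgroup_centralizer[OF subgroup.subset[OF P]] .
      have "?i c \<in> ?C" if c: "c \<in> ?C" for c
      proof -
        have "gconj G (?i c) x = x" if x: "x \<in> P" for x
        proof -
          obtain y where y: "y \<in> P" "x = ?i y" using x i(3) by blast
          have "?i (gconj G c y) = gconj G (?i c) (?i y)" using mor_conj[OF i(1), of c y] c CQ y(1) PQ' by blast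
          moreover have "gconj G c y = y" using c y(1) centralizer_iff[OF subgroup.subset[OF P]] by blast
          ultimately show ?thesis using y(2) by simp
        qed
        moreover have "?i c \<in> carrier G" using subgroup.mem_carrier[OF mor_subgroup(2)[OF i(1)]] c CQ by blast
        ultimately show ?thesis using centralizer_iff[OF subgroup.subset[OF P]] by blast
      qed
      then have "?i ` ?C \<subseteq> ?C" by blast
      moreover have "inj_on ?i ?C" using mor_inj[OF i(1)] CQ inj_on_subset by blast
      ultimately have "?i ` ?C = ?C" using endo_inj_surj[OF finite_subgroup[OF C]] by simp
      then show False using False CQ i(2) by blast
    qed
    obtain \<chi> where \<chi>: "mor \<chi> Q"
      "\<And>\<phi> Q'. \<lbrakk>mor \<phi> Q'; \<phi> ` Q' = Q; P \<subseteq> Q'; \<phi> ` P = P; Q' \<subseteq> normalizer G P; \<not> ?C \<subseteq> Q'\<rbrakk> \<Longrightarrow>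
        \<exists>\<psi> V. mor \<psi> V \<and> P \<subseteq> V \<and> V \<subseteq> normalizer G P \<and> card Q < card V \<and> (\<forall>x\<in>P. \<psi> x = \<chi> (\<phi> x))"
      using fixer_transfer[OF big[OF Q cQ] Q P PQ] by blast
    have "mor \<chi> P" using mor_restrict[OF \<chi>(1) P PQ] .
    then obtain \<mu> where \<mu>: "mor \<mu> (normalizer G (\<chi> ` P))" "\<mu> ` \<chi> ` P = P"
      using top[of \<chi>] by (auto simp: normalizer_le_def)
    have step: "\<exists>\<rho>. mor \<rho> ?R \<and> (\<forall>x\<in>P. \<rho> x = \<mu> (\<chi> (\<phi> x)))"
      if Q': "mor \<phi> Q'" "\<phi> ` Q' = Q" "P \<subseteq> Q'" "\<phi> ` P = P" "Q' \<subseteq> normalizer G P" "\<not> ?C \<subseteq> Q'" for \<phi> Q'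
    proof -
      obtain \<psi> V where V: "mor \<psi> V" "P \<subseteq> V" "V \<subseteq> normalizer G P" "card Q < card V" "\<And>x. x \<in> P \<Longrightarrow> \<psi> x = \<chi> (\<phi> x)"
        using \<chi>(2)[OF Q'] by blast
      have im: "\<psi> ` P = \<chi> ` P"
      proof -
        have "\<psi> ` P = \<chi> ` \<phi> ` P" unfolding image_image using V(5) by (rule image_cong[OF refl])
        then show ?thesis using Q'(4) by simp
      qed
      have "\<psi> ` V \<subseteq> normalizer G (\<chi> ` P)" using mor_normalizer[OF V(1) P V(2,3)] im by simp
      then have m: "mor (\<mu> \<circ> \<psi>) V" using mor_comp[OF V(1) \<mu>(1)] by simp
      have "(\<mu> \<circ> \<psi>) ` P = P" by (simp only: image_comp[symmetric] im \<mu>(2))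
      then obtain \<rho> where \<rho>: "mor \<rho> ?R" "\<And>x. x \<in> P \<Longrightarrow> \<rho> x = (\<mu> \<circ> \<psi>) x"
        using IH[OF V(4) m V(2,3)] by blast
      then show ?thesis using V(5) by auto
    qed
    obtain \<rho>1 where \<rho>1: "mor \<rho>1 ?R" "\<And>x. x \<in> P \<Longrightarrow> \<rho>1 x = \<mu> (\<chi> x)"
      using step[OF mor_id[OF Q] _ PQ _ QN False] by auto
    obtain \<rho>2 where \<rho>2: "mor \<rho>2 ?R" "\<And>x. x \<in> P \<Longrightarrow> \<rho>2 x = \<mu> (\<chi> (?i x))"
      using step[OF i(1,2) PQ' i(3) QN' nC] by blast
    have im1: "\<rho>1 ` P = P"
    proof -
      have "\<rho>1 ` P = \<mu> ` \<chi> ` P" unfolding image_image using \<rho>1(2) by (rule image_cong[OF refl])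
      then show ?thesis using \<mu>(2) by simp
    qed
    have im2: "\<rho>2 ` P = P"
    proof -
      have "\<rho>2 ` P = \<mu> ` \<chi> ` ?i ` P" unfolding image_image using \<rho>2(2) by (rule image_cong[OF refl])
      then show ?thesis using \<mu>(2) i(3) by simp
    qed
    have R1: "\<rho>1 ` ?R = ?R" and R2: "\<rho>2 ` ?R = ?R"
      using mor_centralizer_product[OF _ P] \<rho>1(1) \<rho>2(1) im1 im2 by blast+
    have "mor (inv_into ?R \<rho>2) ?R" using mor_inv[OF \<rho>2(1)] R2 by simp
    then have "mor (inv_into ?R \<rho>2 \<circ> \<rho>1) ?R" using mor_comp[OF \<rho>1(1)] R1 by simp
    moreover have "(inv_into ?R \<rho>2 \<circ> \<rho>1) x = \<beta> x" if x: "x \<in> P" for x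
    proof -
      have \<beta>x: "\<beta> x \<in> P" using x \<beta>(2) by blast
      have "?i (\<beta> x) = x" using mor_inv_apply[OF \<beta>(1)] x PQ by blast
      then have "\<rho>2 (\<beta> x) = \<rho>1 x" using \<rho>1(2)[OF x] \<rho>2(2)[OF \<beta>x] by simp
      then show ?thesis using mor_inv_apply[OF \<rho>2(1), of "\<beta> x"] \<beta>x PR by auto
    qed
    ultimately show ?thesis by blast
  qed
qed

text \<open>
  The given automorphism is a composite, and the intermediate conjugates X of P are carried to P
  by morphisms \<open>\<chi>\<close> on their normalizers. Conjugated with these, every factor
  becomes an automorphism of P that is defined on a subgroup larger than P, to which
  \<open>extends_to_centralizer_product\<close> applies.
\<close>

lemma automorphisms_extend_to_centralizer_product:
  assumes big: "\<And>Q. subgroup Q G \<Longrightarrow> card P < card Q \<Longrightarrow> saturated_at Q"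
    and D: "fusion_generated D" and P: "subgroup P G" "P \<notin> D"
    and top: "\<And>f. mor f P \<Longrightarrow> normalizer_le (f ` P) P"
    and \<alpha>: "mor \<alpha> P" "\<alpha> ` P = P"
  shows "\<exists>\<rho>. mor \<rho> (centralizer_product P P) \<and> (\<forall>x\<in>P. \<rho> x = \<alpha> x)"
proof -
  let ?R = "centralizer_product P P"
  have edge: "\<exists>\<rho>. mor \<rho> ?R \<and> \<rho> ` P = P \<and> (\<forall>x\<in>X. \<rho> (\<chi> x) = \<chi>' (g x))"
    if X: "subgroup X G" "card X = card P" "X \<subseteq> V" "V \<subseteq> normalizer G X" "card P < card V" "mor g V"
      and \<chi>: "mor \<chi> (normalizer G X)" "\<chi> ` X = P"
      and \<chi>': "mor \<chi>' (normalizer G (g ` X))" "\<chi>' ` g ` X = P" for X V g \<chi> \<chi>'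
  proof -
    have V: "subgroup V G" using mor_subgroup(1)[OF X(6)] .
    have \<chi>V: "mor \<chi> V" using mor_restrict[OF \<chi>(1) V X(4)] .
    let ?i = "inv_into V \<chi>" and ?V = "\<chi> ` V"
    have i: "mor ?i ?V" "?i ` ?V = V" "?i ` P = X"
      using mor_inv[OF \<chi>V] mor_inv_image[OF \<chi>V order_refl] mor_inv_image[OF \<chi>V X(3)] \<chi>(2) by simp_all
    have "g ` V \<subseteq> normalizer G (g ` X)" using mor_normalizer[OF X(6,1,3,4)] .
    then have "mor (\<chi>' \<circ> g) V" using mor_comp[OF X(6) \<chi>'(1)] by simp
    then have m: "mor (\<chi>' \<circ> g \<circ> ?i) ?V" using mor_comp[OF i(1)] i(2) by simp
    have im: "(\<chi>' \<circ> g \<circ> ?i) ` P = P" by (simp only: image_comp[symmetric] i(3) \<chi>'(2))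
    have "P \<subseteq> ?V" using X(3) \<chi>(2) by blast
    moreover have "card P < card ?V" using X(5) mor_card[OF \<chi>V] by simp
    moreover have "?V \<subseteq> normalizer G P" using mor_normalizer[OF \<chi>V X(1,3,4)] \<chi>(2) by simp
    ultimately obtain \<rho> where \<rho>: "mor \<rho> ?R" "\<And>x. x \<in> P \<Longrightarrow> \<rho> x = (\<chi>' \<circ> g \<circ> ?i) x"
      using extends_to_centralizer_product[OF big P(1) top m _ _ _ im] by blast
    have "\<rho> ` P = P"
    proof -
      have "\<rho> ` P = (\<chi>' \<circ> g \<circ> ?i) ` P" using \<rho>(2) by (rule image_cong[OF refl])
      then show ?thesis using im by simp
    qed
    moreover have "\<rho> (\<chi> x) = \<chi>' (g x)" if x: "x \<in> X" for x
    proof -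
      have "\<chi> x \<in> P" using x \<chi>(2) by blast
      moreover have "?i (\<chi> x) = x" using mor_inv_apply[OF \<chi>V] x X(3) by blast
      ultimately show ?thesis using \<rho>(2) by simp
    qed
    ultimately show ?thesis using \<rho>(1) by blast
  qed
  have main: "composite D X h \<Longrightarrow> X \<notin> D \<Longrightarrow> normalizer_le X P \<Longrightarrow> (\<exists>f. mor f P \<and> f ` P = X) \<Longrightarrow>
      mor \<chi> (normalizer G X) \<Longrightarrow> \<chi> ` X = P \<Longrightarrow> mor \<chi>' (normalizer G (h ` X)) \<Longrightarrow> \<chi>' ` h ` X = P \<Longrightarrow>
      \<exists>\<rho>. mor \<rho> ?R \<and> \<rho> ` P = P \<and> (\<forall>x\<in>X. \<rho> (\<chi> x) = \<chi>' (h x))" for X h \<chi> \<chi>'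
  proof (induction arbitrary: \<chi> rule: composite.induct)
    case (composite_id X)
    have X: "subgroup X G" "card X = card P" using normalizer_le_subgroup[OF composite_id.prems(2)] by auto
    have GD: "carrier G \<in> D" using D by (auto simp: fusion_generated_def)
    note EX = outside_proper_normalizer[OF D X(1) composite_id.prems(1) GD subgroup.subset[OF X(1)]]
    show ?case
      using edge[OF X EX(3) _ _ mor_id[OF EX(2)] composite_id.prems(4-7)] EX(1) X(2) by simp
  next
    case (composite_step E g X h)
    have X: "subgroup X G" "card X = card P" using normalizer_le_subgroup[OF composite_step.prems(2)] by auto
    note EX = outside_proper_normalizer[OF D X(1) composite_step.prems(1) composite_step.hyps(1,3)]
    have gX: "mor g X" using mor_restrict[OF composite_step.hyps(2) X(1) composite_step.hyps(3)] .
    have gE: "mor g (E \<inter> normalizer G X)" using mor_restrict[OF composite_step.hyps(2) EX(2)] by simp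
    obtain f where f: "mor f P" "f ` P = X" using composite_step.prems(3) by blast
    have gf: "mor (g \<circ> f) P" "(g \<circ> f) ` P = g ` X" using mor_comp[OF f(1) gX] f(2) by (simp_all only: image_comp[symmetric] order_refl)
    have le: "normalizer_le (g ` X) P" using top[OF gf(1)] gf(2) by simp
    then obtain \<chi>1 where \<chi>1: "mor \<chi>1 (normalizer G (g ` X))" "\<chi>1 ` g ` X = P"
      by (auto simp: normalizer_le_def)
    obtain \<rho>1 where \<rho>1: "mor \<rho>1 ?R" "\<rho>1 ` P = P" "\<And>x. x \<in> X \<Longrightarrow> \<rho>1 (\<chi> x) = \<chi>1 (g x)"
      using edge[OF X EX(3) Int_lower2 _ gE composite_step.prems(4,5) \<chi>1] EX(1) X(2) by auto
    have hg: "(h \<circ> g) ` X = h ` g ` X" by (simp only: image_comp[symmetric])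
    have \<chi>': "mor \<chi>' (normalizer G (h ` g ` X))" "\<chi>' ` h ` g ` X = P"
      using composite_step.prems(6,7) unfolding hg by simp_all
    have ex: "\<exists>f. mor f P \<and> f ` P = g ` X" using gf by (intro exI conjI)
    have "\<exists>\<rho>. mor \<rho> ?R \<and> \<rho> ` P = P \<and> (\<forall>x\<in>g ` X. \<rho> (\<chi>1 x) = \<chi>' (h x))"
      by (rule composite_step.IH[OF outside_image[OF D X(1) composite_step.prems(1) gX] le ex \<chi>1 \<chi>'])
    then obtain \<rho>2 where \<rho>2: "mor \<rho>2 ?R" "\<rho>2 ` P = P" "\<forall>x\<in>g ` X. \<rho>2 (\<chi>1 x) = \<chi>' (h x)"
      by (elim exE conjE)
    have "mor (\<rho>2 \<circ> \<rho>1) ?R"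
      using mor_comp[OF \<rho>1(1) \<rho>2(1)] mor_centralizer_product[OF \<rho>1(1) P(1) \<rho>1(2)] by simp
    moreover have "(\<rho>2 \<circ> \<rho>1) ` P = P" by (simp only: image_comp[symmetric] \<rho>1(2) \<rho>2(2))
    moreover have "\<forall>x\<in>X. (\<rho>2 \<circ> \<rho>1) (\<chi> x) = \<chi>' ((h \<circ> g) x)" using \<rho>1(3) \<rho>2(3) by simp
    ultimately show ?case by blast
  qed
  obtain h where h: "composite D P h" "\<And>x. x \<in> P \<Longrightarrow> h x = \<alpha> x"
    using D \<alpha>(1) unfolding fusion_generated_def by blast
  have hP: "h ` P = P"
  proof -
    have "h ` P = \<alpha> ` P" using h(2) by (rule image_cong[OF refl])
    then show ?thesis using \<alpha>(2) by simp
  qed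
  have "\<exists>f. mor f P \<and> f ` P = P" using \<alpha> by blast
  moreover have idN: "mor (\<lambda>x. x) (normalizer G P)" using mor_id[OF subgroup_normalizer'[OF P(1)]] .
  moreover have "mor (\<lambda>x. x) (normalizer G (h ` P))" using idN hP by simp
  ultimately obtain \<rho> where "mor \<rho> ?R" "\<And>x. x \<in> P \<Longrightarrow> \<rho> x = h x"
    using main[OF h(1) P(2) normalizer_le_refl[OF P(1)], of "\<lambda>x. x" "\<lambda>x. x"] hP by auto
  then show ?thesis using h(2) by auto
qed

end

section \<open>Saturation inherited from an overgroup\<close>

context p_fusion_system
begin

text \<open>
  The identity of R is extended over N(P). The resulting morphism on N(P) carries P to its image
  under \<open>\<chi>\<close>, and it is onto the normalizer of this image because N(P) is the
  largest normalizer in its class.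
\<close>

lemma normalizer_onto_image_normalizer:
  assumes P: "subgroup P G" and top: "\<And>f. mor f P \<Longrightarrow> normalizer_le (f ` P) P"
    and R: "subgroup R G" "P \<subseteq> R" "normalizer G P \<subseteq> normalizer G R"
    and \<chi>: "mor \<chi> R" "extends_modulo K \<chi> R"
    and stab: "\<And>\<kappa>. \<kappa> \<in> K \<Longrightarrow> \<kappa> ` P = P"
    and inner: "\<And>\<kappa> t. \<lbrakk>\<kappa> \<in> carrier (Aut R); t \<in> normalizer G P; \<And>y. y \<in> R \<Longrightarrow> \<kappa> y = gconj G t y\<rbrakk> \<Longrightarrow> \<kappa> \<in> K"
  obtains k \<psi> where "k \<in> K" "mor \<psi> (normalizer G P)" "\<forall>x\<in>R. \<psi> x = \<chi> (k x)"
    "\<psi> ` normalizer G P = normalizer G (\<chi> ` P)"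
proof -
  have N: "subgroup (normalizer G P) G" using subgroup_normalizer'[OF P] .
  have comp: "\<exists>\<kappa>\<in>K. \<forall>y\<in>R. gconj G t y = \<kappa> y" if t: "t \<in> normalizer G P" for t
  proof -
    have "t \<in> normalizer G R" using t R(3) by blast
    then obtain \<kappa> where \<kappa>: "\<kappa> \<in> carrier (Aut R)" "\<And>y. y \<in> R \<Longrightarrow> gconj G t y = \<kappa> y"
      using Aut_transport[OF mor_id[OF R(1)], of R t] by auto
    then have "\<kappa> \<in> K" using inner[OF \<kappa>(1) t] by simp
    then show ?thesis using \<kappa>(2) by blast
  qed
  obtain k \<psi> U where k: "k \<in> K" "mor \<psi> U" "R \<subseteq> U" "normalizer G P \<subseteq> U" "U \<subseteq> normalizer G R" "\<forall>x\<in>R. \<psi> x = \<chi> (k x)"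
    by (rule extends_moduloE[OF \<chi>(2) mor_id[OF R(1)] _ N R(3) comp]) auto
  have \<psi>: "mor \<psi> (normalizer G P)" using mor_restrict[OF k(2) N k(4)] .
  have "\<psi> ` P = \<chi> ` k ` P" unfolding image_image using k(6) R(2) by (intro image_cong) auto
  then have \<psi>P: "\<psi> ` P = \<chi> ` P" using stab[OF k(1)] by simp
  obtain \<mu> where \<mu>: "subgroup (\<chi> ` P) G" "mor \<mu> (normalizer G (\<chi> ` P))" "\<mu> ` \<chi> ` P = P"
    using top[OF mor_restrict[OF \<chi>(1) P R(2)]] by (auto simp: normalizer_le_def)
  have "card (normalizer G (\<chi> ` P)) \<le> card (normalizer G P)"
    using card_mono[OF finite_subgroup[OF N] mor_normalizer_image[OF \<mu>(1,2), unfolded \<mu>(3)]] mor_card[OF \<mu>(2)] by simp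
  then have "\<psi> ` normalizer G P = normalizer G (\<chi> ` P)" using normalizer_image_eq[OF P \<psi>] \<psi>P by simp
  then show thesis using that[OF k(1) \<psi> k(6)] by simp
qed

text \<open>
  Let Z be a Sylow subgroup of the stabilizer A of P in Aut(R). As A restricts onto Aut(P), the
  restriction of Z is a Sylow subgroup of Aut(P). Up to conjugation in A, the elements of Z are
  conjugations by elements of N(P), so the restriction of Z is conjugate to a group of inner
  automorphisms, and these form a subgroup of Sylow order.
\<close>

lemma fully_automized_from_overgroup:
  assumes P: "subgroup P G" and top: "\<And>f. mor f P \<Longrightarrow> normalizer_le (f ` P) P"
    and R: "subgroup R G" "saturated_at R" "P \<subseteq> R" "R \<subseteq> normalizer G P" "normalizer G P \<subseteq> normalizer G R"
    and ext: "\<And>\<alpha>. mor \<alpha> P \<Longrightarrow> \<alpha> ` P = P \<Longrightarrow> \<exists>\<beta>. mor \<beta> R \<and> \<beta> ` R = R \<and> (\<forall>x\<in>P. \<beta> x = \<alpha> x)"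
  shows "fully_automized p G F P"
proof -
  define A where "A = {\<kappa> \<in> carrier (Aut R). \<kappa> ` P = P}"
  have A: "subgroup A (Aut R)" using subgroup_stabilizer_Aut[OF R(1,3)] by (simp add: A_def)
  have AD: "\<kappa> \<in> carrier (Aut R)" "\<kappa> ` P = P" if "\<kappa> \<in> A" for \<kappa> using that by (simp_all add: A_def)
  obtain \<chi> where \<chi>: "mor \<chi> R" "p_subgroups_become_inner A \<chi> R" "extends_modulo A \<chi> R"
    by (rule extension_modulo_automorphisms[OF R(2,1) A])
  have inner: "\<kappa> \<in> A" if "\<kappa> \<in> carrier (Aut R)" "t \<in> normalizer G P" "\<And>y. y \<in> R \<Longrightarrow> \<kappa> y = gconj G t y" for \<kappa> t
  proof -
    have "\<kappa> ` P = gconj G t ` P" using that(3) R(3) by (intro image_cong) auto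
    then show ?thesis using that(1,2) mem_normalizer_iff[OF subgroup.subset[OF P]] by (simp add: A_def)
  qed
  obtain k1 \<psi> where k1: "k1 \<in> A" and \<psi>: "mor \<psi> (normalizer G P)" "\<forall>x\<in>R. \<psi> x = \<chi> (k1 x)"
    and \<psi>N: "\<psi> ` normalizer G P = normalizer G (\<chi> ` P)"
    by (rule normalizer_onto_image_normalizer[OF P top R(1,3,5) \<chi>(1,3) AD(2) inner])
  have \<chi>P: "subgroup (\<chi> ` P) G" using mor_image_subgroup[OF \<chi>(1) P R(3)] .
  interpret AR: group "Aut R" using group_Aut[OF R(1)] .
  interpret AP: group "Aut P" using group_Aut[OF P] .
  interpret AA: group "(Aut R)\<lparr>carrier := A\<rparr>" using AR.subgroup_imp_group[OF A] .
  have finA: "finite A" using finite_Aut[OF R(1)] subgroup.subset[OF A] finite_subset by blast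
  let ?r = "\<lambda>\<kappa>. restrict \<kappa> P"
  have r_cl: "?r \<kappa> \<in> carrier (Aut P)" if "\<kappa> \<in> A" for \<kappa>
  proof -
    have "mor \<kappa> R" using AD(1)[OF that] by (simp add: Aut_iff)
    then show ?thesis using Aut_restrictI[OF mor_restrict[OF _ P R(3)]] AD(2)[OF that] by blast
  qed
  have r_hom: "?r \<in> hom ((Aut R)\<lparr>carrier := A\<rparr>) (Aut P)"
  proof (rule homI)
    show "?r \<kappa> \<in> carrier (Aut P)" if "\<kappa> \<in> carrier ((Aut R)\<lparr>carrier := A\<rparr>)" for \<kappa> using r_cl that by simp
    fix \<kappa> l assume "\<kappa> \<in> carrier ((Aut R)\<lparr>carrier := A\<rparr>)" "l \<in> carrier ((Aut R)\<lparr>carrier := A\<rparr>)"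
    then have kl: "\<kappa> \<in> A" "l \<in> A" by simp_all
    have "?r (\<kappa> \<otimes>\<^bsub>Aut R\<^esub> l) = ?r \<kappa> \<otimes>\<^bsub>Aut P\<^esub> ?r l"
    proof (rule Aut_eqI[OF r_cl[OF subgroup.m_closed[OF A kl]] AP.m_closed[OF r_cl[OF kl(1)] r_cl[OF kl(2)]]])
      fix x assume x: "x \<in> P"
      then have "l x \<in> P" "x \<in> R" using AD(2)[OF kl(2)] R(3) by blast+
      then show "?r (\<kappa> \<otimes>\<^bsub>Aut R\<^esub> l) x = (?r \<kappa> \<otimes>\<^bsub>Aut P\<^esub> ?r l) x"
        using Aut_mult_apply[OF AD(1)[OF kl(1)] AD(1)[OF kl(2)]] Aut_mult_apply[OF r_cl[OF kl(1)] r_cl[OF kl(2)] x] x by simp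
    qed
    then show "?r (\<kappa> \<otimes>\<^bsub>(Aut R)\<lparr>carrier := A\<rparr>\<^esub> l) = ?r \<kappa> \<otimes>\<^bsub>Aut P\<^esub> ?r l" by simp
  qed
  interpret r: group_hom "(Aut R)\<lparr>carrier := A\<rparr>" "Aut P" ?r
    using r_hom by unfold_locales
  have r_surj: "?r ` A = carrier (Aut P)"
  proof
    show "?r ` A \<subseteq> carrier (Aut P)" using r_cl by blast
    show "carrier (Aut P) \<subseteq> ?r ` A"
    proof
      fix \<alpha> assume \<alpha>: "\<alpha> \<in> carrier (Aut P)"
      then have "mor \<alpha> P" "\<alpha> ` P = P" by (simp_all add: Aut_iff)
      then obtain \<beta> where \<beta>: "mor \<beta> R" "\<beta> ` R = R" "\<forall>x\<in>P. \<beta> x = \<alpha> x" using ext by blast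
      have "restrict \<beta> R ` P = \<alpha> ` P" using \<beta>(3) R(3) by (intro image_cong) auto
      then have \<beta>A: "restrict \<beta> R \<in> A"
        using Aut_restrictI[OF \<beta>(1,2)] \<open>\<alpha> ` P = P\<close> by (simp add: A_def)
      have "\<alpha> = ?r (restrict \<beta> R)"
      proof (rule Aut_eqI[OF \<alpha> r_cl[OF \<beta>A]])
        fix x assume "x \<in> P"
        moreover from this have "x \<in> R" using R(3) by blast
        ultimately show "\<alpha> x = ?r (restrict \<beta> R) x" using \<beta>(3) by simp
      qed
      then show "\<alpha> \<in> ?r ` A" using \<beta>A by blast
    qed
  qed
  obtain Z where Z: "sylow_subgroup p ((Aut R)\<lparr>carrier := A\<rparr>) Z"
    using AA.sylow_exists[OF _ prime_p] finA by auto
  have cZ: "\<exists>a. card Z = p ^ a" using Z unfolding sylow_subgroup_def by (intro exI) (erule conjunct2)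
  have Z': "subgroup Z ((Aut R)\<lparr>carrier := A\<rparr>)" using Z by (simp add: sylow_subgroup_def)
  have ZA: "Z \<subseteq> A" "subgroup Z (Aut R)"
    using subgroup.subset[OF Z'] AR.incl_subgroup[OF A Z'] by simp_all
  have rZ: "sylow_subgroup p (Aut P) (?r ` Z)"
    using r.sylow_image[OF _ prime_p _ Z] finA r_surj by simp
  obtain n where n: "card Z = p ^ n" using cZ by (elim exE)
  have "\<exists>k\<in>A. \<forall>x\<in>Z. \<exists>s\<in>normalizer G (\<chi> ` R). \<forall>y\<in>R. \<chi> (k (x y)) = gconj G s (\<chi> (k y))"
    using \<chi>(2)[unfolded p_subgroups_become_inner_def, rule_format, of Z n] ZA n by simp
  then obtain k2 where k2: "k2 \<in> A"
    "\<forall>x\<in>Z. \<exists>s\<in>normalizer G (\<chi> ` R). \<forall>y\<in>R. \<chi> (k2 (x y)) = gconj G s (\<chi> (k2 y))" by (elim bexE)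
  let ?k1 = "?r k1" and ?k2 = "?r k2"
  let ?k = "inv\<^bsub>Aut P\<^esub> ?k1 \<otimes>\<^bsub>Aut P\<^esub> ?k2"
  have kP: "?k1 \<in> carrier (Aut P)" "?k2 \<in> carrier (Aut P)" "?k \<in> carrier (Aut P)"
    using r_cl[OF k1] r_cl[OF k2(1)] by simp_all
  \<comment> \<open>The element s in the inner action of x on the image of R normalizes the image of P, so it
     comes from an element t of N(P) under \<open>\<psi>\<close>; then k conjugates x to the
     action of t.\<close>
  have conj: "?k \<otimes>\<^bsub>Aut P\<^esub> z \<otimes>\<^bsub>Aut P\<^esub> inv\<^bsub>Aut P\<^esub> ?k \<in> inner_auts G P" if zr: "z \<in> ?r ` Z" for z
  proof -
    obtain x where x: "x \<in> Z" "z = ?r x" using zr by blast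
    have xA: "x \<in> A" using x(1) ZA(1) by blast
    have zP: "z \<in> carrier (Aut P)" using r_cl[OF xA] x(2) by simp
    obtain s where s: "s \<in> normalizer G (\<chi> ` R)" "\<And>y. y \<in> R \<Longrightarrow> \<chi> (k2 (x y)) = gconj G s (\<chi> (k2 y))"
      using k2(2) x(1) by blast
    have sc: "s \<in> carrier G" using subgroup.mem_carrier[OF subgroup_normalizer'[OF mor_subgroup(2)[OF \<chi>(1)]] s(1)] .
    have "s \<in> normalizer G (\<chi> ` P)"
    proof (rule normalizer_memI[OF \<chi>P finite_subgroup[OF \<chi>P] sc])
      fix w assume "w \<in> \<chi> ` P"
      then have "w \<in> \<chi> ` k2 ` P" using AD(2)[OF k2(1)] by simp
      then obtain y where y: "y \<in> P" "w = \<chi> (k2 y)" by blast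
      have "k2 (x y) \<in> P" using y(1) AD(2)[OF xA] AD(2)[OF k2(1)] by blast
      then show "gconj G s w \<in> \<chi> ` P" using s(2)[of y] y R(3) by (metis image_eqI subsetD)
    qed
    then obtain t where t: "t \<in> normalizer G P" "s = \<psi> t" using \<psi>N by blast
    let ?c = "restrict (gconj G t) P"
    have c_inner: "?c \<in> inner_auts G P" using t(1) by (simp add: inner_auts_def)
    then have cP: "?c \<in> carrier (Aut P)" by (rule subgroup.mem_carrier[OF inner_auts_p_subgroup(1)[OF P]])
    have "?k2 \<otimes>\<^bsub>Aut P\<^esub> z = ?k1 \<otimes>\<^bsub>Aut P\<^esub> (?c \<otimes>\<^bsub>Aut P\<^esub> ?k)"
    proof (rule Aut_eqI)
      fix y assume y: "y \<in> P"
      have zy: "z y = x y" "x y \<in> P" using x(2) y AD(2)[OF xA] by auto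
      have k2y: "k2 y \<in> P" using AD(2)[OF k2(1)] y by blast
      let ?w = "(inv\<^bsub>Aut P\<^esub> ?k1) (k2 y)"
      have w: "?w \<in> P" using Aut_closed[OF _ k2y] kP(1) by simp
      have kw: "?k y = ?w" using Aut_mult_apply[of "inv\<^bsub>Aut P\<^esub> ?k1" P ?k2 y] kP y by simp
      have k1w: "k1 ?w = k2 y" using Aut_inv_apply(2)[OF P kP(1) k2y] w by simp
      have tw: "gconj G t ?w \<in> P" using normalizer_memD[OF P t(1) w] .
      have "\<chi> (k2 (x y)) = gconj G (\<psi> t) (\<chi> (k1 ?w))" using s(2)[of y] t(2) k1w y R(3) by auto
      also have "\<dots> = gconj G (\<psi> t) (\<psi> ?w)" using \<psi>(2) w R(3) by auto
      also have "\<dots> = \<psi> (gconj G t ?w)" using mor_conj[OF \<psi>(1) t(1), of ?w] w subset_normalizer[OF P] by auto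
      also have "\<dots> = \<chi> (k1 (gconj G t ?w))" using \<psi>(2) tw R(3) by auto
      finally have "\<chi> (k2 (x y)) = \<chi> (k1 (gconj G t ?w))" .
      moreover have "k2 (x y) \<in> R" "k1 (gconj G t ?w) \<in> R"
        using zy(2) tw AD(2)[OF k2(1)] AD(2)[OF k1] R(3) by blast+
      ultimately have eq: "k2 (x y) = k1 (gconj G t ?w)" using mor_inj[OF \<chi>(1)] by (meson inj_onD)
      have "(?k2 \<otimes>\<^bsub>Aut P\<^esub> z) y = k2 (x y)" using Aut_mult_apply[OF kP(2) zP y] zy by simp
      moreover have "(?k1 \<otimes>\<^bsub>Aut P\<^esub> (?c \<otimes>\<^bsub>Aut P\<^esub> ?k)) y = k1 (gconj G t ?w)"
        using Aut_mult_apply[OF kP(1) AP.m_closed[OF cP kP(3)] y] Aut_mult_apply[OF cP kP(3) y] kw w tw by simp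
      ultimately show "(?k2 \<otimes>\<^bsub>Aut P\<^esub> z) y = (?k1 \<otimes>\<^bsub>Aut P\<^esub> (?c \<otimes>\<^bsub>Aut P\<^esub> ?k)) y" using eq by simp
    qed (use kP zP cP in simp_all)
    then have "inv\<^bsub>Aut P\<^esub> ?k1 \<otimes>\<^bsub>Aut P\<^esub> (?k2 \<otimes>\<^bsub>Aut P\<^esub> z) = ?c \<otimes>\<^bsub>Aut P\<^esub> ?k"
      using AP.inv_solve_left'[of ?k1 "?k2 \<otimes>\<^bsub>Aut P\<^esub> z" "?c \<otimes>\<^bsub>Aut P\<^esub> ?k"] kP zP cP
      by (metis AP.inv_solve_left AP.m_closed)
    then have "?k \<otimes>\<^bsub>Aut P\<^esub> z = ?c \<otimes>\<^bsub>Aut P\<^esub> ?k" using kP zP by (simp add: AP.m_assoc)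
    then have "?k \<otimes>\<^bsub>Aut P\<^esub> z \<otimes>\<^bsub>Aut P\<^esub> inv\<^bsub>Aut P\<^esub> ?k = ?c \<otimes>\<^bsub>Aut P\<^esub> ?k \<otimes>\<^bsub>Aut P\<^esub> inv\<^bsub>Aut P\<^esub> ?k" by simp
    also have "\<dots> = ?c" using kP(3) cP AP.m_assoc[OF cP kP(3)] AP.r_inv[OF kP(3)] AP.inv_closed[OF kP(3)] by simp
    finally show ?thesis using c_inner by simp
  qed
  have rZc: "?r ` Z \<subseteq> carrier (Aut P)" using r_cl ZA(1) by blast
  have "inj_on (\<lambda>z. ?k \<otimes>\<^bsub>Aut P\<^esub> z \<otimes>\<^bsub>Aut P\<^esub> inv\<^bsub>Aut P\<^esub> ?k) (?r ` Z)"
    by (rule inj_onI) (use kP(3) rZc in \<open>auto simp: subset_iff\<close>)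
  then have "card (?r ` Z) \<le> card (inner_auts G P)"
    using card_inj_on_le[OF _ _ finite_subset[OF subgroup.subset[OF inner_auts_p_subgroup(1)[OF P]] finite_Aut[OF P]]] conj
    by blast
  then have le: "p ^ multiplicity p (order (Aut P)) \<le> card (inner_auts G P)"
    using rZ by (simp add: sylow_subgroup_def)
  obtain m where m: "card (inner_auts G P) = p ^ m" using inner_auts_p_subgroup(2)[OF P] by (elim exE)
  show ?thesis
    unfolding fully_automized_def by (rule AP.sylowI[OF finite_Aut[OF P] prime_p inner_auts_p_subgroup(1)[OF P] m le])
qed

text \<open>
  Let l carry P' to P on the whole normalizer of P'. It remains to extend the automorphism
  \<open>\<alpha>\<close>, which is \<open>\<phi>\<close> after the inverse of l, over the image T
  of the extension domain of \<open>\<phi>\<close>. Extend \<open>\<alpha>\<close> to an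
  automorphism \<open>\<beta>\<close> of R. Along \<open>\<beta>\<close>, the group T acts on R
  through the group K of all automorphisms that act on P like an element of N(P), so \<open>\<chi>
  k2 \<beta>\<close> extends over T. The same \<open>\<chi>\<close> has an extension \<open>\<chi>
  k1\<close> over N(P) with image the normalizer of the image of P. The inverse of the second
  after the first agrees with \<open>\<alpha>\<close> on P up to elements of K, which are
  conjugations by s1 and s2 there.
\<close>

lemma receptive_from_overgroup:
  assumes P: "subgroup P G" and top: "\<And>f. mor f P \<Longrightarrow> normalizer_le (f ` P) P"
    and R: "subgroup R G" "saturated_at R" "P \<subseteq> R" "R \<subseteq> normalizer G P" "normalizer G P \<subseteq> normalizer G R"
    and ext: "\<And>\<alpha>. mor \<alpha> P \<Longrightarrow> \<alpha> ` P = P \<Longrightarrow> \<exists>\<beta>. mor \<beta> R \<and> \<beta> ` R = R \<and> (\<forall>x\<in>P. \<beta> x = \<alpha> x)"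
  shows "receptive G F P"
  unfolding receptive_def
proof (intro allI ballI)
  fix P' \<phi> assume "\<phi> \<in> fus_iso F P' P"
  then have \<phi>: "mor \<phi> P'" "\<phi> ` P' = P" by (simp_all add: iso_iff)
  have P': "subgroup P' G" using mor_subgroup(1)[OF \<phi>(1)] .
  let ?N = "extension_domain G P' P \<phi>"
  have N: "subgroup ?N G" "P' \<subseteq> ?N" using subgroup_extension_domain[OF \<phi>] subset_extension_domain[OF \<phi>] .
  have NN: "?N \<subseteq> normalizer G P'" using mem_extension_domain[OF \<phi>] by blast
  have NP: "subgroup (normalizer G P) G" using subgroup_normalizer'[OF P] .
  have Pc: "x \<in> carrier G" if "x \<in> P" for x using subgroup.mem_carrier[OF P that] .
  have NPc: "x \<in> carrier G" if "x \<in> normalizer G P" for x using subgroup.mem_carrier[OF NP that] .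
  have "mor (inv_into P' \<phi>) P" "inv_into P' \<phi> ` P = P'" using mor_inv[OF \<phi>(1)] mor_inv_image[OF \<phi>(1) order_refl] \<phi>(2) by simp_all
  then have "normalizer_le P' P" using top by metis
  then obtain l where l: "mor l (normalizer G P')" "l ` P' = P" by (auto simp: normalizer_le_def)
  have lP': "mor l P'" using mor_restrict[OF l(1) P' subset_normalizer[OF P']] .
  let ?li = "inv_into P' l"
  have li: "mor ?li P" "?li ` P = P'" using mor_inv[OF lP'] mor_inv_image[OF lP' order_refl] l(2) by simp_all
  let ?\<alpha> = "\<phi> \<circ> ?li"
  have \<alpha>: "mor ?\<alpha> P" "?\<alpha> ` P = P"
    using mor_comp[OF li(1) \<phi>(1)] li(2) \<phi>(2) by (simp_all only: image_comp[symmetric] order_refl)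
  have \<alpha>l: "?\<alpha> (l x) = \<phi> x" if "x \<in> P'" for x using mor_inv_apply[OF lP' that] by simp
  obtain \<beta> where \<beta>: "mor \<beta> R" "\<beta> ` R = R" "\<forall>x\<in>P. \<beta> x = ?\<alpha> x" using ext[OF \<alpha>] by blast
  define K where "K = {\<kappa> \<in> carrier (Aut R). \<exists>s\<in>normalizer G P. \<forall>y\<in>P. \<kappa> y = gconj G s y}"
  have K: "subgroup K (Aut R)" using subgroup_inner_on_Aut[OF R(1) P R(3)] by (simp add: K_def)
  obtain \<chi> where \<chi>: "mor \<chi> R" "p_subgroups_become_inner K \<chi> R" "extends_modulo K \<chi> R"
    by (rule extension_modulo_automorphisms[OF R(2,1) K])
  have im_norm: "gconj G s ` P = P" if "s \<in> normalizer G P" for s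
    using that mem_normalizer_iff[OF subgroup.subset[OF P]] by blast
  have stab: "\<kappa> ` P = P" if \<kappa>: "\<kappa> \<in> K" for \<kappa>
  proof -
    obtain s where s: "s \<in> normalizer G P" "\<forall>y\<in>P. \<kappa> y = gconj G s y" using \<kappa> by (auto simp: K_def)
    have "\<kappa> ` P = gconj G s ` P" using s(2) by (intro image_cong) auto
    then show ?thesis using im_norm[OF s(1)] by simp
  qed
  have inner: "\<kappa> \<in> K" if "\<kappa> \<in> carrier (Aut R)" "t \<in> normalizer G P" "\<And>y. y \<in> R \<Longrightarrow> \<kappa> y = gconj G t y" for \<kappa> t
    using that R(3) unfolding K_def by blast
  obtain k1 \<psi>1 where k1: "k1 \<in> K" "mor \<psi>1 (normalizer G P)" "\<forall>x\<in>R. \<psi>1 x = \<chi> (k1 x)"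
    and \<psi>1N: "\<psi>1 ` normalizer G P = normalizer G (\<chi> ` P)"
    by (rule normalizer_onto_image_normalizer[OF P top R(1,3,5) \<chi>(1,3) stab inner])
  let ?T = "l ` ?N"
  have lN: "mor l ?N" using mor_restrict[OF l(1) N(1) NN] .
  have T: "subgroup ?T G" using mor_subgroup(2)[OF lN] .
  have TN: "?T \<subseteq> normalizer G P" using mor_normalizer[OF lN P' N(2) NN] l(2) by simp
  have PT: "P \<subseteq> ?T" using N(2) l(2) by blast
  have comp2: "\<exists>\<kappa>\<in>K. \<forall>y\<in>R. \<beta> (gconj G t y) = \<kappa> (\<beta> y)" if tT: "t \<in> ?T" for t
  proof -
    obtain u where u: "u \<in> ?N" "t = l u" using tT by blast
    obtain s where s: "s \<in> normalizer G P" "\<And>y. y \<in> P' \<Longrightarrow> \<phi> (gconj G u y) = gconj G s (\<phi> y)"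
      using u(1) mem_extension_domain[OF \<phi>] by blast
    have tN: "t \<in> normalizer G P" using tT TN by blast
    then have "t \<in> normalizer G R" using R(5) by blast
    then obtain \<kappa> where \<kappa>: "\<kappa> \<in> carrier (Aut R)" "\<And>y. y \<in> R \<Longrightarrow> \<beta> (gconj G t y) = \<kappa> (\<beta> y)"
      using Aut_transport[OF \<beta>(1,2), of t] by blast
    have "\<kappa> y = gconj G s y" if y: "y \<in> P" for y
    proof -
      obtain w where w: "w \<in> P'" "y = \<phi> w" using y \<phi>(2) by blast
      have lw: "l w \<in> P" using w(1) l(2) by blast
      have uw: "gconj G u w \<in> P'" using normalizer_memD[OF P' _ w(1)] u(1) NN by blast
      have \<beta>lw: "\<beta> (l w) = y" using \<beta>(3) lw \<alpha>l[OF w(1)] w(2) by simp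
      have "gconj G t (l w) = l (gconj G u w)"
        using mor_conj[OF lN u(1), of w] w(1) N(2) u(2) by auto
      moreover have "l (gconj G u w) \<in> P" using uw l(2) by blast
      ultimately have "\<beta> (gconj G t (l w)) = \<phi> (gconj G u w)" using \<beta>(3) \<alpha>l[OF uw] by simp
      then have "\<kappa> y = \<phi> (gconj G u w)" using \<kappa>(2)[of "l w"] lw R(3) \<beta>lw by auto
      then show ?thesis using s(2)[OF w(1)] w(2) by simp
    qed
    then show ?thesis using \<kappa> s(1) unfolding K_def by blast
  qed
  obtain k2 \<psi>2 U2 where k2: "k2 \<in> K" "mor \<psi>2 U2" "R \<subseteq> U2" "?T \<subseteq> U2" "U2 \<subseteq> normalizer G R" "\<forall>x\<in>R. \<psi>2 x = \<chi> (k2 (\<beta> x))"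
    by (rule extends_moduloE[OF \<chi>(3) \<beta>(1,2) T _ comp2]) (use TN R(5) in auto)
  obtain s1 where s1: "s1 \<in> normalizer G P" "\<forall>y\<in>P. k1 y = gconj G s1 y" using k1(1) by (auto simp: K_def)
  obtain s2 where s2: "s2 \<in> normalizer G P" "\<forall>y\<in>P. k2 y = gconj G s2 y" using k2(1) by (auto simp: K_def)
  have \<psi>1P: "\<psi>1 y = \<chi> (gconj G s1 y)" if "y \<in> P" for y using k1(3) s1(2) that R(3) by auto
  have \<psi>2: "mor \<psi>2 ?T" using mor_restrict[OF k2(2) T k2(4)] .
  have \<psi>2P: "\<psi>2 y = \<chi> (gconj G s2 (?\<alpha> y))" if y: "y \<in> P" for y
  proof -
    have "\<beta> y = ?\<alpha> y" using \<beta>(3) y by blast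
    moreover have "?\<alpha> y \<in> P" using y \<alpha>(2) by blast
    ultimately show ?thesis using k2(6) s2(2) y R(3) by auto
  qed
  have \<psi>2im: "\<psi>2 ` P = \<chi> ` P"
  proof -
    have "\<psi>2 ` P = \<chi> ` gconj G s2 ` ?\<alpha> ` P" unfolding image_image using \<psi>2P by (rule image_cong[OF refl])
    then show ?thesis using im_norm[OF s2(1)] \<alpha>(2) by simp
  qed
  have \<psi>2N: "\<psi>2 ` ?T \<subseteq> normalizer G (\<chi> ` P)"
    using mor_normalizer[OF \<psi>2 P PT TN] \<psi>2im by simp
  let ?j = "inv_into (normalizer G P) \<psi>1"
  have j: "mor ?j (normalizer G (\<chi> ` P))" "?j ` normalizer G (\<chi> ` P) = normalizer G P"
    using mor_inv[OF k1(2)] mor_inv_image[OF k1(2) order_refl] \<psi>1N by simp_all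
  let ?c = "gconj G (s1 \<otimes> inv s2)"
  have sc: "s1 \<in> carrier G" "s2 \<in> carrier G" using NPc s1(1) s2(1) by simp_all
  have c: "mor ?c (normalizer G P)" using mor_gconj[OF NP] sc by simp
  let ?\<theta> = "?c \<circ> (?j \<circ> (\<psi>2 \<circ> l))"
  have m1: "mor (\<psi>2 \<circ> l) ?N" using mor_comp[OF lN \<psi>2] by simp
  have m1im: "(\<psi>2 \<circ> l) ` ?N \<subseteq> normalizer G (\<chi> ` P)" using \<psi>2N by (simp only: image_comp[symmetric])
  have m2: "mor (?j \<circ> (\<psi>2 \<circ> l)) ?N" using mor_comp[OF m1 j(1) m1im] .
  have m2im: "(?j \<circ> (\<psi>2 \<circ> l)) ` ?N \<subseteq> normalizer G P"
    using image_mono[OF m1im, of ?j] j(2) by (simp only: image_comp)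
  have \<theta>: "mor ?\<theta> ?N" using mor_comp[OF m2 c m2im] .
  have eq: "?\<theta> x = \<phi> x" if x: "x \<in> P'" for x
  proof -
    have lx: "l x \<in> P" and \<phi>x: "\<phi> x \<in> P" using x l(2) \<phi>(2) by blast+
    let ?y = "gconj G (s2 \<otimes> inv s1) (\<phi> x)"
    have "s2 \<otimes> inv s1 \<in> normalizer G P"
      using subgroup.m_closed[OF NP s2(1) subgroup.m_inv_closed[OF NP s1(1)]] .
    then have y: "?y \<in> P" using normalizer_memD[OF P _ \<phi>x] by simp
    have xc: "\<phi> x \<in> carrier G" using Pc[OF \<phi>x] .
    have "gconj G s1 ?y = gconj G s2 (\<phi> x)"
      using gconj_mult[OF _ sc(1) xc, of "s2 \<otimes> inv s1"] sc by (simp add: m_assoc)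
    then have "\<psi>1 ?y = \<psi>2 (l x)" using \<psi>1P[OF y] \<psi>2P[OF lx] \<alpha>l[OF x] by simp
    moreover have "?y \<in> normalizer G P" using y subset_normalizer[OF P] by blast
    ultimately have "?j (\<psi>2 (l x)) = ?y" using mor_inv_apply[OF k1(2), of ?y] by simp
    moreover have "s1 \<otimes> inv s2 = inv (s2 \<otimes> inv s1)" using sc by (simp add: inv_mult_group)
    then have "?c ?y = \<phi> x" using gconj_inv(1)[of "s2 \<otimes> inv s1", OF _ xc] sc by simp
    ultimately show ?thesis by simp
  qed
  have "restrict ?\<theta> ?N \<in> F ?N (carrier G)"
    using mor_mem[OF \<theta> subgroup_self subgroup.subset[OF mor_subgroup(2)[OF \<theta>]]] .
  moreover have "\<forall>x\<in>P'. restrict ?\<theta> ?N x = \<phi> x" using eq N(2) by auto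
  ultimately show "\<exists>\<psi>\<in>F ?N (carrier G). \<forall>x\<in>P'. \<psi> x = \<phi> x" by blast
qed

end

section \<open>Centric subgroups that are not radical\<close>

lemma (in group) gconj_subgroup:
  assumes "subgroup H G" "g \<in> H"
  shows "gconj (G\<lparr>carrier := H\<rparr>) g x = gconj G g x"
  using m_inv_consistent[OF assms] by (simp add: gconj_def)

lemma (in group) normalizer_in_normalizer:
  assumes H: "subgroup H G" and X: "X \<subseteq> H"
  shows "normalizer (G\<lparr>carrier := H\<rparr>) X = H \<inter> normalizer G X"
proof -
  interpret H: group "G\<lparr>carrier := H\<rparr>" using subgroup_imp_group[OF H] .
  have HG: "H \<subseteq> carrier G" using subgroup.subset[OF H] .
  show ?thesis
  proof (rule Set.set_eqI)
    fix g
    have "g \<in> normalizer (G\<lparr>carrier := H\<rparr>) X \<longleftrightarrow> g \<in> H \<and> gconj (G\<lparr>carrier := H\<rparr>) g ` X = X"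
      using H.mem_normalizer_iff[of X g] X by simp
    also have "\<dots> \<longleftrightarrow> g \<in> H \<and> gconj G g ` X = X" by (simp add: gconj_subgroup[OF H] cong: conj_cong)
    also have "\<dots> \<longleftrightarrow> g \<in> H \<inter> normalizer G X" using mem_normalizer_iff[of X g] X HG by auto
    finally show "g \<in> normalizer (G\<lparr>carrier := H\<rparr>) X \<longleftrightarrow> g \<in> H \<inter> normalizer G X" .
  qed
qed

lemma (in group) set_mult_normalized_subgroup:
  assumes A: "subgroup A G" and P: "subgroup P G" and AN: "A \<subseteq> normalizer G P"
  shows "subgroup (A <#> P) G"
proof (rule subgroupI)
  have Ac: "a \<in> carrier G" if "a \<in> A" for a using subgroup.mem_carrier[OF A that] .
  have Pc: "x \<in> carrier G" if "x \<in> P" for x using subgroup.mem_carrier[OF P that] .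
  have memI: "a \<otimes> x \<in> A <#> P" if "a \<in> A" "x \<in> P" for a x using that by (auto simp: set_mult_def)
  show "A <#> P \<subseteq> carrier G" using Ac Pc by (auto simp: set_mult_def)
  show "A <#> P \<noteq> {}" using memI[OF subgroup.one_closed[OF A] subgroup.one_closed[OF P]] by blast
  fix g assume "g \<in> A <#> P"
  then obtain a x where g: "a \<in> A" "x \<in> P" "g = a \<otimes> x" by (auto simp: set_mult_def)
  have ia: "inv a \<in> A" and ix: "inv x \<in> P" using subgroup.m_inv_closed[OF A g(1)] subgroup.m_inv_closed[OF P g(2)] .
  have "gconj G (inv a) (inv x) \<in> P" using normalizer_memD[OF P _ ix] ia AN by blast
  moreover have "inv g = inv a \<otimes> gconj G (inv a) (inv x)"
    using g Ac[OF g(1)] Pc[OF g(2)] by (simp add: gconj_def inv_mult_group flip: m_assoc)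
  ultimately show "inv g \<in> A <#> P" using memI[OF ia] by simp
  fix h assume "h \<in> A <#> P"
  then obtain b y where h: "b \<in> A" "y \<in> P" "h = b \<otimes> y" by (auto simp: set_mult_def)
  have bx: "gconj G b x \<in> P" using normalizer_memD[OF P _ g(2)] h(1) AN by blast
  have "b \<otimes> gconj G b x = x \<otimes> b" using Ac[OF h(1)] Pc[OF g(2)] by (simp add: gconj_def flip: m_assoc)
  moreover have "a \<otimes> b \<otimes> (gconj G b x \<otimes> y) = a \<otimes> (b \<otimes> gconj G b x) \<otimes> y"
    using Ac[OF g(1)] Ac[OF h(1)] Pc[OF bx] Pc[OF h(2)] by (simp add: m_assoc)
  ultimately have "g \<otimes> h = a \<otimes> b \<otimes> (gconj G b x \<otimes> y)"
    using g h Ac[OF g(1)] Ac[OF h(1)] Pc[OF g(2)] Pc[OF h(2)] by (simp add: m_assoc)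
  then show "g \<otimes> h \<in> A <#> P"
    using memI[OF subgroup.m_closed[OF A g(1) h(1)] subgroup.m_closed[OF P bx h(2)]] by simp
qed

lemma (in group) set_mult_contains:
  assumes "subgroup A G" "subgroup B G"
  shows "A \<subseteq> A <#> B" "B \<subseteq> A <#> B"
proof -
  have "a = a \<otimes> \<one>" if "a \<in> A" for a using subgroup.mem_carrier[OF assms(1) that] by simp
  then show "A \<subseteq> A <#> B" using subgroup.one_closed[OF assms(2)] by (fastforce simp: set_mult_def)
  have "b = \<one> \<otimes> b" if "b \<in> B" for b using subgroup.mem_carrier[OF assms(2) that] by simp
  then show "B \<subseteq> A <#> B" using subgroup.one_closed[OF assms(1)] by (fastforce simp: set_mult_def)
qed

lemma (in group) set_mult_absorb:
  assumes A: "subgroup A G" and P: "subgroup P G"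
  shows "A <#> P <#> P = A <#> P" "P <#> P = P"
proof -
  show PP: "P <#> P = P"
    using set_mult_contains(1)[OF P P] subgroup.m_closed[OF P] by (auto simp: set_mult_def)
  show "A <#> P <#> P = A <#> P"
    using set_mult_assoc[OF subgroup.subset[OF A] subgroup.subset[OF P] subgroup.subset[OF P]] PP by simp
qed

context p_fusion_system
begin

text \<open>
  Morphisms of the normalizer fusion system already extend to the products with P, which absorb a
  second factor P.
\<close>

lemma normal_in_normalizer_fusion:
  assumes P: "subgroup P G"
  shows "fus_normal (normalizer_group G P) (normalizer_fusion G F P) P"
proof -
  let ?N = "normalizer G P"
  have N: "subgroup ?N G" using subgroup_normalizer'[OF P] .
  have PN: "P \<subseteq> ?N" using subset_normalizer[OF P] .
  have sP: "subgroup P (normalizer_group G P)" using subgroup_incl[OF P N PN] .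
  have nP: "normalizer (normalizer_group G P) P = ?N" using normalizer_in_normalizer[OF N PN] by simp
  have "normalizer_fusion G F P A B = normalizer_fusion (normalizer_group G P) (normalizer_fusion G F P) P A B" for A B
  proof (cases "subgroup A (normalizer_group G P) \<and> subgroup B (normalizer_group G P)")
    case False
    have "normalizer_fusion G F P A B = {}" using False by (auto simp: normalizer_fusion_def)
    moreover have "normalizer_fusion (normalizer_group G P) (normalizer_fusion G F P) P A B = {}"
      unfolding normalizer_fusion_def[of "normalizer_group G P" "normalizer_fusion G F P" P A B] nP
      using False by auto
    ultimately show ?thesis by simp
  next
    case True
    have A: "subgroup A G" "A \<subseteq> ?N" using True incl_subgroup[OF N] subgroup.subset by force+
    have B: "subgroup B G" "B \<subseteq> ?N" using True incl_subgroup[OF N] subgroup.subset by force+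
    have prodN: "subgroup (X <#> P) (normalizer_group G P)" if X: "subgroup X G" "X \<subseteq> ?N" for X
    proof (rule subgroup_incl[OF set_mult_normalized_subgroup[OF X(1) P X(2)] N])
      show "X <#> P \<subseteq> ?N" using X(2) PN subgroup.m_closed[OF N] by (force simp: set_mult_def)
    qed
    have sub: "A \<subseteq> A <#> P" "P \<subseteq> A <#> P" using set_mult_contains[OF A(1) P] .
    have NF1: "normalizer_fusion G F P A B = {restrict \<phi> A | \<phi>. \<phi> \<in> F (A <#> P) (B <#> P) \<and> \<phi> ` P = P \<and> \<phi> ` A \<subseteq> B}"
      using True by (simp add: normalizer_fusion_def)
    have NF2: "normalizer_fusion G F P (A <#> P) (B <#> P) =
        {restrict \<phi> (A <#> P) | \<phi>. \<phi> \<in> F (A <#> P) (B <#> P) \<and> \<phi> ` P = P \<and> \<phi> ` (A <#> P) \<subseteq> B <#> P}"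
      using prodN[OF A] prodN[OF B] set_mult_absorb(1)[OF A(1) P] set_mult_absorb(1)[OF B(1) P]
      by (simp add: normalizer_fusion_def)
    have NF3: "normalizer_fusion (normalizer_group G P) (normalizer_fusion G F P) P A B =
        {restrict \<phi> A | \<phi>. \<phi> \<in> normalizer_fusion G F P (A <#> P) (B <#> P) \<and> \<phi> ` P = P \<and> \<phi> ` A \<subseteq> B}"
      unfolding normalizer_fusion_def[of "normalizer_group G P" "normalizer_fusion G F P" P A B]
      using True by (simp add: nP)
    show ?thesis
    proof (rule Set.set_eqI, rule iffI)
      fix \<sigma> assume "\<sigma> \<in> normalizer_fusion G F P A B"
      then obtain \<phi> where \<phi>: "\<sigma> = restrict \<phi> A" "\<phi> \<in> F (A <#> P) (B <#> P)" "\<phi> ` P = P" "\<phi> ` A \<subseteq> B"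
        unfolding NF1 by blast
      have "\<phi> = restrict \<phi> (A <#> P)" using extensional_restrict[OF morI(5)[OF \<phi>(2)]] by simp
      then have "\<phi> \<in> normalizer_fusion G F P (A <#> P) (B <#> P)"
        unfolding NF2 using \<phi>(2,3) morI(4)[OF \<phi>(2)] by blast
      then show "\<sigma> \<in> normalizer_fusion (normalizer_group G P) (normalizer_fusion G F P) P A B"
        unfolding NF3 using \<phi> by blast
    next
      fix \<sigma> assume "\<sigma> \<in> normalizer_fusion (normalizer_group G P) (normalizer_fusion G F P) P A B"
      then obtain \<phi> where \<phi>: "\<sigma> = restrict \<phi> A" "\<phi> \<in> normalizer_fusion G F P (A <#> P) (B <#> P)"
        "\<phi> ` P = P" "\<phi> ` A \<subseteq> B"
        unfolding NF3 by blast
      then obtain \<phi>' where \<phi>': "\<phi> = restrict \<phi>' (A <#> P)" "\<phi>' \<in> F (A <#> P) (B <#> P)" "\<phi>' ` P = P"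
        unfolding NF2 by blast
      have "\<sigma> = restrict \<phi>' A" using \<phi>(1) \<phi>'(1) sub(1) by (simp add: Int_absorb1 restrict_restrict)
      moreover have "\<phi>' ` A \<subseteq> B" using \<phi>(4) \<phi>'(1) sub(1) by auto
      ultimately show "\<sigma> \<in> normalizer_fusion G F P A B"
        unfolding NF1 using \<phi>'(2,3) by blast
    qed
  qed
  then have "normalizer_fusion G F P = normalizer_fusion (normalizer_group G P) (normalizer_fusion G F P) P"
    by (intro ext) simp
  then show ?thesis using sP nP by (simp add: fus_normal_def)
qed

text \<open>
  P is normal in its own normalizer fusion system. If it is not the greatest normal subgroup, then
  some normal subgroup U is not contained in P, and R is P U. The automorphisms of P are morphisms
  of the normalizer fusion system, so they extend to P U by normality of U.
\<close>

lemma nonradical_overgroup: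
  assumes P: "subgroup P G" and nr: "P \<noteq> fus_core (normalizer_group G P) (normalizer_fusion G F P)"
  obtains R where "subgroup R G" "P \<subset> R" "R \<subseteq> normalizer G P" "normalizer G P \<subseteq> normalizer G R"
    "\<forall>\<alpha>. mor \<alpha> P \<and> \<alpha> ` P = P \<longrightarrow> (\<exists>\<beta>. mor \<beta> R \<and> \<beta> ` R = R \<and> (\<forall>x\<in>P. \<beta> x = \<alpha> x))"
proof -
  let ?N = "normalizer G P" and ?NG = "normalizer_group G P" and ?NF = "normalizer_fusion G F P"
  have N: "subgroup ?N G" using subgroup_normalizer'[OF P] .
  have PN: "P \<subseteq> ?N" using subset_normalizer[OF P] .
  have sP: "subgroup P ?NG" using subgroup_incl[OF P N PN] .
  have "\<exists>U. fus_normal ?NG ?NF U \<and> \<not> U \<subseteq> P"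
  proof (rule ccontr)
    assume "\<not> ?thesis"
    \<comment> \<open>If all normal subgroups were contained in P, then P would be the greatest one.\<close>
    then have "(GREATEST U. fus_normal ?NG ?NF U) = P"
      using normal_in_normalizer_fusion[OF P] by (intro Greatest_equality) blast+
    then show False using nr by (simp add: fus_core_def)
  qed
  then obtain U where U: "subgroup U ?NG" "normalizer ?NG U = ?N" "?NF = normalizer_fusion ?NG ?NF U" "\<not> U \<subseteq> P"
    by (auto simp: fus_normal_def)
  have UN: "U \<subseteq> ?N" using subgroup.subset[OF U(1)] by simp
  have sU: "subgroup U G" using incl_subgroup[OF N U(1)] .
  have Unorm: "?N \<subseteq> normalizer G U" using normalizer_in_normalizer[OF N UN] U(2) by blast
  let ?R = "P <#> U"
  have ext: "\<exists>\<phi>. subgroup ?R G \<and> ?R \<subseteq> ?N \<and> mor \<phi> ?R \<and> \<phi> ` U = U \<and> (\<forall>x\<in>P. \<phi> x = \<alpha> x)"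
    if \<alpha>: "mor \<alpha> P" "\<alpha> ` P = P" for \<alpha>
  proof -
    have "restrict \<alpha> P \<in> F (P <#> P) (P <#> P)" "restrict \<alpha> P ` P = P" using mor_mem[OF \<alpha>(1) P] set_mult_absorb(2)[OF P P] \<alpha>(2) by simp_all
    then have "restrict (restrict \<alpha> P) P \<in> ?NF P P" unfolding normalizer_fusion_def using sP by (auto intro!: exI[of _ "restrict \<alpha> P"])
    then have "restrict \<alpha> P \<in> normalizer_fusion ?NG ?NF U P P" using U(3) by simp
    then obtain \<phi> where \<phi>: "restrict \<alpha> P = restrict \<phi> P" "\<phi> \<in> ?NF ?R ?R" "\<phi> ` U = U"
      by (auto simp: normalizer_fusion_def[of ?NG ?NF U P P] split: if_splits)
    have sR: "subgroup ?R ?NG" using \<phi>(2) by (auto simp: normalizer_fusion_def split: if_splits)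
    then have R: "subgroup ?R G" "?R \<subseteq> ?N" using incl_subgroup[OF N sR] subgroup.subset[OF sR] by simp_all
    obtain \<phi>' where \<phi>': "\<phi> = restrict \<phi>' ?R" "\<phi>' \<in> F (?R <#> P) (?R <#> P)"
      using \<phi>(2) by (auto simp: normalizer_fusion_def split: if_splits)
    have "mor \<phi>' ?R" using mor_restrict[OF morI(1)[OF \<phi>'(2)] R(1) set_mult_contains(1)[OF R(1) P]] .
    moreover have "\<phi>' ` U = U"
    proof -
      have "\<phi>' ` U = \<phi> ` U" using \<phi>'(1) set_mult_contains(2)[OF P sU] by (intro image_cong) auto
      then show ?thesis using \<phi>(3) by simp
    qed
    moreover have "\<phi>' x = \<alpha> x" if x: "x \<in> P" for x
    proof -
      have "x \<in> ?R" using x set_mult_contains(1)[OF P sU] by blast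
      then show ?thesis using fun_cong[OF \<phi>(1), of x] x \<phi>'(1) by simp
    qed
    ultimately show ?thesis using R by blast
  qed
  have R: "subgroup ?R G" "?R \<subseteq> ?N" using ext[OF mor_id[OF P]] by auto
  have PR: "P \<subseteq> ?R" "U \<subseteq> ?R" using set_mult_contains[OF P sU] .
  show thesis
  proof (rule that[OF R(1) _ R(2)])
    show "P \<subset> ?R" using PR U(4) by blast
    show "?N \<subseteq> normalizer G ?R"
    proof
      fix t assume t: "t \<in> ?N"
      have tc: "t \<in> carrier G" using subgroup.mem_carrier[OF N t] .
      show "t \<in> normalizer G ?R"
      proof (rule normalizer_memI[OF R(1) finite_subgroup[OF R(1)] tc])
        fix r assume "r \<in> ?R"
        then obtain x u where xu: "x \<in> P" "u \<in> U" "r = x \<otimes> u" by (auto simp: set_mult_def)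
        have "gconj G t r = gconj G t x \<otimes> gconj G t u"
          using gconj_hom[OF tc subgroup.mem_carrier[OF P xu(1)] subgroup.mem_carrier[OF sU xu(2)]] xu(3) by simp
        moreover have "gconj G t x \<in> P" using normalizer_memD[OF P t xu(1)] .
        moreover have "gconj G t u \<in> U" using normalizer_memD[OF sU _ xu(2)] Unorm t by blast
        ultimately show "gconj G t r \<in> ?R" unfolding set_mult_def by blast
      qed
    qed
    show "\<forall>\<alpha>. mor \<alpha> P \<and> \<alpha> ` P = P \<longrightarrow> (\<exists>\<beta>. mor \<beta> ?R \<and> \<beta> ` ?R = ?R \<and> (\<forall>x\<in>P. \<beta> x = \<alpha> x))"
    proof (intro allI impI, elim conjE)
      fix \<alpha> assume \<alpha>: "mor \<alpha> P" "\<alpha> ` P = P"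
      obtain \<phi> where \<phi>: "mor \<phi> ?R" "\<phi> ` U = U" "\<forall>x\<in>P. \<phi> x = \<alpha> x" using ext[OF \<alpha>] by blast
      have "\<phi> r \<in> ?R" if r: "r \<in> ?R" for r
      proof -
        obtain x u where xu: "x \<in> P" "u \<in> U" "r = x \<otimes> u" using r by (auto simp: set_mult_def)
        have "\<phi> r = \<phi> x \<otimes> \<phi> u" using mor_mult[OF \<phi>(1), of x u] xu PR by blast
        moreover have "\<phi> x \<in> P" using \<phi>(3) xu(1) \<alpha>(2) by auto
        moreover have "\<phi> u \<in> U" using \<phi>(2) xu(2) by blast
        ultimately show ?thesis unfolding set_mult_def by blast
      qed
      then have "\<phi> ` ?R \<subseteq> ?R" by blast
      then have "\<phi> ` ?R = ?R" using endo_inj_surj[OF mor_finite[OF \<phi>(1)] _ mor_inj[OF \<phi>(1)]] by simp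
      then show "\<exists>\<beta>. mor \<beta> ?R \<and> \<beta> ` ?R = ?R \<and> (\<forall>x\<in>P. \<beta> x = \<alpha> x)" using \<phi>(1,3) by blast
    qed
  qed
qed

text \<open>
  Some conjugate of P does not contain its centralizer. It is carried to P by a morphism on its
  normalizer, which contains the centralizer, so P does not contain C(P) either.
\<close>

lemma noncentric_overgroup:
  assumes big: "\<And>Q. subgroup Q G \<Longrightarrow> card P < card Q \<Longrightarrow> saturated_at Q"
    and D: "fusion_generated D" and P: "subgroup P G" "P \<notin> D"
    and top: "\<And>f. mor f P \<Longrightarrow> normalizer_le (f ` P) P" and nc: "\<not> fus_centric G F P"
  obtains R where "subgroup R G" "P \<subset> R" "R \<subseteq> normalizer G P" "normalizer G P \<subseteq> normalizer G R"
    "\<forall>\<alpha>. mor \<alpha> P \<and> \<alpha> ` P = P \<longrightarrow> (\<exists>\<beta>. mor \<beta> R \<and> \<beta> ` R = R \<and> (\<forall>x\<in>P. \<beta> x = \<alpha> x))"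
proof -
  obtain Q where Q: "Q \<in> fus_conjugates F P" "\<not> centralizer G Q \<subseteq> Q"
    using nc by (auto simp: fus_centric_def)
  obtain g where g: "mor g P" "\<not> centralizer G (g ` P) \<subseteq> g ` P"
    using Q(1)[unfolded conjugates_iff] Q(2) by (elim exE conjE) simp
  let ?X = "g ` P"
  obtain \<psi> where \<psi>: "subgroup ?X G" "mor \<psi> (normalizer G ?X)" "\<psi> ` ?X = P"
    using top[OF g(1)] by (auto simp: normalizer_le_def)
  have CX: "c \<in> normalizer G ?X" if c: "c \<in> centralizer G ?X" for c
    using c centralizer_iff[OF subgroup.subset[OF \<psi>(1)]] normalizer_memI[OF \<psi>(1) finite_subgroup[OF \<psi>(1)], of c] by auto
  have XN: "?X \<subseteq> normalizer G ?X" using subset_normalizer[OF \<psi>(1)] .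
  have ncP: "\<not> centralizer G P \<subseteq> P"
  proof
    assume cP: "centralizer G P \<subseteq> P"
    have "c \<in> ?X" if c: "c \<in> centralizer G ?X" for c
    proof -
      have "gconj G (\<psi> c) y = y" if y: "y \<in> P" for y
      proof -
        obtain x where x: "x \<in> ?X" "y = \<psi> x" using y \<psi>(3) by blast
        have "gconj G c x = x" using c x(1) centralizer_iff[OF subgroup.subset[OF \<psi>(1)]] by blast
        then show ?thesis using mor_conj[OF \<psi>(2) CX[OF c], of x] x XN by auto
      qed
      moreover have "\<psi> c \<in> carrier G" using subgroup.mem_carrier[OF mor_subgroup(2)[OF \<psi>(2)]] CX[OF c] by blast
      ultimately have "\<psi> c \<in> P" using cP centralizer_iff[OF subgroup.subset[OF P(1)]] by blast
      then obtain x where x: "x \<in> ?X" "\<psi> c = \<psi> x" using \<psi>(3) by blast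
      then have "c = x" using inj_onD[OF mor_inj[OF \<psi>(2)] x(2) CX[OF c]] XN by blast
      then show ?thesis using x by simp
    qed
    then show False using g(2) by blast
  qed
  let ?R = "centralizer_product P P"
  have PN: "P \<subseteq> normalizer G P" using subset_normalizer[OF P(1)] .
  have R: "subgroup ?R G" using subgroup_centralizer_product[OF P(1) P(1) PN] .
  show thesis
  proof (rule that[OF R])
    show "P \<subset> ?R" using ncP subset_centralizer_product[OF P(1)] centralizer_subset_product[OF P(1) P(1)] by blast
    show "?R \<subseteq> normalizer G P" using centralizer_product_normalizes[OF P(1) P(1) PN] .
    show "normalizer G P \<subseteq> normalizer G ?R"
    proof
      fix t assume t: "t \<in> normalizer G P"
      then have tc: "t \<in> carrier G" "gconj G t ` P = P" using mem_normalizer_iff[OF subgroup.subset[OF P(1)]] by auto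
      have "gconj G t ` ?R = ?R" using mor_centralizer_product[OF mor_gconj[OF R tc(1)] P(1) tc(2)] .
      then show "t \<in> normalizer G ?R" using mem_normalizer_iff[OF subgroup.subset[OF R]] tc(1) by blast
    qed
    show "\<forall>\<alpha>. mor \<alpha> P \<and> \<alpha> ` P = P \<longrightarrow> (\<exists>\<beta>. mor \<beta> ?R \<and> \<beta> ` ?R = ?R \<and> (\<forall>x\<in>P. \<beta> x = \<alpha> x))"
    proof (intro allI impI, elim conjE)
      fix \<alpha> assume \<alpha>: "mor \<alpha> P" "\<alpha> ` P = P"
      obtain \<rho> where \<rho>: "mor \<rho> ?R" "\<forall>x\<in>P. \<rho> x = \<alpha> x"
        using automorphisms_extend_to_centralizer_product[OF big D P top \<alpha>] by blast
      have "\<rho> ` P = P"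
      proof -
        have "\<rho> ` P = \<alpha> ` P" using \<rho>(2) by (intro image_cong) auto
        then show ?thesis using \<alpha>(2) by simp
      qed
      then have "\<rho> ` ?R = ?R" using mor_centralizer_product[OF \<rho>(1) P(1)] by simp
      then show "\<exists>\<beta>. mor \<beta> ?R \<and> \<beta> ` ?R = ?R \<and> (\<forall>x\<in>P. \<beta> x = \<alpha> x)" using \<rho> by blast
    qed
  qed
qed

section \<open>Saturation from a generating family of subgroups\<close>

text \<open>
  By downward induction on the order. If P is not a member of D, then a conjugate of P with
  largest normalizer inherits the saturation condition from its overgroup R, which satisfies it by
  induction.
\<close>

theorem saturated_at_all:
  assumes D: "fusion_generated D" and sat: "\<And>P. P \<in> D \<Longrightarrow> saturated_at P"
    and cr: "centric_radicals G F \<subseteq> D"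
  shows "subgroup P G \<Longrightarrow> saturated_at P"
proof (induction "order G - card P" arbitrary: P rule: less_induct)
  case less
  note P = less.prems
  show ?case
  proof (cases "P \<in> D")
    case False
    have big: "saturated_at Q" if "subgroup Q G" "card P < card Q" for Q
    proof -
      have "card Q \<le> order G" using subgroup_card_le[OF that(1)] .
      then show ?thesis using less.hyps[OF _ that(1)] that(2) by simp
    qed
    obtain f where f: "mor f P" "\<forall>g. mor g P \<longrightarrow> card (normalizer G (g ` P)) \<le> card (normalizer G (f ` P))"
      by (rule largest_normalizer_in_class[OF P])
    let ?Q = "f ` P"
    have Q: "subgroup ?Q G" "?Q \<notin> D" using mor_subgroup(2)[OF f(1)] outside_image[OF D P False f(1)] .
    have cQ: "card ?Q = card P" using mor_card[OF f(1)] .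
    have big': "saturated_at R" if "subgroup R G" "card ?Q < card R" for R using big that cQ by simp
    have fn: "fully_normalized G F ?Q"
      unfolding fully_normalized_def
    proof
      fix X assume "X \<in> fus_conjugates F ?Q"
      then obtain g where g: "mor g ?Q" "X = g ` ?Q" unfolding conjugates_iff by (elim exE conjE)
      have "mor (g \<circ> f) P" using mor_comp[OF f(1) g(1)] by simp
      moreover have "(g \<circ> f) ` P = X" using g(2) by (simp only: image_comp)
      ultimately show "card (normalizer G X) \<le> card (normalizer G ?Q)" using f(2)[rule_format, of "g \<circ> f"] by simp
    qed
    note top = fully_normalized_is_top[OF big' D Q fn]
    obtain R where R: "subgroup R G" "?Q \<subset> R" "R \<subseteq> normalizer G ?Q" "normalizer G ?Q \<subseteq> normalizer G R"
      "\<forall>\<alpha>. mor \<alpha> ?Q \<and> \<alpha> ` ?Q = ?Q \<longrightarrow> (\<exists>\<beta>. mor \<beta> R \<and> \<beta> ` R = R \<and> (\<forall>x\<in>?Q. \<beta> x = \<alpha> x))"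
    proof (cases "fus_centric G F ?Q")
      case False
      show thesis by (rule noncentric_overgroup[OF big' D Q top False]; (assumption | (rule that; assumption)))
    next
      case True
      have "?Q \<in> fus_conjugates F ?Q" using mor_id[OF Q(1)] conjugates_iff by fastforce
      then have "?Q \<noteq> fus_core (normalizer_group G ?Q) (normalizer_fusion G F ?Q)"
        using cr Q True fn by (auto simp: centric_radicals_def fus_radical_def)
      then show thesis by (rule nonradical_overgroup[OF Q(1)]) (rule that)
    qed
    have "card ?Q < card R" using psubset_card_mono[OF finite_subgroup[OF R(1)] R(2)] .
    then have satR: "saturated_at R" using big'[OF R(1)] by simp
    have QR: "?Q \<subseteq> R" using R(2) by blast
    note ext = R(5)[rule_format, OF conjI]
    have "fully_automized p G F ?Q"
      by (rule fully_automized_from_overgroup[OF Q(1) top R(1) satR QR R(3,4) ext])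
    moreover have "receptive G F ?Q"
      by (rule receptive_from_overgroup[OF Q(1) top R(1) satR QR R(3,4) ext])
    ultimately show ?thesis using f(1) unfolding saturated_at_def by blast
  qed (rule sat)
qed

corollary saturated_from_generating_family:
  assumes "fusion_generated D" "\<And>P. P \<in> D \<Longrightarrow> saturated_at P" "centric_radicals G F \<subseteq> D"
  shows "saturated_fusion_system p G F"
proof unfold_locales
  fix P assume "subgroup P G"
  then obtain f where "mor f P" "fully_automized p G F (f ` P)" "receptive G F (f ` P)"
    using saturated_at_all[OF assms] unfolding saturated_at_def by blast
  then show "\<exists>Q\<in>fus_conjugates F P. fully_automized p G F Q \<and> receptive G F Q"
    using conjugates_iff by blast
qed

end

section \<open>Words in a partial group\<close>

context partial_group
begin

abbreviation winv :: "'a list \<Rightarrow> 'a list"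
  where "winv w \<equiv> rev (map (pinv L) w)"

abbreviation pone :: 'a
  where "pone \<equiv> wprod L []"

lemma words_carrier: "w \<in> words L \<Longrightarrow> set w \<subseteq> carrier L"
  using words_subset by auto

lemma winv_winv: "set w \<subseteq> carrier L \<Longrightarrow> winv (winv w) = w"
  by (induction w) (auto simp: pinv_pinv)

lemma words_prefix: "u @ v \<in> words L \<Longrightarrow> u \<in> words L"
  and words_suffix: "u @ v \<in> words L \<Longrightarrow> v \<in> words L"
  using words_split by blast+

lemma words_factor: "u @ v @ w \<in> words L \<Longrightarrow> v \<in> words L"
  using words_split by blast

lemma winv_words: "w \<in> words L \<Longrightarrow> winv w \<in> words L"
  using words_inverse words_prefix by blast

lemma words_inverse': "w \<in> words L \<Longrightarrow> w @ winv w \<in> words L"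
  and wprod_inverse': "w \<in> words L \<Longrightarrow> wprod L (w @ winv w) = pone"
  using words_inverse[OF winv_words] wprod_inverse[OF winv_words] winv_winv[OF words_carrier] by metis+

lemma nil_words: "[] \<in> words L"
  using carrier_nonempty singleton_word words_prefix[of "[]"] by fastforce

lemma pone_closed: "pone \<in> carrier L"
  using wprod_closed nil_words by blast

lemma pone_insert: "u @ w \<in> words L \<Longrightarrow> u @ [pone] @ w \<in> words L"
  using words_contract[of u "[]" w] by simp

lemma wprod_pone: "u @ w \<in> words L \<Longrightarrow> wprod L (u @ [pone] @ w) = wprod L (u @ w)"
  using wprod_contract[of u "[]" w] by simp

lemma wprod_cong:
  assumes "u @ v @ w \<in> words L" "u @ v' @ w \<in> words L" "wprod L v = wprod L v'"
  shows "wprod L (u @ v @ w) = wprod L (u @ v' @ w)"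
  using wprod_contract[OF assms(1)] wprod_contract[OF assms(2)] assms(3) by simp

lemma wprod_delete:
  assumes "u @ v @ w \<in> words L" "wprod L v = pone" "u @ w \<in> words L"
  shows "wprod L (u @ v @ w) = wprod L (u @ w)"
  using wprod_cong[of u v w "[]"] assms by simp

lemma pinv_words: "g \<in> carrier L \<Longrightarrow> [pinv L g, g] \<in> words L"
  and wprod_pinv: "g \<in> carrier L \<Longrightarrow> wprod L [pinv L g, g] = pone"
  and wprod_pinv': "g \<in> carrier L \<Longrightarrow> wprod L [g, pinv L g] = pone"
  using words_inverse[OF singleton_word, of g] wprod_inverse[OF singleton_word, of g]
    wprod_inverse'[OF singleton_word, of g] by simp_all

text \<open>
  The word \<open>[pinv L h, h, g]\<close> is evaluated in two ways.
\<close>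

lemma left_inverse_unique:
  assumes "[h, g] \<in> words L" "wprod L [h, g] = pone"
  shows "h = pinv L g"
proof -
  have hg: "h \<in> carrier L" "g \<in> carrier L" using words_carrier[OF assms(1)] by auto
  have w: "[pinv L h, h, g] \<in> words L"
    using words_suffix[of "[pinv L g]" "[pinv L h, h, g]"] words_inverse[OF assms(1)] by simp
  have "wprod L [pinv L h, h, g] = pinv L h"
    using wprod_delete[of "[pinv L h]" "[h, g]" "[]"] w assms(2) singleton_word[OF pinv_closed[OF hg(1)]]
      wprod_singleton[OF pinv_closed[OF hg(1)]] by simp
  moreover have "wprod L [pinv L h, h, g] = g"
    using wprod_delete[of "[]" "[pinv L h, h]" "[g]"] w wprod_pinv[OF hg(1)] singleton_word[OF hg(2)]
      wprod_singleton[OF hg(2)] by simp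
  ultimately show ?thesis using pinv_pinv[OF hg(1)] by simp
qed

lemma wprod_winv:
  assumes w: "w \<in> words L"
  shows "wprod L (winv w) = pinv L (wprod L w)"
proof (rule left_inverse_unique)
  have ww: "winv w @ w \<in> words L" using words_inverse[OF w] .
  have 1: "[wprod L (winv w)] @ w \<in> words L" using words_contract[of "[]" "winv w" w] ww by simp
  then show "[wprod L (winv w), wprod L w] \<in> words L" using words_contract[of "[wprod L (winv w)]" w "[]"] by simp
  have "wprod L [wprod L (winv w), wprod L w] = wprod L ([wprod L (winv w)] @ w)"
    using wprod_contract[of "[wprod L (winv w)]" w "[]"] 1 by simp
  also have "\<dots> = pone" using wprod_contract[of "[]" "winv w" w] ww wprod_inverse[OF w] by simp
  finally show "wprod L [wprod L (winv w), wprod L w] = pone" .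
qed

lemma pinv_pone: "pinv L pone = pone"
  using wprod_winv[OF nil_words] by simp

lemma conj_dom_words: "x \<in> conj_dom L g \<Longrightarrow> [pinv L g, x, g] \<in> words L"
  by (simp add: conj_dom_def)

lemma conj_domI: "[pinv L g, x, g] \<in> words L \<Longrightarrow> x \<in> conj_dom L g"
  using words_carrier[of "[pinv L g, x, g]"] by (simp add: conj_dom_def)

lemma conj_dom_pone: "x \<in> carrier L \<Longrightarrow> x \<in> conj_dom L pone"
  and pconj_pone: "x \<in> carrier L \<Longrightarrow> pconj L pone x = x"
proof -
  assume x: "x \<in> carrier L"
  have w: "[x, pone] \<in> words L" using pone_insert[of "[x]" "[]"] singleton_word[OF x] by simp
  then have "[pone, x, pone] \<in> words L" using pone_insert[of "[]" "[x, pone]"] by simp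
  then show "x \<in> conj_dom L pone" by (intro conj_domI) (simp add: pinv_pone)
  have "wprod L [pone, x, pone] = wprod L [x, pone]" using wprod_pone[of "[]" "[x, pone]"] w by simp
  also have "\<dots> = x" using wprod_pone[of "[x]" "[]"] singleton_word[OF x] wprod_singleton[OF x] by simp
  finally show "pconj L pone x = x" by (simp add: pconj_def pinv_pone)
qed

text \<open>
  Multiply the word \<open>[pinv L g, x, g]\<close> from the right by its inverse and keep the
  first four letters; multiply these from the left by their inverse and keep the last five.
\<close>

lemma conj_dom_extended:
  assumes g: "g \<in> carrier L" and x: "x \<in> conj_dom L g"
  shows "[g, pinv L g, x, g, pinv L g] \<in> words L"
proof -
  have w: "[pinv L g, x, g] \<in> words L" using conj_dom_words[OF x] .
  have "[pinv L g, x, g, pinv L g] \<in> words L"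
    using words_prefix[of "[pinv L g, x, g, pinv L g]" "[pinv L x, g]"] words_inverse'[OF w] pinv_pinv[OF g] by simp
  then have "[g, pinv L g, pinv L x, g, pinv L g, x, g, pinv L g] \<in> words L"
    using words_inverse[of "[pinv L g, x, g, pinv L g]"] pinv_pinv[OF g] by simp
  then show ?thesis using words_suffix[of "[g, pinv L g, pinv L x]" "[g, pinv L g, x, g, pinv L g]"] by simp
qed

lemma pconj_pinv:
  assumes g: "g \<in> carrier L" and x: "x \<in> conj_dom L g"
  shows "pconj L g x \<in> conj_dom L (pinv L g)" "pconj L (pinv L g) (pconj L g x) = x"
proof -
  have xc: "x \<in> carrier L" using x by (simp add: conj_dom_def)
  have w: "[g] @ [pinv L g, x, g] @ [pinv L g] \<in> words L" using conj_dom_extended[OF assms] by simp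
  have "[g, pconj L g x, pinv L g] \<in> words L" using words_contract[OF w] by (simp add: pconj_def)
  then show "pconj L g x \<in> conj_dom L (pinv L g)" by (intro conj_domI) (simp add: pinv_pinv[OF g])
  have xg: "[x, g, pinv L g] \<in> words L" using words_suffix[of "[g, pinv L g]" "[x, g, pinv L g]"] w by simp
  have "pconj L (pinv L g) (pconj L g x) = wprod L ([g] @ [pinv L g, x, g] @ [pinv L g])"
    using wprod_contract[OF w] by (simp add: pconj_def pinv_pinv[OF g])
  also have "\<dots> = wprod L [x, g, pinv L g]"
    using wprod_delete[of "[]" "[g, pinv L g]" "[x, g, pinv L g]"] w xg wprod_pinv'[OF g] by simp
  also have "\<dots> = x"
    using wprod_delete[of "[x]" "[g, pinv L g]" "[]"] xg wprod_pinv'[OF g] singleton_word[OF xc] wprod_singleton[OF xc] by simp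
  finally show "pconj L (pinv L g) (pconj L g x) = x" .
qed

lemma pconj_inj: "g \<in> carrier L \<Longrightarrow> inj_on (pconj L g) (conj_dom L g)"
  using pconj_pinv(2) by (metis inj_onI)

lemma pconj_minv:
  assumes g: "g \<in> carrier L" and x: "x \<in> conj_dom L g"
  shows "pinv L x \<in> conj_dom L g" "pconj L g (pinv L x) = pinv L (pconj L g x)"
proof -
  have w: "[pinv L g, x, g] \<in> words L" using conj_dom_words[OF x] .
  have "winv [pinv L g, x, g] = [pinv L g, pinv L x, g]" using pinv_pinv[OF g] by simp
  then show "pinv L x \<in> conj_dom L g" "pconj L g (pinv L x) = pinv L (pconj L g x)"
    using winv_words[OF w] wprod_winv[OF w] by (auto intro: conj_domI simp: pconj_def)
qed

lemma pconj_one: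
  assumes g: "g \<in> carrier L"
  shows "pone \<in> conj_dom L g" "pconj L g pone = pone"
proof -
  have "[pinv L g, pone, g] \<in> words L" using pone_insert[of "[pinv L g]" "[g]"] pinv_words[OF g] by simp
  then show "pone \<in> conj_dom L g" by (rule conj_domI)
  show "pconj L g pone = pone"
    using wprod_pone[of "[pinv L g]" "[g]"] pinv_words[OF g] wprod_pinv[OF g] by (simp add: pconj_def)
qed

text \<open>
  The word in the hypothesis is contracted in the middle to obtain the conjugate of the product,
  and in its two halves to obtain the product of the conjugates.
\<close>

lemma pconj_product:
  assumes g: "g \<in> carrier L" and w: "[pinv L g, x, g, pinv L g, y, g] \<in> words L"
  shows "wprod L [x, y] \<in> conj_dom L g" "pconj L g (wprod L [x, y]) = wprod L [pconj L g x, pconj L g y]"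
proof -
  have w1: "[pinv L g, x, pone, y, g] \<in> words L"
    using words_contract[of "[pinv L g, x]" "[g, pinv L g]" "[y, g]"] w wprod_pinv'[OF g] by simp
  have xpy: "[x, pone, y] \<in> words L" using words_factor[of "[pinv L g]" "[x, pone, y]" "[g]"] w1 by simp
  have xc: "x \<in> carrier L" using words_carrier[OF xpy] by auto
  have "wprod L [x, pone] = x" using wprod_pone[of "[x]" "[]"] singleton_word[OF xc] wprod_singleton[OF xc] by simp
  then have e: "wprod L [x, pone, y] = wprod L [x, y]" using wprod_contract[of "[]" "[x, pone]" "[y]"] xpy by simp
  have 1: "[pinv L g, wprod L [x, y], g] \<in> words L"
    "wprod L [pinv L g, x, pone, y, g] = wprod L [pinv L g, wprod L [x, y], g]"
    using words_contract[of "[pinv L g]" "[x, pone, y]" "[g]"] wprod_contract[of "[pinv L g]" "[x, pone, y]" "[g]"] w1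
    unfolding e by simp_all
  from 1(1) show "wprod L [x, y] \<in> conj_dom L g" by (rule conj_domI)
  have w2: "[pconj L g x, pinv L g, y, g] \<in> words L"
    using words_contract[of "[]" "[pinv L g, x, g]" "[pinv L g, y, g]"] w by (simp add: pconj_def)
  have "pconj L g (wprod L [x, y]) = wprod L [pinv L g, x, g, pinv L g, y, g]"
    using 1(2) wprod_contract[of "[pinv L g, x]" "[g, pinv L g]" "[y, g]"] w wprod_pinv'[OF g]
    by (simp add: pconj_def)
  also have "\<dots> = wprod L [pconj L g x, pinv L g, y, g]"
    using wprod_contract[of "[]" "[pinv L g, x, g]" "[pinv L g, y, g]"] w by (simp add: pconj_def)
  also have "\<dots> = wprod L [pconj L g x, pconj L g y]"
    using wprod_contract[of "[pconj L g x]" "[pinv L g, y, g]" "[]"] w2 by (simp add: pconj_def)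
  finally show "pconj L g (wprod L [x, y]) = wprod L [pconj L g x, pconj L g y]" .
qed

lemma wprod_conj_word:
  "winv w @ [x] @ w \<in> words L \<Longrightarrow> wprod L (winv w @ [x] @ w) = fold (pconj L) w x"
proof (induction w arbitrary: x)
  case Nil
  then show ?case using wprod_singleton words_carrier[of "[x]"] by simp
next
  case (Cons g w)
  have w: "winv w @ [pinv L g, x, g] @ w \<in> words L" using Cons.prems by simp
  have w': "winv w @ [pconj L g x] @ w \<in> words L" using words_contract[OF w] by (simp add: pconj_def)
  have "wprod L (winv w @ [pinv L g, x, g] @ w) = wprod L (winv w @ [pconj L g x] @ w)"
    using wprod_contract[OF w] by (simp add: pconj_def)
  then show ?case using Cons.IH[OF w'] by simp
qed

lemma pconj_wprod:
  assumes w: "winv w @ [x] @ w \<in> words L"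
  shows "x \<in> conj_dom L (wprod L w)" "pconj L (wprod L w) x = fold (pconj L) w x"
proof -
  have ww: "w \<in> words L" using words_suffix[of "winv w @ [x]" w] w by simp
  have w1: "[pinv L (wprod L w), x] @ w \<in> words L"
    using words_contract[of "[]" "winv w" "[x] @ w"] w wprod_winv[OF ww] by simp
  then have "[pinv L (wprod L w), x, wprod L w] \<in> words L"
    using words_contract[of "[pinv L (wprod L w), x]" w "[]"] by simp
  then show "x \<in> conj_dom L (wprod L w)" by (rule conj_domI)
  have "pconj L (wprod L w) x = wprod L ([pinv L (wprod L w), x] @ w)"
    using wprod_contract[of "[pinv L (wprod L w), x]" w "[]"] w1 by (simp add: pconj_def)
  also have "\<dots> = wprod L (winv w @ [x] @ w)"
    using wprod_contract[of "[]" "winv w" "[x] @ w"] w wprod_winv[OF ww] by simp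
  finally show "pconj L (wprod L w) x = fold (pconj L) w x" using wprod_conj_word[OF w] by simp
qed

subsection \<open>Subgroups of a partial group\<close>

lemma pg_subgroup_closed:
  assumes "pg_subgroup H L"
  shows "H \<subseteq> carrier L" "lists H \<subseteq> words L" "\<And>w. w \<in> lists H \<Longrightarrow> wprod L w \<in> H" "\<And>h. h \<in> H \<Longrightarrow> pinv L h \<in> H"
  using assms by (auto simp: pg_subgroup_def partial_subgroup_def)

lemma grp_of_simps:
  "carrier (grp_of L H) = H" "\<one>\<^bsub>grp_of L H\<^esub> = pone" "x \<otimes>\<^bsub>grp_of L H\<^esub> y = wprod L [x, y]"
  by (simp_all add: grp_of_def)

lemma grp_of_restrict: "(grp_of L H)\<lparr>carrier := K\<rparr> = grp_of L K"
  by (simp add: grp_of_def)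

lemma group_grp_of:
  assumes H: "pg_subgroup H L"
  shows "group (grp_of L H)"
proof (rule groupI; unfold grp_of_simps)
  note c = pg_subgroup_closed[OF H]
  show "pone \<in> H" using c(3)[of "[]"] by simp
  fix x assume x: "x \<in> H"
  have xc: "x \<in> carrier L" using x c(1) by blast
  show "wprod L [pone, x] = x"
    using wprod_pone[of "[]" "[x]"] singleton_word[OF xc] wprod_singleton[OF xc] by simp
  show "\<exists>y\<in>H. wprod L [y, x] = pone" using c(4)[OF x] wprod_pinv[OF xc] by blast
  fix y assume y: "y \<in> H"
  show "wprod L [x, y] \<in> H" using c(3)[of "[x, y]"] x y by simp
  fix z assume z: "z \<in> H"
  have "[x, y, z] \<in> words L" using c(2) x y z by auto
  then show "wprod L [wprod L [x, y], z] = wprod L [x, wprod L [y, z]]"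
    using wprod_contract[of "[]" "[x, y]" "[z]"] wprod_contract[of "[x]" "[y, z]" "[]"] by simp
qed

lemma inv_grp_of:
  assumes H: "pg_subgroup H L" and x: "x \<in> H"
  shows "inv\<^bsub>grp_of L H\<^esub> x = pinv L x"
proof -
  interpret group "grp_of L H" using group_grp_of[OF H] .
  note c = pg_subgroup_closed[OF H]
  have "x \<in> carrier L" using x c(1) by blast
  then show ?thesis using inv_equality[of "pinv L x" x] x c(4)[OF x] by (simp add: grp_of_simps wprod_pinv)
qed

lemma gconj_grp_of:
  assumes H: "pg_subgroup H L" and x: "g \<in> H" "x \<in> H"
  shows "gconj (grp_of L H) g x = pconj L g x" "x \<in> conj_dom L g"
proof -
  note c = pg_subgroup_closed[OF H]
  have w: "[pinv L g, x, g] \<in> words L" using c(2) c(4)[OF x(1)] x by auto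
  then show "x \<in> conj_dom L g" by (rule conj_domI)
  show "gconj (grp_of L H) g x = pconj L g x"
    using wprod_contract[of "[]" "[pinv L g, x]" "[g]"] w
    by (simp add: gconj_def pconj_def inv_grp_of[OF H x(1)] grp_of_simps)
qed

lemma pg_subgroup_subgroup:
  assumes H: "pg_subgroup H L" and K: "subgroup K (grp_of L H)"
  shows "pg_subgroup K L"
proof -
  note c = pg_subgroup_closed[OF H]
  have KH: "K \<subseteq> H" using subgroup.subset[OF K] by (simp add: grp_of_simps)
  have prod: "wprod L w \<in> K" if "w \<in> lists K" for w
    using that
  proof (induction w)
    case Nil
    then show ?case using subgroup.one_closed[OF K] by (simp add: grp_of_simps)
  next
    case (Cons x w)
    then have "wprod L [x, wprod L w] \<in> K" using subgroup.m_closed[OF K, of x "wprod L w"] by (simp add: grp_of_simps)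
    moreover have "x # w \<in> lists H" using Cons.hyps KH lists_mono[OF KH] by auto
    then have "x # w \<in> words L" using c(2) by blast
    ultimately show ?case using wprod_contract[of "[x]" w "[]"] by simp
  qed
  have "pinv L h \<in> K" if "h \<in> K" for h
    using subgroup.m_inv_closed[OF K that] inv_grp_of[OF H] that KH by auto
  moreover have "lists K \<subseteq> words L" using lists_mono[OF KH] c(2) by blast
  moreover have "K \<noteq> {}" "K \<subseteq> carrier L" using subgroup.one_closed[OF K] KH c(1) by blast+
  ultimately show ?thesis
    using prod by (auto simp: pg_subgroup_def partial_subgroup_def)
qed

end

section \<open>Words and objects in a locality\<close>

context locality
begin

abbreviation GS :: "'a monoid"
  where "GS \<equiv> grp_of L S"

lemma S_subgroup: "pg_subgroup S L"
  using S_p_subgroup by (simp add: pg_p_subgroup_def)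

sublocale GS: group GS
  using group_grp_of[OF S_subgroup] .

lemma carrier_GS: "carrier GS = S"
  by (simp add: grp_of_simps)

lemma S_carrier: "S \<subseteq> carrier L"
  using pg_subgroup_closed(1)[OF S_subgroup] .

lemma finite_S: "finite S"
  using S_carrier finite_carrier finite_subset by blast

lemma object_subset: "P \<in> \<Delta> \<Longrightarrow> P \<subseteq> S"
  using objects_subgroups subgroup.subset[of P GS] by (simp add: carrier_GS)

lemma object_closed:
  assumes X: "X \<in> \<Delta>" and g: "g \<in> carrier L" "X \<subseteq> conj_dom L g"
    and s: "subgroup (pconj L g ` X) GS" and Y: "subgroup Y GS" "pconj L g ` X \<subseteq> Y"
  shows "Y \<in> \<Delta>"
proof (rule objects_closed[OF X S_object g _ Y(1)])
  show "subgroup (pconj L g ` X) (grp_of L Y)"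
    using GS.subgroup_incl[OF s Y] by (simp add: grp_of_restrict)
qed

lemma overgroup_object:
  assumes X: "X \<in> \<Delta>" and Y: "subgroup Y GS" "X \<subseteq> Y"
  shows "Y \<in> \<Delta>"
proof -
  have Xc: "x \<in> carrier L" if "x \<in> X" for x using that object_subset[OF X] S_carrier by blast
  have "pconj L pone ` X = X" using pconj_pone[OF Xc] by simp
  then show ?thesis
    using object_closed[OF X pone_closed _ _ Y(1)] objects_subgroups[OF X] Y(2) conj_dom_pone[OF Xc] by auto
qed

text \<open>
  X can be conjugated by the letters of w one after the other within the set of objects. By the
  first axiom of a locality, this holds for some X if and only if w has a product.
\<close>

fun via :: "'a set \<Rightarrow> 'a list \<Rightarrow> bool"
  where
    "via X [] \<longleftrightarrow> X \<in> \<Delta>"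
  | "via X (g # w) \<longleftrightarrow> X \<in> \<Delta> \<and> g \<in> carrier L \<and> X \<subseteq> conj_dom L g \<and> via (pconj L g ` X) w"

lemma via_object: "via X w \<Longrightarrow> X \<in> \<Delta>"
  by (cases w) auto

lemma via_append: "via X (u @ v) \<longleftrightarrow> via X u \<and> via (fold (pconj L) u ` X) v"
  by (induction u arbitrary: X) (auto simp: via_object image_comp)

lemma via_end: "via X w \<Longrightarrow> fold (pconj L) w ` X \<in> \<Delta>"
  using via_append[of X w "[]"] by simp

lemma via_carrier: "via X w \<Longrightarrow> set w \<subseteq> carrier L"
  by (induction w arbitrary: X) auto

lemma via_words:
  assumes "via X w"
  shows "w \<in> words L"
proof -
  have main: "via X w \<Longrightarrow> \<exists>Y. Y 0 = X \<and> (\<forall>i\<le>length w. Y i \<in> \<Delta>) \<and>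
      (\<forall>i<length w. Y i \<subseteq> conj_dom L (w ! i) \<and> pconj L (w ! i) ` Y i = Y (Suc i))" for X
  proof (induction w arbitrary: X)
    case Nil
    then show ?case by (intro exI[of _ "\<lambda>_. X"]) simp
  next
    case (Cons g w)
    have v: "via (pconj L g ` X) w" using Cons.prems by simp
    obtain Y where Y: "Y 0 = pconj L g ` X" "\<forall>i\<le>length w. Y i \<in> \<Delta>"
      "\<forall>i<length w. Y i \<subseteq> conj_dom L (w ! i) \<and> pconj L (w ! i) ` Y i = Y (Suc i)" using Cons.IH[OF v] by (elim exE conjE) (rule that)
    show ?case
    proof (intro exI[of _ "case_nat X Y"] conjI allI impI)
      fix i
      show "case_nat X Y i \<in> \<Delta>" if "i \<le> length (g # w)" using that Cons.prems Y(2) by (cases i) auto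
      assume i: "i < length (g # w)"
      show "case_nat X Y i \<subseteq> conj_dom L ((g # w) ! i)" using i Cons.prems Y(3) by (cases i) auto
      show "pconj L ((g # w) ! i) ` case_nat X Y i = case_nat X Y (Suc i)" using i Cons.prems Y(1,3) by (cases i) auto
    qed simp
  qed
  have c: "w \<in> lists (carrier L)" using via_carrier[OF assms] by auto
  show ?thesis unfolding words_iff[OF c] using main[OF assms] by (elim exE conjE) (intro exI conjI)
qed

lemma words_via:
  assumes "w \<in> words L"
  shows "\<exists>X. via X w"
proof -
  have c: "w \<in> lists (carrier L)" using words_subset assms by blast
  have main: "w \<in> lists (carrier L) \<Longrightarrow> (\<forall>i\<le>length w. Y i \<in> \<Delta>) \<Longrightarrow>
      (\<forall>i<length w. Y i \<subseteq> conj_dom L (w ! i) \<and> pconj L (w ! i) ` Y i = Y (Suc i)) \<Longrightarrow> via (Y 0) w" for Y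
  proof (induction w arbitrary: Y)
    case (Cons g w)
    have "Y (Suc i) \<subseteq> conj_dom L (w ! i) \<and> pconj L (w ! i) ` Y (Suc i) = Y (Suc (Suc i))" if "i < length w" for i
      using Cons.prems(3)[rule_format, of "Suc i"] that by simp
    then have "via (Y (Suc 0)) w" using Cons.IH[of "\<lambda>i. Y (Suc i)"] Cons.prems(1,2) by auto
    then show ?case using Cons.prems by force
  qed simp
  obtain Y where "\<forall>i\<le>length w. Y i \<in> \<Delta>"
    "\<forall>i<length w. Y i \<subseteq> conj_dom L (w ! i) \<and> pconj L (w ! i) ` Y i = Y (Suc i)"
    using assms[unfolded words_iff[OF c]] by (elim exE conjE)
  then have "via (Y 0) w" by (rule main[OF c])
  then show ?thesis by (rule exI)
qed

lemma via_inverse_step: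
  assumes "via X [g]"
  shows "via (pconj L g ` X) [pinv L g]" "pconj L (pinv L g) ` pconj L g ` X = X"
proof -
  have g: "g \<in> carrier L" "X \<subseteq> conj_dom L g" "X \<in> \<Delta>" "pconj L g ` X \<in> \<Delta>" using assms by auto
  show im: "pconj L (pinv L g) ` pconj L g ` X = X"
    unfolding image_image using pconj_pinv(2)[OF g(1)] g(2) by (auto simp: subset_iff image_def)
  show "via (pconj L g ` X) [pinv L g]"
    using g pconj_pinv(1)[OF g(1)] im by (auto simp: pinv_closed)
qed

lemma via_winv:
  assumes "via X w"
  shows "via (fold (pconj L) w ` X) (winv w)" "fold (pconj L) (winv w) ` fold (pconj L) w ` X = X"
proof -
  have "via X w \<Longrightarrow> via (fold (pconj L) w ` X) (winv w) \<and> fold (pconj L) (winv w) ` fold (pconj L) w ` X = X"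
  proof (induction w arbitrary: X)
    case (Cons g w)
    have g: "via X [g]" using Cons.prems via_object by auto
    let ?Y = "pconj L g ` X"
    have IH: "via (fold (pconj L) w ` ?Y) (winv w)" "fold (pconj L) (winv w) ` fold (pconj L) w ` ?Y = ?Y"
      using Cons.IH Cons.prems by auto
    have e: "fold (pconj L) (g # w) ` X = fold (pconj L) w ` ?Y" by (simp only: fold_Cons image_comp)
    have "via (fold (pconj L) w ` ?Y) (winv w @ [pinv L g])"
      unfolding via_append using IH via_inverse_step(1)[OF g] by simp
    moreover have "fold (pconj L) (winv w @ [pinv L g]) ` fold (pconj L) w ` ?Y = X"
      using IH(2) via_inverse_step(2)[OF g] by (simp only: fold_append fold_Cons fold_Nil id_comp comp_id image_comp[symmetric] image_id o_id id_o)
    ultimately show ?case unfolding e by simp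
  qed (auto simp: image_id)
  then show "via (fold (pconj L) w ` X) (winv w)" "fold (pconj L) (winv w) ` fold (pconj L) w ` X = X"
    using assms by blast+
qed

lemma via_normalizer: "X \<in> \<Delta> \<Longrightarrow> x \<in> pg_normalizer L X \<Longrightarrow> via X [x]"
  by (simp add: pg_normalizer_def)

text \<open>
  The chain of objects for w is run through backwards from its end to X, then x fixes X, and the
  chain is run through forwards.
\<close>

lemma via_conj_word:
  assumes w: "via X w" and x: "x \<in> pg_normalizer L X"
  shows "winv w @ [x] @ w \<in> words L"
proof -
  have "pconj L x ` X = X" using x by (simp add: pg_normalizer_def)
  then have "via (fold (pconj L) w ` X) (winv w @ [x] @ w)"
    unfolding via_append using via_winv[OF w] via_normalizer[OF via_object[OF w] x] w by simp
  then show ?thesis by (rule via_words)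
qed

lemma via_pconj:
  assumes w: "via X w" and x: "x \<in> pg_normalizer L X"
  shows "x \<in> conj_dom L (wprod L w)" "pconj L (wprod L w) x = fold (pconj L) w x"
  using pconj_wprod[OF via_conj_word[OF assms]] .

lemma object_normalizes:
  assumes X: "X \<in> \<Delta>"
  shows "X \<subseteq> pg_normalizer L X" "S \<inter> pg_normalizer L X = normalizer GS X"
proof -
  have XS: "X \<subseteq> S" using object_subset[OF X] .
  show e: "S \<inter> pg_normalizer L X = normalizer GS X"
  proof (rule Set.set_eqI)
    fix s
    have "X \<subseteq> conj_dom L s \<and> pconj L s ` X = gconj GS s ` X \<and> s \<in> carrier L" if s: "s \<in> S"
    proof -
      have "x \<in> conj_dom L s \<and> pconj L s x = gconj GS s x" if "x \<in> X" for x
        using gconj_grp_of[OF S_subgroup s] that XS by auto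
      then show ?thesis using s S_carrier by (auto intro!: image_cong)
    qed
    then show "s \<in> S \<inter> pg_normalizer L X \<longleftrightarrow> s \<in> normalizer GS X"
      using GS.mem_normalizer_iff[of X s] XS by (simp add: carrier_GS pg_normalizer_def cong: conj_cong)
  qed
  show "X \<subseteq> pg_normalizer L X" using GS.subset_normalizer[OF objects_subgroups[OF X]] e by blast
qed

lemma via_wprod:
  assumes w: "via X w"
  shows "via X [wprod L w]" "pconj L (wprod L w) ` X = fold (pconj L) w ` X"
proof -
  have X: "X \<in> \<Delta>" using via_object[OF w] .
  have "x \<in> conj_dom L (wprod L w) \<and> pconj L (wprod L w) x = fold (pconj L) w x" if "x \<in> X" for x
    using via_pconj[OF w, of x] object_normalizes(1)[OF X] that by blast
  then show im: "pconj L (wprod L w) ` X = fold (pconj L) w ` X" and "via X [wprod L w]"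
    using X wprod_closed[OF via_words[OF w]] via_end[OF w] by (auto intro!: image_cong)
qed

text \<open>
  The conjugate is the product of a word along the objects Y, X, X, Y, where Y is the conjugate of
  X.
\<close>

lemma normalizer_pconj:
  assumes x: "x \<in> pg_normalizer L X" and g: "via X [g]"
  shows "pconj L g x \<in> pg_normalizer L (pconj L g ` X)"
proof -
  let ?Y = "pconj L g ` X"
  have xX: "pconj L x ` X = X" using x by (simp add: pg_normalizer_def)
  have "via ?Y ([pinv L g] @ [x] @ [g])"
    unfolding via_append using via_inverse_step[OF g] via_normalizer[OF via_object[OF g] x] xX g by simp
  then have v: "via ?Y [pinv L g, x, g]" by simp
  have "fold (pconj L) [pinv L g, x, g] ` ?Y = pconj L g ` pconj L x ` pconj L (pinv L g) ` ?Y"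
    by (simp add: image_comp o_assoc)
  then have "fold (pconj L) [pinv L g, x, g] ` ?Y = ?Y" using via_inverse_step(2)[OF g] xX by simp
  then show ?thesis using via_wprod[OF v] by (auto simp: pg_normalizer_def pconj_def)
qed

lemma normalizer_subgroup:
  assumes X: "X \<in> \<Delta>"
  shows "pg_subgroup (pg_normalizer L X) L"
proof -
  let ?N = "pg_normalizer L X"
  have v: "via X w \<and> fold (pconj L) w ` X = X" if "w \<in> lists ?N" for w
    using that
  proof (induction w)
    case (Cons g w)
    then have g: "g \<in> carrier L" "X \<subseteq> conj_dom L g" "pconj L g ` X = X" by (auto simp: pg_normalizer_def)
    then have "fold (pconj L) (g # w) ` X = fold (pconj L) w ` X" by (metis fold_Cons image_comp)
    then show ?case using Cons.IH g X by simp
  qed (use X in simp)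
  have "wprod L w \<in> ?N" if w: "w \<in> lists ?N" for w
    using via_wprod[of X w] v[OF w] by (auto simp: pg_normalizer_def)
  moreover have "pinv L g \<in> ?N" if "g \<in> ?N" for g
    using via_inverse_step[OF via_normalizer[OF X that]] that by (auto simp: pg_normalizer_def)
  moreover have "lists ?N \<subseteq> words L" using v via_words by blast
  moreover have "?N \<noteq> {}" using object_normalizes(1)[OF X] subgroup.one_closed[OF objects_subgroups[OF X]] by blast
  ultimately show ?thesis by (auto simp: pg_subgroup_def partial_subgroup_def pg_normalizer_def)
qed

lemma pconj_normalizer_hom:
  assumes g: "via X [g]"
  shows "pconj L g \<in> hom (grp_of L (pg_normalizer L X)) (grp_of L (pg_normalizer L (pconj L g ` X)))"
proof (rule homI; unfold grp_of_simps)
  show "pconj L g x \<in> pg_normalizer L (pconj L g ` X)" if "x \<in> pg_normalizer L X" for x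
    using normalizer_pconj[OF that g] .
  fix x y assume x: "x \<in> pg_normalizer L X" and y: "y \<in> pg_normalizer L X"
  have X: "X \<in> \<Delta>" using via_object[OF g] .
  have xX: "pconj L x ` X = X" "pconj L y ` X = X" using x y by (simp_all add: pg_normalizer_def)
  have "via (pconj L g ` X) ([pinv L g] @ [x] @ [g] @ [pinv L g] @ [y] @ [g])"
    unfolding via_append using via_inverse_step[OF g] via_normalizer[OF X x] via_normalizer[OF X y] xX g by simp
  then have "[pinv L g, x, g, pinv L g, y, g] \<in> words L" using via_words by fastforce
  then show "pconj L g (wprod L [x, y]) = wprod L [pconj L g x, pconj L g y]"
    using pconj_product(2) g by simp
qed

lemma S_via:
  assumes X: "X \<in> \<Delta>" and s: "s \<in> S"
  shows "via X [s]"
proof -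
  have XS: "X \<subseteq> S" using object_subset[OF X] .
  have c: "X \<subseteq> conj_dom L s" and e: "pconj L s ` X = gconj GS s ` X"
    using gconj_grp_of[OF S_subgroup s] XS by (auto simp: subset_iff image_def)
  have "subgroup (pconj L s ` X) GS"
    using GS.subgroup_gconj_image[OF objects_subgroups[OF X]] s by (simp add: e carrier_GS)
  then show ?thesis using object_closed[OF X _ c] X c s S_carrier by auto
qed

text \<open>
  Let b be the conjugate of a by g, so that \<open>a g = g b\<close>. Then g is the product of the
  word with letters the inverse of a, g and b. This word conjugates the conjugate of X by a along
  objects: back to X, on to the conjugate of X by g, and then by an element of S.
\<close>

lemma via_translate:
  assumes g: "via X [g]" and a: "a \<in> S_elt L S g"
  shows "via (pconj L a ` X) [g]"
proof -
  have X: "X \<in> \<Delta>" "g \<in> carrier L" using g by auto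
  have aS: "a \<in> S" "a \<in> conj_dom L g" and bS: "pconj L g a \<in> S" using a by (auto simp: S_elt_def)
  have ac: "a \<in> carrier L" using aS(1) S_carrier by blast
  let ?b = "pconj L g a"
  have "via X ([g] @ [?b])" unfolding via_append using g S_via[of "pconj L g ` X", OF _ bS] by simp
  then have gb: "[g, ?b] \<in> words L" using via_words by fastforce
  have va: "via X [a]" using S_via[OF X(1) aS(1)] .
  have "via (pconj L a ` X) ([pinv L a] @ [g] @ [?b])"
    unfolding via_append using via_inverse_step[OF va] g S_via[of "pconj L g ` X", OF _ bS] by simp
  then have v: "via (pconj L a ` X) [pinv L a, g, ?b]" by simp
  have w1: "[g, pinv L g, a, g] \<in> words L"
    using words_prefix[of "[g, pinv L g, a, g]" "[pinv L g]"] conj_dom_extended[OF X(2) aS(2)] by simp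
  have ag: "[a, g] \<in> words L" using words_suffix[of "[g, pinv L g]" "[a, g]"] w1 by simp
  have "wprod L [g, pinv L g, a, g] = wprod L [g, ?b]"
    using wprod_contract[of "[g]" "[pinv L g, a, g]" "[]"] w1 by (simp add: pconj_def)
  moreover have "wprod L [g, pinv L g, a, g] = wprod L [a, g]"
    using wprod_delete[of "[]" "[g, pinv L g]" "[a, g]"] w1 ag wprod_pinv'[OF X(2)] by simp
  ultimately have eq: "wprod L [g, ?b] = wprod L [a, g]" by simp
  have aag: "[pinv L a, a, g] \<in> words L"
    using words_suffix[of "[pinv L g]" "[pinv L a, a, g]"] words_inverse[OF ag] by simp
  have "wprod L [pinv L a, g, ?b] = wprod L [pinv L a, a, g]"
    using wprod_cong[of "[pinv L a]" "[g, ?b]" "[]" "[a, g]"] via_words[OF v] aag eq by simp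
  also have "\<dots> = g"
    using wprod_delete[of "[]" "[pinv L a, a]" "[g]"] aag wprod_pinv[OF ac] singleton_word[OF X(2)] wprod_singleton[OF X(2)] by simp
  finally show ?thesis using via_wprod(1)[OF v] by simp
qed

text \<open>
  The elements x and y need not normalize an object X that can be conjugated by g. By
  \<open>via_translate\<close>, the translates of X by x and by y can be conjugated by g, too, and
  they form the chain of objects for the word in \<open>pconj_product\<close>.
\<close>

lemma S_elt_product:
  assumes g: "g \<in> carrier L" and x: "x \<in> S_elt L S g" and y: "y \<in> S_elt L S g"
  shows "wprod L [x, y] \<in> S_elt L S g" "pconj L g (wprod L [x, y]) = wprod L [pconj L g x, pconj L g y]"
proof -
  obtain X where X: "via X [g]" using words_via[OF singleton_word[OF g]] by blast
  have S: "x \<in> S" "y \<in> S" "pconj L g x \<in> S" "pconj L g y \<in> S" using x y by (auto simp: S_elt_def)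
  let ?X = "pconj L x ` X" let ?X' = "pconj L y ` ?X"
  have X1: "via ?X [g]" using via_translate[OF X x] .
  have X2: "via ?X' [g]" using via_translate[OF X1 y] .
  have "via (pconj L g ` X) ([pinv L g] @ [x] @ [g] @ [pinv L g] @ [y] @ [g])"
    unfolding via_append
    using via_inverse_step[OF X] via_inverse_step[OF X1] X1 X2 S_via[OF via_object[OF X] S(1)] S_via[OF via_object[OF X1] S(2)] by simp
  then have w: "[pinv L g, x, g, pinv L g, y, g] \<in> words L" using via_words by fastforce
  show e: "pconj L g (wprod L [x, y]) = wprod L [pconj L g x, pconj L g y]" using pconj_product(2)[OF g w] .
  show "wprod L [x, y] \<in> S_elt L S g"
    using pconj_product(1)[OF g w] e GS.m_closed[of x y] GS.m_closed[of "pconj L g x" "pconj L g y"] S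
    by (simp add: S_elt_def grp_of_simps)
qed

lemma S_elt_subgroup:
  assumes g: "g \<in> carrier L"
  shows "subgroup (S_elt L S g) GS"
proof (rule GS.subgroupI)
  show "S_elt L S g \<subseteq> carrier GS" by (auto simp: S_elt_def carrier_GS)
  have "pone \<in> S" using GS.one_closed by (simp add: grp_of_simps)
  then have "pone \<in> S_elt L S g" using pconj_one[OF g] by (simp add: S_elt_def)
  then show "S_elt L S g \<noteq> {}" by blast
  fix a assume a: "a \<in> S_elt L S g"
  then have "a \<in> S" "a \<in> conj_dom L g" "pconj L g a \<in> S" by (auto simp: S_elt_def)
  then show "inv\<^bsub>GS\<^esub> a \<in> S_elt L S g"
    using pconj_minv[OF g] pg_subgroup_closed(4)[OF S_subgroup] by (simp add: S_elt_def inv_grp_of[OF S_subgroup])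
  fix b assume "b \<in> S_elt L S g"
  then show "a \<otimes>\<^bsub>GS\<^esub> b \<in> S_elt L S g" using S_elt_product(1)[OF g a] by (simp add: grp_of_simps)
qed

lemma S_elt_hom:
  assumes g: "g \<in> carrier L"
  shows "group_hom (grp_of L (S_elt L S g)) GS (pconj L g)"
proof -
  have "group (grp_of L (S_elt L S g))"
    using GS.subgroup_imp_group[OF S_elt_subgroup[OF g]] by (simp add: grp_of_restrict)
  moreover have "pconj L g \<in> hom (grp_of L (S_elt L S g)) GS"
    by (rule homI) (use S_elt_product(2)[OF g] in \<open>auto simp: grp_of_simps S_elt_def\<close>)
  ultimately show ?thesis by (intro group_hom.intro GS.is_group group_hom_axioms.intro)
qed

lemma S_elt_image_subgroup:
  assumes g: "g \<in> carrier L" and P: "subgroup P GS" "P \<subseteq> S_elt L S g"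
  shows "subgroup (pconj L g ` P) GS"
  using group_hom.subgroup_img_is_subgroup[OF S_elt_hom[OF g]]
    GS.subgroup_incl[OF P(1) S_elt_subgroup[OF g] P(2)] by (simp add: grp_of_restrict)

text \<open>
  For an object X that can be conjugated by g, both X and its conjugate lie in S; so the subgroup
  in question contains X.
\<close>

lemma S_elt_object: "g \<in> carrier L \<Longrightarrow> S_elt L S g \<in> \<Delta>"
proof -
  assume g: "g \<in> carrier L"
  obtain X where X: "via X [g]" using words_via[OF singleton_word[OF g]] by blast
  then have "X \<in> \<Delta>" "X \<subseteq> conj_dom L g" "pconj L g ` X \<in> \<Delta>" by auto
  then have "X \<subseteq> S_elt L S g" using object_subset[of X] object_subset[of "pconj L g ` X"] by (auto simp: S_elt_def)
  then show ?thesis using overgroup_object[OF \<open>X \<in> \<Delta>\<close> S_elt_subgroup[OF g]] by simp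
qed

lemma via_S_elt:
  assumes P: "P \<in> \<Delta>" and g: "g \<in> carrier L"
  shows "via P [g] \<longleftrightarrow> P \<subseteq> S_elt L S g"
proof
  assume "via P [g]"
  then show "P \<subseteq> S_elt L S g"
    using object_subset[OF P] object_subset[of "pconj L g ` P"] by (auto simp: S_elt_def)
next
  assume s: "P \<subseteq> S_elt L S g"
  then have "P \<subseteq> conj_dom L g" by (auto simp: S_elt_def)
  moreover have "subgroup (pconj L g ` P) GS" using S_elt_image_subgroup[OF g objects_subgroups[OF P] s] .
  ultimately show "via P [g]" using object_closed[OF P g] P g by auto
qed

end

section \<open>The fusion system of a locality\<close>

context locality
begin

text \<open>
  The elements of S that stay in S while they are conjugated by the letters of w one after the
  other.
\<close>

fun word_dom :: "'a list \<Rightarrow> 'a set"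
  where
    "word_dom [] = S"
  | "word_dom (g # w) = {x \<in> S_elt L S g. pconj L g x \<in> word_dom w}"

lemma word_dom_S: "x \<in> word_dom w \<Longrightarrow> x \<in> S" "x \<in> word_dom w \<Longrightarrow> fold (pconj L) w x \<in> S"
  by (induction w arbitrary: x) (auto simp: S_elt_def)

lemma word_dom_append: "x \<in> word_dom (u @ v) \<longleftrightarrow> x \<in> word_dom u \<and> fold (pconj L) u x \<in> word_dom v"
  by (induction u arbitrary: x) (auto dest: word_dom_S(1))

lemma word_dom_singleton: "word_dom [g] = S_elt L S g"
  by (auto simp: S_elt_def)

lemma word_dom_mult:
  "set w \<subseteq> carrier L \<Longrightarrow> x \<in> word_dom w \<Longrightarrow> y \<in> word_dom w \<Longrightarrow>
    fold (pconj L) w (wprod L [x, y]) = wprod L [fold (pconj L) w x, fold (pconj L) w y]"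
  by (induction w arbitrary: x y) (simp_all add: S_elt_product(2))

lemma word_dom_inverse:
  "set w \<subseteq> carrier L \<Longrightarrow> x \<in> word_dom w \<Longrightarrow>
    fold (pconj L) w x \<in> word_dom (winv w) \<and> fold (pconj L) (winv w) (fold (pconj L) w x) = x"
proof (induction w arbitrary: x)
  case (Cons g w)
  have g: "g \<in> carrier L" and x: "x \<in> S" "x \<in> conj_dom L g" "pconj L g x \<in> word_dom w"
    using Cons.prems by (auto simp: S_elt_def)
  have "pconj L g x \<in> S" using word_dom_S(1)[OF x(3)] .
  then have "pconj L g x \<in> word_dom [pinv L g]" using pconj_pinv[OF g x(2)] x(1) by (simp add: S_elt_def)
  then show ?case using Cons.IH[OF _ x(3)] Cons.prems(1) pconj_pinv(2)[OF g x(2)] by (simp add: word_dom_append)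
qed simp

text \<open>
  The generated fusion system, explicitly: the restrictions of composites of the conjugation maps.
\<close>

definition word_fusion :: "'a homs"
  where "word_fusion P Q = {\<phi> \<in> extensional P. subgroup P GS \<and> subgroup Q GS \<and> \<phi> ` P \<subseteq> Q \<and>
    (\<exists>w. set w \<subseteq> carrier L \<and> P \<subseteq> word_dom w \<and> (\<forall>x\<in>P. \<phi> x = fold (pconj L) w x))}"

lemma word_fusionI:
  assumes "subgroup P GS" "subgroup Q GS" "\<phi> ` P \<subseteq> Q" "set w \<subseteq> carrier L" "P \<subseteq> word_dom w"
    "\<And>x. x \<in> P \<Longrightarrow> \<phi> x = fold (pconj L) w x" "\<phi> \<in> extensional P"
  shows "\<phi> \<in> word_fusion P Q"
  using assms unfolding word_fusion_def by blast

lemma word_fusionE: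
  assumes "\<phi> \<in> word_fusion P Q"
  obtains w where "subgroup P GS" "subgroup Q GS" "\<phi> ` P \<subseteq> Q" "\<phi> \<in> extensional P"
    "set w \<subseteq> carrier L" "P \<subseteq> word_dom w" "\<forall>x\<in>P. \<phi> x = fold (pconj L) w x"
  using assms unfolding word_fusion_def by blast

lemma word_fusion_hom:
  assumes "\<phi> \<in> word_fusion P Q"
  shows "group_hom (grp_of L P) GS \<phi>" "inj_on \<phi> P"
proof -
  obtain w where w: "subgroup P GS" "subgroup Q GS" "\<phi> ` P \<subseteq> Q" "\<phi> \<in> extensional P"
    "set w \<subseteq> carrier L" "P \<subseteq> word_dom w" "\<forall>x\<in>P. \<phi> x = fold (pconj L) w x"
    using assms by (rule word_fusionE)
  have hom: "\<phi> \<in> hom (grp_of L P) GS"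
  proof (rule homI; unfold grp_of_simps)
    fix x assume x: "x \<in> P"
    show "\<phi> x \<in> S" using w(6,7) x word_dom_S(2) by auto
    fix y assume y: "y \<in> P"
    have "wprod L [x, y] \<in> P" using subgroup.m_closed[OF w(1) x y] by (simp add: grp_of_simps)
    then show "\<phi> (wprod L [x, y]) = wprod L [\<phi> x, \<phi> y]"
      using w(7) word_dom_mult[OF w(5), of x y] w(6) x y by auto
  qed
  moreover have "group (grp_of L P)" using GS.subgroup_imp_group[OF w(1)] by (simp add: grp_of_restrict)
  ultimately show "group_hom (grp_of L P) GS \<phi>" by (intro group_hom.intro GS.is_group group_hom_axioms.intro)
  have "fold (pconj L) (winv w) (\<phi> x) = x" if "x \<in> P" for x
    using word_dom_inverse[OF w(5), of x] w(6,7) that by auto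
  then show "inj_on \<phi> P" by (rule inj_on_inverseI)
qed

lemma fusion_system_word_fusion: "fusion_system GS word_fusion"
proof
  show "finite (carrier GS)" using finite_S by (simp add: carrier_GS)
next
  fix \<phi> P Q assume \<phi>: "\<phi> \<in> word_fusion P Q"
  then obtain w where w: "subgroup P GS" "subgroup Q GS" "\<phi> ` P \<subseteq> Q" "\<phi> \<in> extensional P"
    "set w \<subseteq> carrier L" "P \<subseteq> word_dom w" "\<forall>x\<in>P. \<phi> x = fold (pconj L) w x"
    by (rule word_fusionE)
  show "subgroup P GS \<and> subgroup Q GS" using w by blast
  interpret h: group_hom "grp_of L P" GS \<phi> using word_fusion_hom(1)[OF \<phi>] .
  have "\<phi> \<in> mon (grp_of L P) (grp_of L Q)"
    using word_fusion_hom(2)[OF \<phi>] h.hom_mult w(3) by (auto simp: mon_def hom_def grp_of_simps)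
  then show "\<phi> \<in> extensional P \<inter> mon (GS\<lparr>carrier := P\<rparr>) (GS\<lparr>carrier := Q\<rparr>)"
    using w(4) by (simp add: grp_of_restrict)
  have im: "subgroup (\<phi> ` P) GS" using h.img_is_subgroup by (simp add: grp_of_simps)
  have inv: "fold (pconj L) w x \<in> word_dom (winv w) \<and> fold (pconj L) (winv w) (fold (pconj L) w x) = x" if "x \<in> P" for x
    using word_dom_inverse[OF w(5)] w(6) that by blast
  let ?\<psi> = "restrict (fold (pconj L) (winv w)) (\<phi> ` P)"
  have \<psi>\<phi>: "?\<psi> (\<phi> x) = x" if "x \<in> P" for x using inv[OF that] w(7) that by simp
  have "?\<psi> \<in> word_fusion (\<phi> ` P) P"
  proof (rule word_fusionI[OF im w(1), of _ "winv w"])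
    show "?\<psi> ` \<phi> ` P \<subseteq> P" using \<psi>\<phi> by auto
    show "set (winv w) \<subseteq> carrier L" using w(5) pinv_closed by auto
    show "\<phi> ` P \<subseteq> word_dom (winv w)" using inv w(7) by auto
  qed simp_all
  moreover have "\<phi> \<in> word_fusion P (\<phi> ` P)" by (rule word_fusionI[OF w(1) im order_refl w(5,6) _ w(4)]) (use w(7) in blast)
  moreover have "compose P ?\<psi> \<phi> = (\<lambda>x\<in>P. x)" using \<psi>\<phi> by (intro ext) (simp add: compose_def)
  moreover have "compose (\<phi> ` P) \<phi> ?\<psi> = (\<lambda>x\<in>\<phi> ` P. x)"
  proof
    fix y
    show "compose (\<phi> ` P) \<phi> ?\<psi> y = (\<lambda>x\<in>\<phi> ` P. x) y"
    proof (cases "y \<in> \<phi> ` P")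
      case True
      then obtain x where "x \<in> P" "y = \<phi> x" by blast
      then show ?thesis using \<psi>\<phi> by (simp add: compose_def)
    qed (simp add: compose_def)
  qed
  ultimately show "\<phi> \<in> fus_iso word_fusion P (\<phi> ` P)" unfolding fus_iso_def by blast
next
  fix P assume P: "subgroup P GS"
  then have "P \<subseteq> S" using subgroup.subset carrier_GS by blast
  then show "(\<lambda>x\<in>P. x) \<in> word_fusion P P" by (intro word_fusionI[OF P P, of _ "[]"]) auto
next
  fix \<phi> \<psi> P Q R assume "\<phi> \<in> word_fusion P Q" and \<psi>: "\<psi> \<in> word_fusion Q R"
  then obtain u where u: "subgroup P GS" "subgroup Q GS" "\<phi> ` P \<subseteq> Q" "\<phi> \<in> extensional P"
    "set u \<subseteq> carrier L" "P \<subseteq> word_dom u" "\<forall>x\<in>P. \<phi> x = fold (pconj L) u x"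
    using word_fusionE by blast
  obtain v where v: "subgroup Q GS" "subgroup R GS" "\<psi> ` Q \<subseteq> R" "\<psi> \<in> extensional Q"
    "set v \<subseteq> carrier L" "Q \<subseteq> word_dom v" "\<forall>x\<in>Q. \<psi> x = fold (pconj L) v x"
    using \<psi> by (rule word_fusionE)
  show "compose P \<psi> \<phi> \<in> word_fusion P R"
  proof (rule word_fusionI[OF u(1) v(2), of _ "u @ v"])
    have \<phi>Q: "\<phi> x \<in> Q" if "x \<in> P" for x using u(3) that by blast
    show "compose P \<psi> \<phi> ` P \<subseteq> R" using \<phi>Q v(3) by (auto simp: compose_def)
    show "P \<subseteq> word_dom (u @ v)"
      using u(6,7) v(6) \<phi>Q by (fastforce simp: word_dom_append)
    show "compose P \<psi> \<phi> x = fold (pconj L) (u @ v) x" if "x \<in> P" for x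
      using v(7) u(7) that \<phi>Q[OF that] by (simp add: compose_def)
  qed (use u v in auto)
next
  fix P Q g assume P: "subgroup P GS" "subgroup Q GS" and g: "g \<in> carrier GS" "gconj GS g ` P \<subseteq> Q"
  have gS: "g \<in> S" "g \<in> carrier L" using g S_carrier by (auto simp: carrier_GS)
  have PS: "P \<subseteq> S" "Q \<subseteq> S" using P subgroup.subset carrier_GS by blast+
  have e: "gconj GS g x = pconj L g x" "x \<in> conj_dom L g" if "x \<in> P" for x
    using gconj_grp_of[OF S_subgroup gS(1)] that PS by auto
  have "P \<subseteq> word_dom [g]" using e g(2) PS by (auto simp: S_elt_def)
  then show "restrict (gconj GS g) P \<in> word_fusion P Q"
    using e g(2) gS(2) by (intro word_fusionI[OF P, of _ "[g]"]) auto
qed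

lemma locality_fusion_eq: "locality_fusion L S = word_fusion"
proof (intro ext)
  fix P Q
  have gen: "restrict (pconj L g) (S_elt L S g) \<in> word_fusion (S_elt L S g) S" if g: "g \<in> carrier L" for g
  proof (rule word_fusionI[OF S_elt_subgroup[OF g] objects_subgroups[OF S_object], of _ "[g]"])
    show "restrict (pconj L g) (S_elt L S g) ` S_elt L S g \<subseteq> S" by (auto simp: S_elt_def)
    show "S_elt L S g \<subseteq> word_dom [g]" by (simp only: word_dom_singleton order_refl)
  qed (use g in auto)
  have "\<phi> \<in> E P Q"
    if \<phi>: "\<phi> \<in> word_fusion P Q" and E: "fusion_system GS E"
      "\<forall>g\<in>carrier L. restrict (pconj L g) (S_elt L S g) \<in> E (S_elt L S g) S" for \<phi> E
  proof -
    interpret E: fusion_system GS E using E(1) .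
    have *: "set w \<subseteq> carrier L \<Longrightarrow> subgroup P GS \<Longrightarrow> P \<subseteq> word_dom w \<Longrightarrow> E.mor (fold (pconj L) w) P" for w P
    proof (induction w arbitrary: P)
      case Nil
      then show ?case using E.mor_id by (simp add: id_def)
    next
      case (Cons g w)
      have g: "g \<in> carrier L" "P \<subseteq> S_elt L S g" "pconj L g ` P \<subseteq> word_dom w" using Cons.prems by auto
      have "E.mor (restrict (pconj L g) (S_elt L S g)) (S_elt L S g)"
        using E(2) g(1) E.morI(1) by blast
      then have "E.mor (pconj L g) (S_elt L S g)" by (rule E.mor_cong[THEN iffD1, rotated]) simp
      then have 1: "E.mor (pconj L g) P" using E.mor_restrict[OF _ Cons.prems(2) g(2)] by blast
      have "E.mor (fold (pconj L) w) (pconj L g ` P)"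
        using Cons.IH[OF _ E.mor_subgroup(2)[OF 1] g(3)] Cons.prems(1) by simp
      then have "E.mor (fold (pconj L) w \<circ> pconj L g) P" using E.mor_comp[OF 1] by blast
      then show ?case by (simp only: fold_Cons)
    qed
    obtain w where w: "subgroup P GS" "subgroup Q GS" "\<phi> ` P \<subseteq> Q" "\<phi> \<in> extensional P"
      "set w \<subseteq> carrier L" "P \<subseteq> word_dom w" "\<forall>x\<in>P. \<phi> x = fold (pconj L) w x"
      using \<phi> by (rule word_fusionE)
    have "E.mor \<phi> P" using E.mor_cong[of P \<phi> "fold (pconj L) w"] *[OF w(5,1,6)] w(7) by blast
    then show ?thesis unfolding E.mem_iff using w by blast
  qed
  then show "locality_fusion L S P Q = word_fusion P Q"
    unfolding locality_fusion_def using fusion_system_word_fusion gen by blast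
qed

end

lemma (in group_hom) hom_gconj:
  "g \<in> carrier G \<Longrightarrow> x \<in> carrier G \<Longrightarrow> h (gconj G g x) = gconj H (h g) (h x)"
  by (simp add: gconj_def)

locale prime_locality = locality +
  assumes prime_p: "prime p"
begin

abbreviation FS :: "'a homs"
  where "FS \<equiv> locality_fusion L S"

sublocale F: p_fusion_system GS FS p
proof -
  have "\<exists>n. order GS = p ^ n"
    using S_p_subgroup by (simp add: pg_p_subgroup_def order_def carrier_GS)
  then show "p_fusion_system GS FS p"
    using fusion_system_word_fusion prime_p
    by (simp add: p_fusion_system_def p_fusion_system_axioms_def locality_fusion_eq)
qed

lemma mor_words:
  "F.mor f P \<longleftrightarrow> subgroup P GS \<and>
    (\<exists>w. set w \<subseteq> carrier L \<and> P \<subseteq> word_dom w \<and> (\<forall>x\<in>P. f x = fold (pconj L) w x))"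
proof
  assume m: "F.mor f P"
  then have "restrict f P \<in> FS P (f ` P)" by (simp only: F.mor_def)
  then have "restrict f P \<in> word_fusion P (f ` P)" unfolding locality_fusion_eq .
  then obtain w where "subgroup P GS" "set w \<subseteq> carrier L" "P \<subseteq> word_dom w" "\<forall>x\<in>P. restrict f P x = fold (pconj L) w x"
    by (rule word_fusionE)
  then show "subgroup P GS \<and> (\<exists>w. set w \<subseteq> carrier L \<and> P \<subseteq> word_dom w \<and> (\<forall>x\<in>P. f x = fold (pconj L) w x))"
    by auto
next
  assume "subgroup P GS \<and> (\<exists>w. set w \<subseteq> carrier L \<and> P \<subseteq> word_dom w \<and> (\<forall>x\<in>P. f x = fold (pconj L) w x))"
  then obtain w where w: "subgroup P GS" "set w \<subseteq> carrier L" "P \<subseteq> word_dom w" "\<forall>x\<in>P. f x = fold (pconj L) w x"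
    by blast
  have "restrict f P \<in> word_fusion P S"
    by (rule word_fusionI[OF w(1) objects_subgroups[OF S_object] _ w(2,3)]) (use w(3,4) word_dom_S(2) in auto)
  then have "F.mor (restrict f P) P" using F.morI(1) by (simp add: locality_fusion_eq)
  then show "F.mor f P" by (rule F.mor_cong[THEN iffD1, rotated]) simp
qed

lemma via_word_dom:
  "set w \<subseteq> carrier L \<Longrightarrow> P \<in> \<Delta> \<Longrightarrow> P \<subseteq> word_dom w \<Longrightarrow> via P w"
proof (induction w arbitrary: P)
  case (Cons g w)
  have "P \<subseteq> S_elt L S g" "pconj L g ` P \<subseteq> word_dom w" using Cons.prems by auto
  moreover from this have "via P [g]" using via_S_elt Cons.prems by auto
  ultimately show ?case using Cons by auto
qed simp

text \<open>
  An object in the domain of a word gives a chain of objects for it, so the word can be replaced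
  by its product.
\<close>

lemma mor_object:
  assumes P: "P \<in> \<Delta>"
  shows "F.mor f P \<longleftrightarrow> (\<exists>g. via P [g] \<and> (\<forall>x\<in>P. f x = pconj L g x))"
proof
  assume "F.mor f P"
  then obtain w where w: "set w \<subseteq> carrier L" "P \<subseteq> word_dom w" "\<forall>x\<in>P. f x = fold (pconj L) w x"
    using mor_words by blast
  have v: "via P w" using via_word_dom[OF w(1) P w(2)] .
  have "\<forall>x\<in>P. f x = pconj L (wprod L w) x"
    using w(3) via_pconj(2)[OF v] object_normalizes(1)[OF P] by auto
  then show "\<exists>g. via P [g] \<and> (\<forall>x\<in>P. f x = pconj L g x)" using via_wprod(1)[OF v] by blast
next
  assume "\<exists>g. via P [g] \<and> (\<forall>x\<in>P. f x = pconj L g x)"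
  then obtain g where g: "via P [g]" "\<forall>x\<in>P. f x = pconj L g x" by blast
  then have "g \<in> carrier L" by simp
  then have "P \<subseteq> word_dom [g]" using via_S_elt[OF P] g(1) by (simp only: word_dom_singleton)
  then show "F.mor f P" unfolding mor_words
    using objects_subgroups[OF P] g(2) \<open>g \<in> carrier L\<close> by (intro conjI exI[of _ "[g]"]) auto
qed

lemma mor_image_object:
  assumes P: "P \<in> \<Delta>" and f: "F.mor f P"
  shows "f ` P \<in> \<Delta>"
proof -
  obtain g where g: "via P [g]" "\<forall>x\<in>P. f x = pconj L g x" using f mor_object[OF P] by blast
  have "f ` P = pconj L g ` P" using g(2) by (intro image_cong) auto
  then show ?thesis using g(1) by simp
qed

lemma objects_generate: "F.fusion_generated \<Delta>"
  unfolding F.fusion_generated_def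
proof (intro conjI allI impI ballI)
  show "carrier GS \<in> \<Delta>" using S_object by (simp add: carrier_GS)
  show "subgroup E GS" if "E \<in> \<Delta>" for E using objects_subgroups[OF that] .
  show "f ` E \<in> \<Delta>" if "E \<in> \<Delta>" "F.mor f E" for E f using mor_image_object that by blast
  fix f P assume "F.mor f P"
  then obtain w where w: "set w \<subseteq> carrier L" "P \<subseteq> word_dom w" "\<forall>x\<in>P. f x = fold (pconj L) w x"
    using mor_words by blast
  have "set w \<subseteq> carrier L \<Longrightarrow> P \<subseteq> word_dom w \<Longrightarrow> F.composite \<Delta> P (fold (pconj L) w)" for P
  proof (induction w arbitrary: P)
    case Nil
    then show ?case using F.composite_id[of \<Delta> P] by (simp add: id_def)
  next
    case (Cons g w)
    have g: "g \<in> carrier L" "P \<subseteq> S_elt L S g" "pconj L g ` P \<subseteq> word_dom w" using Cons.prems by auto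
    have "F.mor (pconj L g) (S_elt L S g)"
      unfolding mor_object[OF S_elt_object[OF g(1)]] using via_S_elt[OF S_elt_object[OF g(1)] g(1)] by blast
    moreover have "F.composite \<Delta> (pconj L g ` P) (fold (pconj L) w)" using Cons.IH[OF _ g(3)] Cons.prems(1) by simp
    ultimately have "F.composite \<Delta> P (fold (pconj L) w \<circ> pconj L g)"
      using F.composite_step[OF S_elt_object[OF g(1)] _ g(2)] by blast
    then show ?case by (simp only: fold_Cons)
  qed
  then have "F.composite \<Delta> P (fold (pconj L) w)" using w(1,2) by blast
  moreover have "\<forall>x\<in>P. fold (pconj L) w x = f x" using w(3) by simp
  ultimately show "\<exists>h. F.composite \<Delta> P h \<and> (\<forall>x\<in>P. h x = f x)" by blast
qed

section \<open>Saturation at the objects of a locality\<close>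

abbreviation NL :: "'a set \<Rightarrow> 'a set"
  where "NL P \<equiv> pg_normalizer L P"

abbreviation NG :: "'a set \<Rightarrow> 'a monoid"
  where "NG P \<equiv> grp_of L (NL P)"

lemma subgroup_transfer:
  assumes A: "pg_subgroup A L" and B: "pg_subgroup B L" and T: "subgroup T (grp_of L A)" "T \<subseteq> B"
  shows "subgroup T (grp_of L B)"
proof -
  interpret B: group "grp_of L B" using group_grp_of[OF B] .
  have TA: "T \<subseteq> A" using subgroup.subset[OF T(1)] by (simp add: grp_of_simps)
  show ?thesis
  proof (rule B.subgroupI)
    show "T \<subseteq> carrier (grp_of L B)" using T(2) by (simp add: grp_of_simps)
    show "T \<noteq> {}" using subgroup.one_closed[OF T(1)] by blast
    fix a assume a: "a \<in> T"
    have "a \<in> A" "a \<in> B" using a TA T(2) by blast+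
    then have "inv\<^bsub>grp_of L B\<^esub> a = inv\<^bsub>grp_of L A\<^esub> a" using inv_grp_of[OF A] inv_grp_of[OF B] by simp
    then show "inv\<^bsub>grp_of L B\<^esub> a \<in> T" using subgroup.m_inv_closed[OF T(1) a] by simp
    fix b assume "b \<in> T"
    then show "a \<otimes>\<^bsub>grp_of L B\<^esub> b \<in> T" using subgroup.m_closed[OF T(1) a] by (simp add: grp_of_simps)
  qed
qed

lemma object_normalizer_subgroups:
  assumes P: "P \<in> \<Delta>"
  shows "group (NG P)" "finite (NL P)" "subgroup P (NG P)" "subgroup (normalizer GS P) (NG P)"
    "P \<subseteq> NL P" "normalizer GS P \<subseteq> NL P" "normalizer (NG P) P = NL P"
proof -
  note N = normalizer_subgroup[OF P]
  show g: "group (NG P)" using group_grp_of[OF N] .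
  show "finite (NL P)" using finite_carrier finite_subset pg_subgroup_closed(1)[OF N] by blast
  show PN: "P \<subseteq> NL P" using object_normalizes(1)[OF P] .
  show SN: "normalizer GS P \<subseteq> NL P" using object_normalizes(2)[OF P] by blast
  show "subgroup P (NG P)" using subgroup_transfer[OF S_subgroup N objects_subgroups[OF P] PN] .
  show "subgroup (normalizer GS P) (NG P)"
    using subgroup_transfer[OF S_subgroup N F.subgroup_normalizer'[OF objects_subgroups[OF P]] SN] .
  interpret group "NG P" using g .
  have "gconj (NG P) x ` P = P" if x: "x \<in> NL P" for x
  proof -
    have "gconj (NG P) x ` P = pconj L x ` P" using gconj_grp_of(1)[OF N x] PN by (intro image_cong) auto
    then show ?thesis using x by (simp add: pg_normalizer_def)
  qed
  then show "normalizer (NG P) P = NL P"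
    using mem_normalizer_iff[of P] PN by (auto simp: grp_of_simps)
qed

lemma NG_gconj: "P \<in> \<Delta> \<Longrightarrow> g \<in> NL P \<Longrightarrow> x \<in> NL P \<Longrightarrow> gconj (NG P) g x = pconj L g x"
  using gconj_grp_of(1)[OF normalizer_subgroup] by blast

lemma pconj_group_hom:
  assumes g: "via P [g]"
  shows "group_hom (NG P) (NG (pconj L g ` P)) (pconj L g)"
proof -
  have "P \<in> \<Delta>" "pconj L g ` P \<in> \<Delta>" using g by auto
  then show ?thesis
    using object_normalizer_subgroups(1) pconj_normalizer_hom[OF g]
    by (simp add: group_hom_def group_hom_axioms_def)
qed

text \<open>
  Again the inverse makes the contravariant conjugation a homomorphism. It is onto because, by
  \<open>mor_object\<close>, automorphisms of an object are conjugations by elements of its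
  normalizer.
\<close>

lemma normalizer_acts_by_automorphisms:
  assumes R: "R \<in> \<Delta>"
  defines "h \<equiv> \<lambda>x. restrict (pconj L (pinv L x)) R"
  shows "group_hom (NG R) (F.Aut R) h" "h ` NL R = carrier (F.Aut R)"
    "h ` normalizer GS R = inner_auts GS R"
proof -
  note N = normalizer_subgroup[OF R] and O = object_normalizer_subgroups[OF R]
  interpret NR: group "NG R" using O(1) .
  have sR: "subgroup R GS" using objects_subgroups[OF R] .
  interpret A: group "F.Aut R" using F.group_Aut[OF sR] .
  have inv: "pinv L x \<in> NL R" if "x \<in> NL R" for x using pg_subgroup_closed(4)[OF N that] .
  have act: "F.mor (pconj L x) R" "pconj L x ` R = R" if "x \<in> NL R" for x
    using mor_object[OF R] via_normalizer[OF R that] that by (auto simp: pg_normalizer_def)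
  have cl: "h x \<in> carrier (F.Aut R)" if "x \<in> NL R" for x
    unfolding h_def using F.Aut_restrictI act[OF inv[OF that]] by blast
  have "h \<in> hom (NG R) (F.Aut R)"
  proof (rule homI; unfold grp_of_simps)
    fix x y assume x: "x \<in> NL R" and y: "y \<in> NL R"
    have xy: "wprod L [x, y] \<in> NL R" using NR.m_closed[of x y] x y by (simp add: grp_of_simps)
    show "h (wprod L [x, y]) = h x \<otimes>\<^bsub>F.Aut R\<^esub> h y"
    proof (rule F.Aut_eqI[OF cl[OF xy] A.m_closed[OF cl[OF x] cl[OF y]]])
      fix r assume r: "r \<in> R"
      have rN: "r \<in> NL R" using r O(5) by blast
      have yr: "pconj L (pinv L y) r \<in> R" using act(2)[OF inv[OF y]] r by blast
      have "pconj L (pinv L (wprod L [x, y])) r = gconj (NG R) (inv\<^bsub>NG R\<^esub> (x \<otimes>\<^bsub>NG R\<^esub> y)) r"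
        using NG_gconj[OF R inv[OF xy] rN] inv_grp_of[OF N xy] by (simp add: grp_of_simps)
      also have "\<dots> = gconj (NG R) (inv\<^bsub>NG R\<^esub> x) (gconj (NG R) (inv\<^bsub>NG R\<^esub> y) r)"
        using NR.inv_mult_group[of x y] NR.gconj_mult[OF NR.inv_closed[of y] NR.inv_closed[of x], of r] x y rN
        by (simp add: grp_of_simps(1))
      also have "\<dots> = pconj L (pinv L x) (pconj L (pinv L y) r)"
        using NG_gconj[OF R inv[OF x]] NG_gconj[OF R inv[OF y] rN] inv_grp_of[OF N x] inv_grp_of[OF N y] yr O(5) by auto
      finally show "h (wprod L [x, y]) r = (h x \<otimes>\<^bsub>F.Aut R\<^esub> h y) r"
        using F.Aut_mult_apply[OF cl[OF x] cl[OF y] r] r yr by (simp add: h_def)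
    qed
  qed (rule cl)
  then show "group_hom (NG R) (F.Aut R) h" by (intro group_hom.intro NR.is_group A.is_group group_hom_axioms.intro)
  show "h ` NL R = carrier (F.Aut R)"
  proof
    show "h ` NL R \<subseteq> carrier (F.Aut R)" using cl by blast
    show "carrier (F.Aut R) \<subseteq> h ` NL R"
    proof
      fix \<alpha> assume \<alpha>: "\<alpha> \<in> carrier (F.Aut R)"
      then have "F.mor \<alpha> R" "\<alpha> ` R = R" by (simp_all add: F.Aut_iff)
      then obtain g where g: "via R [g]" "\<forall>x\<in>R. \<alpha> x = pconj L g x" using mor_object[OF R] by blast
      have "pconj L g ` R = \<alpha> ` R" using g(2) by (intro image_cong) auto
      then have gN: "g \<in> NL R" using \<open>\<alpha> ` R = R\<close> g(1) by (simp add: pg_normalizer_def)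
      have "\<alpha> = h (pinv L g)"
        using F.Aut_eqI[OF \<alpha> cl[OF inv[OF gN]]] g by (simp add: h_def pinv_pinv)
      then show "\<alpha> \<in> h ` NL R" using inv[OF gN] by blast
    qed
  qed
  show "h ` normalizer GS R = inner_auts GS R"
  proof -
    note NS = F.subgroup_normalizer'[OF sR]
    have sc: "s \<in> S" if "s \<in> normalizer GS R" for s using subgroup.mem_carrier[OF NS that] by (simp add: carrier_GS)
    have iN: "pinv L s \<in> normalizer GS R" if "s \<in> normalizer GS R" for s
      using subgroup.m_inv_closed[OF NS that] inv_grp_of[OF S_subgroup sc[OF that]] by simp
    have hs: "h s = restrict (gconj GS (pinv L s)) R" if "s \<in> normalizer GS R" for s
      unfolding h_def using gconj_grp_of(1)[OF S_subgroup sc[OF iN[OF that]]] object_subset[OF R]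
      by (intro restrict_ext) auto
    have "restrict (gconj GS s) R = h (pinv L s)" if "s \<in> normalizer GS R" for s
      using hs[OF iN[OF that]] pinv_pinv sc[OF that] S_carrier by auto
    then show ?thesis unfolding inner_auts_def using hs iN by (auto simp: image_iff) metis+
  qed
qed

lemma fully_automized_object:
  assumes R: "R \<in> \<Delta>" and syl: "sylow_subgroup p (NG R) (normalizer GS R)"
  shows "fully_automized p GS FS R"
proof -
  note h = normalizer_acts_by_automorphisms[OF R]
  show ?thesis
    using group_hom.sylow_image[OF h(1) _ prime_p _ syl] h(2,3) object_normalizer_subgroups(2)[OF R]
    by (simp add: fully_automized_def grp_of_simps)
qed

text \<open>
  Let \<open>\<phi>\<close> be conjugation by g. The extension domain T of \<open>\<phi>\<close>
  normalizes P, so g conjugates T into N(R), in fact to a p-subgroup of the group M of all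
  elements that act on R like an element of S. The normalizer of R in S is a Sylow subgroup of M,
  so some k in M conjugates the image of T into S. Let k act on R like s in S. Conjugation by the
  product of g and k maps T into S; followed by conjugation by the inverse of s it agrees with
  \<open>\<phi>\<close> on P.
\<close>

lemma receptive_object:
  assumes R: "R \<in> \<Delta>" and syl: "sylow_subgroup p (NG R) (normalizer GS R)"
  shows "receptive GS FS R"
  unfolding receptive_def
proof (intro allI ballI)
  fix P \<phi> assume "\<phi> \<in> fus_iso FS P R"
  then have \<phi>: "F.mor \<phi> P" "\<phi> ` P = R" by (simp_all add: F.iso_iff)
  have "F.mor (inv_into P \<phi>) R" "inv_into P \<phi> ` R = P"
    using F.mor_inv[OF \<phi>(1)] F.mor_inv_image[OF \<phi>(1) order_refl] \<phi>(2) by simp_all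
  then have P: "P \<in> \<Delta>" using mor_image_object[OF R] by metis
  obtain g where g: "via P [g]" "\<forall>x\<in>P. \<phi> x = pconj L g x" using \<phi>(1) mor_object[OF P] by blast
  have gP: "pconj L g ` P = R"
  proof -
    have "pconj L g ` P = \<phi> ` P" using g(2) by (intro image_cong) auto
    then show ?thesis using \<phi>(2) by simp
  qed
  have sP: "subgroup P GS" and sR: "subgroup R GS" using objects_subgroups P R by blast+
  note OP = object_normalizer_subgroups[OF P] and OR = object_normalizer_subgroups[OF R]
  let ?T = "extension_domain GS P R \<phi>" and ?NS = "normalizer GS R"
  have T: "subgroup ?T GS" "P \<subseteq> ?T" using F.subgroup_extension_domain[OF \<phi>] F.subset_extension_domain[OF \<phi>] .
  have TN: "?T \<subseteq> NL P" using F.mem_extension_domain[OF \<phi>] OP(6) by blast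
  interpret NR: group "NG R" using OR(1) .
  interpret h: group_hom "NG P" "NG R" "pconj L g" using pconj_group_hom[OF g(1)] gP by simp
  have TNG: "subgroup ?T (NG P)" using subgroup_transfer[OF S_subgroup normalizer_subgroup[OF P] T(1) TN] .
  let ?X = "pconj L g ` ?T"
  have X: "subgroup ?X (NG R)" using h.subgroup_img_is_subgroup[OF TNG] .
  obtain n where n: "card ?T = p ^ n" using F.subgroup_p_power[OF T(1)] by (elim exE)
  have "card ?X dvd p ^ n" using dvdI[OF h.card_image_kernel[OF TNG, symmetric]] n by simp
  then obtain m where m: "card ?X = p ^ m" using divides_primepow_nat[OF prime_p] by auto
  define M where "M = NR.centralizer_product R ?NS"
  have Mmem: "t \<in> M \<longleftrightarrow> t \<in> NL R \<and> (\<exists>s\<in>?NS. \<forall>x\<in>R. gconj (NG R) t x = gconj (NG R) s x)" for t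
    by (simp add: M_def NR.centralizer_product_def grp_of_simps(1))
  have M: "subgroup M (NG R)"
    unfolding M_def using NR.subgroup_centralizer_product[OF OR(3,4)] OR(6,7) by simp
  have NSM: "?NS \<subseteq> M" unfolding M_def using NR.subset_centralizer_product[OF OR(4)] .
  have XM: "?X \<subseteq> M"
  proof
    fix y assume "y \<in> ?X"
    then obtain t where t: "t \<in> ?T" "y = pconj L g t" by blast
    have tN: "t \<in> NL P" using t TN by blast
    obtain s where s: "s \<in> ?NS" "\<And>x. x \<in> P \<Longrightarrow> \<phi> (gconj GS t x) = gconj GS s (\<phi> x)"
      and tS: "t \<in> normalizer GS P"
      using t(1) F.mem_extension_domain[OF \<phi>] by blast
    have "gconj (NG R) y r = gconj (NG R) s r" if r: "r \<in> R" for r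
    proof -
      obtain x where x: "x \<in> P" "r = pconj L g x" using r gP by blast
      have sS: "t \<in> S" "s \<in> S" "x \<in> S" "r \<in> S"
        using t(1) subgroup.subset[OF T(1)] subgroup.mem_carrier[OF F.subgroup_normalizer'[OF sR] s(1)]
          x(1) object_subset[OF P] r object_subset[OF R] by (auto simp: carrier_GS)
      have tx: "gconj GS t x \<in> P" using GS.normalizer_memD[OF sP tS x(1)] .
      have "gconj (NG R) y r = pconj L g (gconj (NG P) t x)"
        using h.hom_gconj[of t x] tN x OP(5) t(2) by (auto simp: grp_of_simps(1))
      also have "gconj (NG P) t x = gconj GS t x"
        using NG_gconj[OF P tN] gconj_grp_of(1)[OF S_subgroup sS(1,3)] x(1) OP(5) by auto
      also have "pconj L g (gconj GS t x) = gconj GS s (\<phi> x)" using g(2) tx s(2)[OF x(1)] by simp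
      also have "\<dots> = gconj GS s r" using g(2) x by simp
      also have "\<dots> = gconj (NG R) s r"
        using NG_gconj[OF R subsetD[OF OR(6) s(1)] subsetD[OF OR(5) r]] gconj_grp_of(1)[OF S_subgroup sS(2,4)] by simp
      finally show ?thesis .
    qed
    moreover have "y \<in> NL R" using subgroup.mem_carrier[OF X \<open>y \<in> ?X\<close>] by (simp add: grp_of_simps(1))
    ultimately show "y \<in> M" unfolding Mmem using s(1) by blast
  qed
  interpret MG: group "(NG R)\<lparr>carrier := M\<rparr>" using NR.subgroup_imp_group[OF M] .
  have finN: "finite (carrier (NG R))" using OR(2) by (simp add: grp_of_simps(1))
  have finM: "finite M" using finite_subset[OF subgroup.subset[OF M] finN] .
  have sylM: "sylow_subgroup p ((NG R)\<lparr>carrier := M\<rparr>) ?NS"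
    using NR.sylow_in_subgroup[OF finN prime_p syl M NSM] .
  obtain a where a: "a \<in> M" "\<forall>x\<in>?X. a \<otimes>\<^bsub>NG R\<^esub> x \<otimes>\<^bsub>NG R\<^esub> inv\<^bsub>(NG R)\<lparr>carrier := M\<rparr>\<^esub> a \<in> ?NS"
    using MG.p_subgroup_conjugate_into[OF _ prime_p sylM NR.subgroup_incl[OF X M XM] m] finM by auto
  let ?k = "inv\<^bsub>NG R\<^esub> a"
  have aN: "a \<in> carrier (NG R)" using subgroup.mem_carrier[OF M a(1)] .
  have kM: "?k \<in> M" using subgroup.m_inv_closed[OF M a(1)] .
  then have kN: "?k \<in> NL R" by (simp add: Mmem)
  have conj: "pconj L ?k x \<in> ?NS" if x: "x \<in> ?X" for x
  proof -
    have xN: "x \<in> NL R" using subgroup.mem_carrier[OF X x] by (simp add: grp_of_simps(1))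
    have "gconj (NG R) ?k x \<in> ?NS"
      unfolding gconj_def NR.inv_inv[OF aN] using bspec[OF a(2) x] NR.m_inv_consistent[OF M a(1)] by simp
    then show ?thesis using NG_gconj[OF R kN xN] by simp
  qed
  obtain s where s: "s \<in> ?NS" "\<forall>x\<in>R. gconj (NG R) ?k x = gconj (NG R) s x" using kM Mmem by blast
  have sS: "s \<in> S" using subgroup.mem_carrier[OF F.subgroup_normalizer'[OF sR] s(1)] by (simp add: carrier_GS)
  have v: "via P [g, ?k]" using g(1) gP via_normalizer[OF R kN] by simp
  let ?e = "wprod L [g, ?k]"
  have e: "t \<in> conj_dom L ?e" "pconj L ?e t = pconj L ?k (pconj L g t)" if "t \<in> ?T" for t
    using via_pconj[OF v, of t] that TN by auto
  have ec: "?e \<in> carrier L" using wprod_closed[OF via_words[OF v]] .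
  have TS: "?T \<subseteq> S_elt L S ?e"
  proof
    fix t assume t: "t \<in> ?T"
    have "pconj L ?e t \<in> ?NS" using conj e(2)[OF t] t by simp
    then have "pconj L ?e t \<in> S" using subgroup.mem_carrier[OF F.subgroup_normalizer'[OF sR]] by (simp add: carrier_GS)
    then show "t \<in> S_elt L S ?e" using e(1)[OF t] t subgroup.subset[OF T(1)] by (auto simp: S_elt_def carrier_GS)
  qed
  have "F.mor (pconj L ?e) ?T" unfolding mor_words
    using T(1) TS ec by (intro conjI exI[of _ "[?e]"]) (auto simp: S_elt_def)
  moreover have "F.mor (gconj GS (inv\<^bsub>GS\<^esub> s)) (carrier GS)"
    using F.mor_gconj[OF GS.subgroup_self GS.inv_closed] sS by (simp add: carrier_GS)
  ultimately have \<theta>: "F.mor (gconj GS (inv\<^bsub>GS\<^esub> s) \<circ> pconj L ?e) ?T" (is "F.mor ?\<theta> _")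
    using F.mor_comp subgroup.subset[OF F.mor_subgroup(2)] by blast
  have "?\<theta> x = \<phi> x" if x: "x \<in> P" for x
  proof -
    have gx: "pconj L g x = \<phi> x" "\<phi> x \<in> R" using g(2) x \<phi>(2) by auto
    have rS: "\<phi> x \<in> S" using gx(2) object_subset[OF R] by blast
    have "pconj L ?e x = pconj L ?k (\<phi> x)" using e(2)[of x] T(2) x gx(1) by auto
    also have "\<dots> = gconj (NG R) ?k (\<phi> x)" using NG_gconj[OF R kN] gx(2) OR(5) by auto
    also have "\<dots> = gconj (NG R) s (\<phi> x)" using s(2) gx(2) by blast
    also have "\<dots> = pconj L s (\<phi> x)" using NG_gconj[OF R, of s] s(1) OR(5,6) gx(2) by auto
    also have "\<dots> = gconj GS s (\<phi> x)" using gconj_grp_of(1)[OF S_subgroup sS rS] by simp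
    finally show ?thesis using GS.gconj_inv(1)[of s "\<phi> x"] sS rS by (simp add: carrier_GS)
  qed
  moreover have "restrict ?\<theta> ?T \<in> FS ?T (carrier GS)"
    using F.mor_mem[OF \<theta> GS.subgroup_self subgroup.subset[OF F.mor_subgroup(2)[OF \<theta>]]] .
  ultimately show "\<exists>\<psi>\<in>FS ?T (carrier GS). \<forall>x\<in>P. \<psi> x = \<phi> x"
    using T(2) by (intro bexI[of _ "restrict ?\<theta> ?T"]) auto
qed

text \<open>
  By downward induction on the order of P. Let Q be the conjugate of P whose normalizer N in S is
  largest, and suppose that N is not a Sylow subgroup of the normalizer of Q in the locality. Then
  a p-group M, larger than N, normalizes Q and N. If Q is S, this contradicts the maximality of S
  among the p-subgroups. Otherwise N is larger than Q and has, by induction, a conjugate N' whose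
  normalizer in S is Sylow. So M, after the conjugation g from N to N' and a further conjugation
  by k in N(N'), lies in S, and it normalizes the image of Q. This contradicts the choice of Q.
\<close>

lemma sylow_conjugate_object:
  "P \<in> \<Delta> \<Longrightarrow> \<exists>f. F.mor f P \<and> sylow_subgroup p (NG (f ` P)) (normalizer GS (f ` P))"
proof (induction "card S - card P" arbitrary: P rule: less_induct)
  case less
  note P = less.prems
  have sP: "subgroup P GS" using objects_subgroups[OF P] .
  obtain f where f: "F.mor f P" "\<forall>g. F.mor g P \<longrightarrow> card (normalizer GS (g ` P)) \<le> card (normalizer GS (f ` P))"
    by (rule F.largest_normalizer_in_class[OF sP])
  let ?Q = "f ` P" and ?N = "normalizer GS (f ` P)"
  have Q: "?Q \<in> \<Delta>" using mor_image_object[OF P f(1)] .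
  have sQ: "subgroup ?Q GS" using objects_subgroups[OF Q] .
  note OQ = object_normalizer_subgroups[OF Q]
  interpret NQ: group "NG ?Q" using OQ(1) .
  have sN: "subgroup ?N GS" using F.subgroup_normalizer'[OF sQ] .
  have QN: "?Q \<subseteq> ?N" using GS.subset_normalizer[OF sQ] .
  have NO: "?N \<in> \<Delta>" using overgroup_object[OF Q sN QN] .
  have "sylow_subgroup p (NG ?Q) ?N"
  proof (rule ccontr)
    assume ns: "\<not> sylow_subgroup p (NG ?Q) ?N"
    obtain n where n: "card ?N = p ^ n" using F.subgroup_p_power[OF sN] by (elim exE)
    obtain M m where M: "subgroup M (NG ?Q)" "card M = p ^ m" "?N \<subset> M" "\<And>t. t \<in> M \<Longrightarrow> gconj (NG ?Q) t ` ?N = ?N"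
      using NQ.nonsylow_enlarge[OF _ prime_p OQ(4) n ns] OQ(2) by (auto simp: grp_of_simps(1))
    have pgM: "pg_subgroup M L" using pg_subgroup_subgroup[OF normalizer_subgroup[OF Q] M(1)] .
    have MNQ: "M \<subseteq> NL ?Q" using subgroup.subset[OF M(1)] by (simp add: grp_of_simps(1))
    have finM: "finite M" using finite_subset[OF MNQ OQ(2)] .
    have MNN: "M \<subseteq> NL ?N"
    proof
      fix t assume t: "t \<in> M"
      then have tN: "t \<in> NL ?Q" using MNQ by blast
      have "x \<in> conj_dom L t \<and> gconj (NG ?Q) t x = pconj L t x" if "x \<in> ?N" for x
        using gconj_grp_of[OF normalizer_subgroup[OF Q] tN, of x] that OQ(6) by auto
      moreover from this have "pconj L t ` ?N = gconj (NG ?Q) t ` ?N" by (intro image_cong) auto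
      ultimately show "t \<in> NL ?N"
        using M(4)[OF t] pg_subgroup_closed(1)[OF pgM] t by (auto simp: pg_normalizer_def)
    qed
    have "?Q \<noteq> S"
    proof
      assume QS: "?Q = S"
      then have "S \<subseteq> M" using QN M(3) by auto
      then have "M = S" using S_maximal[of M] pgM M(2) by (auto simp: pg_p_subgroup_def)
      moreover have "?N \<subseteq> S" using subgroup.subset[OF sN] by (simp add: carrier_GS)
      ultimately show False using M(3) QN QS by auto
    qed
    then have QS: "?Q \<subset> carrier GS" using subgroup.subset[OF sQ] by (auto simp: carrier_GS)
    obtain t where "t \<in> carrier GS - ?Q" "t \<in> ?N"
      using F.proper_subgroup_normalizer[OF GS.subgroup_self sQ QS] by blast
    then have "?Q \<subset> ?N" using QN by blast
    then have "card P < card ?N" using psubset_card_mono[OF F.finite_subgroup[OF sN]] F.mor_card[OF f(1)] by metis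
    moreover have "card ?N \<le> card S" using card_mono[OF finite_S object_subset[OF NO]] .
    ultimately have "card S - card ?N < card S - card P" by linarith
    then obtain h where h: "F.mor h ?N" "sylow_subgroup p (NG (h ` ?N)) (normalizer GS (h ` ?N))"
      using less.hyps[OF _ NO] by blast
    let ?N' = "h ` ?N"
    have N': "?N' \<in> \<Delta>" using mor_image_object[OF NO h(1)] .
    note ON' = object_normalizer_subgroups[OF N']
    obtain g where g: "via ?N [g]" "\<forall>x\<in>?N. h x = pconj L g x" using h(1) mor_object[OF NO] by blast
    have gN: "pconj L g ` ?N = ?N'" using g(2) by (intro image_cong) auto
    interpret N': group "NG ?N'" using ON'(1) .
    interpret c: group_hom "NG ?N" "NG ?N'" "pconj L g" using pconj_group_hom[OF g(1)] gN by simp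
    have MN: "subgroup M (NG ?N)" using subgroup_transfer[OF normalizer_subgroup[OF Q] normalizer_subgroup[OF NO] M(1) MNN] .
    let ?X = "pconj L g ` M"
    have X: "subgroup ?X (NG ?N')" using c.subgroup_img_is_subgroup[OF MN] .
    have "card ?X dvd p ^ m" using dvdI[OF c.card_image_kernel[OF MN, symmetric]] M(2) by simp
    then obtain l where l: "card ?X = p ^ l" using divides_primepow_nat[OF prime_p] by auto
    obtain a where a: "a \<in> NL ?N'" "\<forall>x\<in>?X. a \<otimes>\<^bsub>NG ?N'\<^esub> x \<otimes>\<^bsub>NG ?N'\<^esub> inv\<^bsub>NG ?N'\<^esub> a \<in> normalizer GS ?N'"
      using N'.p_subgroup_conjugate_into[OF _ prime_p h(2) X l] ON'(2) by (auto simp: grp_of_simps(1))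
    let ?k = "inv\<^bsub>NG ?N'\<^esub> a"
    have aN: "a \<in> carrier (NG ?N')" using a(1) by (simp add: grp_of_simps(1))
    have kN: "?k \<in> NL ?N'" using N'.inv_closed[OF aN] by (simp add: grp_of_simps(1))
    have conj: "pconj L ?k x \<in> S" if x: "x \<in> ?X" for x
    proof -
      have xN: "x \<in> NL ?N'" using subgroup.mem_carrier[OF X x] by (simp add: grp_of_simps(1))
      have "gconj (NG ?N') ?k x \<in> normalizer GS ?N'" unfolding gconj_def N'.inv_inv[OF aN] using a(2) x by (rule bspec)
      then show ?thesis
        using NG_gconj[OF N' kN xN] subgroup.mem_carrier[OF F.subgroup_normalizer'[OF objects_subgroups[OF N']]]
        by (simp add: carrier_GS)
    qed
    have v: "via ?N [g, ?k]" using g(1) gN via_normalizer[OF N' kN] by simp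
    let ?e = "wprod L [g, ?k]"
    have ec: "?e \<in> carrier L" using wprod_closed[OF via_words[OF v]] .
    have e: "t \<in> conj_dom L ?e" "pconj L ?e t \<in> S" if "t \<in> M" for t
      using via_pconj[OF v, of t] that MNN conj by auto
    have "?Q \<subseteq> S_elt L S ?e"
    proof
      fix x assume x: "x \<in> ?Q"
      then have "x \<in> M" using QN M(3) by blast
      then show "x \<in> S_elt L S ?e" using e x object_subset[OF Q] by (auto simp: S_elt_def)
    qed
    then have vQ: "via ?Q [?e]" using via_S_elt[OF Q ec] by simp
    then have "F.mor (pconj L ?e) ?Q" using mor_object[OF Q] by blast
    then have "F.mor (pconj L ?e \<circ> f) P" using F.mor_comp[OF f(1)] by blast
    then have "card (normalizer GS ((pconj L ?e \<circ> f) ` P)) \<le> card ?N" using f(2) by blast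
    then have le: "card (normalizer GS (pconj L ?e ` ?Q)) \<le> card ?N" by (simp only: image_comp)
    have Qe: "pconj L ?e ` ?Q \<in> \<Delta>" using vQ by simp
    have "pconj L ?e ` M \<subseteq> normalizer GS (pconj L ?e ` ?Q)"
    proof (rule image_subsetI)
      fix t assume t: "t \<in> M"
      then have "pconj L ?e t \<in> NL (pconj L ?e ` ?Q)" using normalizer_pconj[OF _ vQ] MNQ by blast
      then show "pconj L ?e t \<in> normalizer GS (pconj L ?e ` ?Q)"
        using e(2)[OF t] object_normalizes(2)[OF Qe] by blast
    qed
    moreover have "card (pconj L ?e ` M) = card M"
      using card_image[OF inj_on_subset[OF pconj_inj[OF ec]]] e(1) by blast
    ultimately have "card M \<le> card (normalizer GS (pconj L ?e ` ?Q))"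
      using card_mono[OF F.finite_subgroup[OF F.subgroup_normalizer'[OF objects_subgroups[OF Qe]]]] by metis
    moreover have "card ?N < card M" using psubset_card_mono[OF finM M(3)] .
    ultimately show False using le by simp
  qed
  then show ?case using f(1) by blast
qed

lemma saturated_at_object:
  assumes P: "P \<in> \<Delta>"
  shows "F.saturated_at P"
proof -
  obtain f where f: "F.mor f P" "sylow_subgroup p (NG (f ` P)) (normalizer GS (f ` P))"
    using sylow_conjugate_object[OF P] by blast
  note R = mor_image_object[OF P f(1)]
  show ?thesis unfolding F.saturated_at_def
    using f(1) fully_automized_object[OF R f(2)] receptive_object[OF R f(2)] by blast
qed

end

section \<open>Proper localities\<close>

theorem theoremB:
  fixes p :: nat and L :: "('a, 'b) partial_grp_scheme"
    and \<Delta> :: "'a set set" and S :: "'a set"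
  assumes "prime p"
    and "proper_locality p L \<Delta> S"
  shows "saturated_fusion_system p (grp_of L S) (locality_fusion L S)"
proof -
  interpret proper_locality p L \<Delta> S using assms(2) .
  interpret prime_locality p L \<Delta> S using assms(1) by unfold_locales
  show ?thesis
    using F.saturated_from_generating_family[OF objects_generate saturated_at_object centric_radicals_subset] .
qed

end
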